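(* Let $\varepsilon$ be given with $\frac25<\varepsilon<\frac12$. Then there are real numbers $\delta>0$ and $\alpha>0$ such that $$\tfrac25<\varepsilon<\tfrac12<\delta<1-\varepsilon<1,\qquad 0<\tfrac12-\varepsilon<\alpha<\tfrac\varepsilon4<\tfrac16.$$ Moreover, for any fixed $\varepsilon$, $\delta$, $\alpha$ satisfying these inequalities, there are a $t_0\ge1$ and a constant $A$, independent of $s$ (that is, of both $\sigma$ and $t$), such that for every $s=\sigma+it$ with $t\ge t_0$ and $t^{\delta}\ge 1-\sigma\ge t^{\varepsilon}$ we have $$\mathcal R(s)=-\chi(s)\,\eta^{s-1}e^{-\pi i\eta^2}\,\frac{\sqrt2\,e^{3\pi i/8}\sin\pi\eta}{2\cos2\pi\eta}\,(1+U),\qquad |U|\le A\,t^{4\alpha-\varepsilon},$$ where $U=U(s)$ is a complex number depending on $s$.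
   Context: For $s=\sigma+it$ with $\sigma,t$ real. Riemann's auxiliary function is the entire function $$\mathcal R(s)=\int_{0\swarrow1}\frac{x^{-s}e^{\pi i x^2}}{e^{\pi i x}-e^{-\pi i x}}\,dx,$$ where $0\swarrow1$ denotes a straight line parallel to the direction $e^{i\pi/4}$ crossing the real axis at a point strictly between $0$ and $1$, traversed from upper right to lower left (for instance $x=\frac12-ue^{i\pi/4}$, with $u$ going from $-\infty$ to $+\infty$), and $x^{-s}=\exp(-s\log x)$ with the principal logarithm on $\mathbf{C}\setminus(-\infty,0]$. $\chi(s)=\pi^{s-1/2}\,\Gamma\!\left(\frac{1-s}{2}\right)/\Gamma\!\left(\frac s2\right)$ is the factor in the functional equation $\zeta(s)=\chi(s)\zeta(1-s)$ of the Riemann zeta function. $\eta=\sqrt{\frac{s-1}{2\pi i}}=\eta_1+i\eta_2$ ($\eta_1,\eta_2$ real) is the square root chosen so that $\eta_1+\eta_2>0$. For $s$ with $t>0$ and $1-\sigma>0$ this gives $0<\arg\eta<\frac\pi4$, and $\eta^{s-1}=\exp((s-1)\log\eta)$ with this principal argument. *)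

theory Defs
  imports "HOL-Complex_Analysis.Complex_Analysis"
begin

definition aux_integrand :: "complex \<Rightarrow> complex \<Rightarrow> complex" where
  "aux_integrand s x =
     x powr (- s) * exp (of_real pi * \<i> * x\<^sup>2)
       / (exp (of_real pi * \<i> * x) - exp (- (of_real pi * \<i> * x)))"

text \<open>
  The line of slope 1 through \<open>c\<close> on the real axis, run from upper right to lower left.
\<close>

definition aux_line :: "real \<Rightarrow> real \<Rightarrow> complex" where
  "aux_line c u = of_real c - of_real u * cis (pi / 4)"

text \<open>
  The crossing point is fixed at \<open>1/2\<close>. By Cauchy's theorem, every crossing point strictly between
  0 and 1 gives the same value. The integral converges absolutely (the integrand decays like
  \<open>exp (- pi * u\<^sup>2)\<close> up to factors of exponential order 1), and \<open>- cis (pi / 4)\<close> is the derivative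
  of the line.
\<close>

definition riemann_aux :: "complex \<Rightarrow> complex" where
  "riemann_aux s =
     (\<integral>u. aux_integrand s (aux_line (1 / 2) u) * (- cis (pi / 4)) \<partial>lborel)"

definition zeta_chi :: "complex \<Rightarrow> complex" where
  "zeta_chi s = of_real pi powr (s - 1 / 2) * Gamma ((1 - s) / 2) / Gamma (s / 2)"

text \<open>
  The value is well defined unless \<open>(s - 1) / (2 * pi * \<i>)\<close> is \<open>- \<i>\<close> times a nonnegative real,
  that is, unless \<open>s\<close> is real and \<open>s \<ge> 1\<close>.
\<close>

definition saddle_eta :: "complex \<Rightarrow> complex" where
  "saddle_eta s = (THE w. w\<^sup>2 = (s - 1) / (2 * of_real pi * \<i>) \<and> Re w + Im w > 0)"

end

theory Submission
  imports Defs "HOL-Probability.Probability" "HOL-Real_Asymp.Real_Asymp"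
begin

text \<open>
  Shifting the line of integration to the right past the poles \<open>1, \<dots>, N\<close> turns \<open>\<R>(s)\<close> into the sum of
  the \<open>n\<^sup>-\<^sup>s\<close> with \<open>n \<le> N\<close> plus an integral along a line close to the saddle point \<open>\<eta>\<close> of
  \<open>x\<^sup>1\<^sup>-\<^sup>s exp (\<pi> \<i> x\<^sup>2)\<close>, which lies slightly above the real axis. Both parts sample the same function
  \<open>x\<^sup>-\<^sup>s exp (\<pi> \<i> x\<^sup>2)\<close>. Replace it by its second order approximation at the saddle, the Gaussian
  \<open>\<eta>\<^sup>-\<^sup>s exp (\<pi> \<i> \<eta>\<^sup>2) exp (2 \<pi> \<i> (x - \<eta>)\<^sup>2)\<close>. Then the sum becomes a geometric series, the integral a
  Mordell integral, and together they equal \<open>sin \<pi>\<eta> / cos 2\<pi>\<eta>\<close> up to a constant. With \<open>b = Im \<eta>\<close>,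
  the replacement costs a factor \<open>O((k + k\<^sup>3) / |\<eta>|)\<close> at distance \<open>k\<close> from the saddle, where the terms of
  the sum have the relative size \<open>exp (- 4 \<pi> b k)\<close>. The error relative to the main term is therefore
  \<open>O((1 + 1/b)\<^sup>5 / |\<eta>|)\<close>, that is \<open>O(t\<^sup>2\<^sup>-\<^sup>5\<^sup>\<epsilon>)\<close>, and \<open>2 - 5\<epsilon> < 4\<alpha> - \<epsilon>\<close>. Finally, Stirling's formula for
  \<open>\<Gamma>(1 - s)\<close> expresses \<open>\<eta>\<^sup>-\<^sup>s exp (\<pi> \<i> \<eta>\<^sup>2)\<close> through \<open>\<chi>(s) \<eta>\<^sup>s\<^sup>-\<^sup>1 exp (- \<pi> \<i> \<eta>\<^sup>2)\<close>.
\<close>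

section \<open>Stirling's formula in the right half-plane\<close>

text \<open>The height \<open>b = Im \<eta>\<close> is not confined to a bounded range: up to
  constants it can be as small as \<open>t powr (\<epsilon> - 1/2)\<close> and as large as
  \<open>t powr (\<delta> - 1/2)\<close>, so every estimate has to be uniform in \<open>b\<close>.
  For large \<open>b\<close> the main term has size \<open>exp (- pi * b)\<close>, and both sources
  of error must keep this factor: the sum spends part of its decay on it, the integral takes it from
  the growth of the kernel. For small \<open>b\<close> the sum decays slowly. The factor
  \<open>k ^ 3\<close> costs \<open>1 / b ^ 3\<close>, the summation over \<open>k\<close> costs
  \<open>1 / b\<close>, and the lower bound for the sine, which vanishes at the integers, costs the
  fifth factor. The real point \<open>Re \<eta>\<close> lies at distance \<open>b\<close> from the
  saddle and is compared with it, so \<open>b ^ 3\<close> must be small against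
  \<open>Re \<eta>\<close>; this is where \<delta> < 1 - \<epsilon> < 3/5 enters. The line need not
  meet the saddle. It crosses the axis at a half-integer, which keeps it away from the poles, and
  misses \<eta> horizontally by at most 1/2.\<close>

lemma Ln_quotient:
  assumes "x \<noteq> 0" "z \<noteq> 0" "- pi < Im (Ln x) - Im (Ln z)" "Im (Ln x) - Im (Ln z) \<le> pi"
  shows "Ln (x / z) = Ln x - Ln z"
proof -
  have "x / z = exp (Ln x - Ln z)"
    using assms(1,2) by (simp add: exp_diff)
  moreover have "Ln (exp (Ln x - Ln z)) = Ln x - Ln z"
    by (rule Ln_exp) (use assms(3,4) in auto)
  ultimately show ?thesis by simp
qed

section \<open>Third-order remainder of the logarithm\<close>

lemma norm_one_plus_ge_half:
  fixes w :: complex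
  assumes "Re w \<ge> 0 \<or> norm w \<le> 1/2"
  shows "norm (1 + w) \<ge> 1/2"
  using assms
proof
  assume "Re w \<ge> 0"
  then have "1 \<le> Re (1 + w)" by simp
  also have "\<dots> \<le> norm (1 + w)" by (rule complex_Re_le_cmod)
  finally show ?thesis by simp
next
  assume "norm w \<le> 1/2"
  moreover have "norm (1 + w) \<ge> norm (1::complex) - norm w"
    using norm_diff_ineq[of 1 w] by simp
  ultimately show ?thesis by simp
qed

text \<open>The remainder has derivative \<open>u\<^sup>2 / (1 + u)\<close>, and both alternatives
  of the hypothesis pass to the whole segment from 0 to \<open>w\<close>, where they give
  \<open>norm (1 + u) \<ge> 1/2\<close>. Stirling's formula uses the first alternative, with
  \<open>w\<close> of any size; the saddle comparison uses the second.\<close>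

lemma norm_Ln_cubic_le:
  fixes w :: complex
  assumes w: "Re w \<ge> 0 \<or> norm w \<le> 1/2"
  shows "norm (Ln (1 + w) - w + w\<^sup>2 / 2) \<le> 2 * norm w ^ 3"
proof -
  let ?S = "closed_segment 0 w"
  let ?f = "\<lambda>u::complex. Ln (1 + u) - u + u\<^sup>2 / 2"
  have seg: "norm u \<le> norm w \<and> (Re u \<ge> 0 \<or> norm u \<le> 1/2)" if u: "u \<in> ?S" for u
  proof -
    obtain c where c: "0 \<le> c" "c \<le> 1" "u = of_real c * w"
      using u by (auto simp: in_segment scaleR_conv_of_real)
    have "norm u = c * norm w" using c by (simp add: norm_mult)
    also have "\<dots> \<le> norm w" using c by (simp add: mult_left_le_one_le)
    finally have "norm u \<le> norm w" .
    moreover have "Re u = c * Re w" using c by simp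
    ultimately show ?thesis using w c(1) by auto
  qed
  have "norm (?f w - ?f 0) \<le> (2 * (norm w)\<^sup>2) * norm (w - 0)"
  proof (rule field_differentiable_bound)
    show "convex ?S" by simp
    fix u assume u: "u \<in> ?S"
    have n: "norm (1 + u) \<ge> 1/2" using seg[OF u] norm_one_plus_ge_half by blast
    then have nz: "1 + u \<noteq> 0" by force
    have np: "1 + u \<notin> \<real>\<^sub>\<le>\<^sub>0"
    proof -
      have "Re (1 + u) > 0"
      proof -
        have "Re u \<ge> 0 \<or> \<bar>Re u\<bar> \<le> 1/2"
          using seg[OF u] abs_Re_le_cmod[of u] by linarith
        then show ?thesis by auto
      qed
      then show ?thesis by (auto simp: complex_nonpos_Reals_iff)
    qed
    have "(?f has_field_derivative (1 / (1 + u) - 1 + u)) (at u)"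
      by (rule derivative_eq_intros refl np | simp add: np field_simps)+
    then show "(?f has_field_derivative (1 / (1 + u) - 1 + u)) (at u within ?S)"
      by (rule has_field_derivative_at_within)
    have "1 / (1 + u) - 1 + u = u\<^sup>2 / (1 + u)"
      using nz by (simp add: field_simps power2_eq_square)
    also have "norm \<dots> = (norm u)\<^sup>2 / norm (1 + u)" by (simp add: norm_divide norm_power)
    also have "\<dots> \<le> (norm w)\<^sup>2 / (1/2)"
      using n seg[OF u] by (intro frac_le power_mono) auto
    finally show "norm (1 / (1 + u) - 1 + u) \<le> 2 * (norm w)\<^sup>2" by simp
  qed auto
  then show ?thesis by (simp add: power3_eq_cube power2_eq_square mult.assoc)
qed

definition stirling_exponent :: "complex \<Rightarrow> complex" where
  "stirling_exponent z = (z - 1/2) * Ln z - z"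

text \<open>The logarithmic defect of Stirling's approximation in the functional equation
  \<open>Gamma (z + 1) = z * Gamma z\<close>.\<close>

definition stirling_step :: "complex \<Rightarrow> complex" where
  "stirling_step z = stirling_exponent (z + 1) - stirling_exponent z - Ln z"

lemma Ln_quotient_right_half_plane:
  assumes "Re x > 0" "Re z > 0"
  shows "Ln (x / z) = Ln x - Ln z"
proof -
  have "x \<noteq> 0" "z \<noteq> 0" using assms by auto
  moreover have "\<bar>Im (Ln x)\<bar> < pi/2" "\<bar>Im (Ln z)\<bar> < pi/2"
    using Re_Ln_pos_lt[of x] Re_Ln_pos_lt[of z] assms \<open>x \<noteq> 0\<close> \<open>z \<noteq> 0\<close> by auto
  ultimately show ?thesis by (intro Ln_quotient) auto
qed

text \<open>In powers of \<open>y = 1 / z\<close> the constant and the linear term cancel; the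
  linear one does so because of the shift 1/2 in \<open>stirling_exponent\<close>. What remains is
  quadratic in \<open>y\<close>, hence summable along \<open>z + n\<close>.\<close>

lemma norm_stirling_step_le:
  assumes z: "Re z \<ge> 1"
  shows "norm (stirling_step z) \<le> 4 / (norm z)\<^sup>2"
proof -
  define y where "y = 1 / z"
  have nz: "z \<noteq> 0" using z by auto
  have y0: "y \<noteq> 0" using nz by (simp add: y_def)
  have zy: "z = 1 / y" using nz by (simp add: y_def)
  have "norm z \<ge> 1" using z complex_Re_le_cmod[of z] by linarith
  then have y1: "norm y \<le> 1" by (simp add: y_def norm_divide divide_le_eq_1)
  have Rey: "Re y \<ge> 0" using z by (simp add: y_def Re_divide)
  define E where "E = Ln (1 + y) - y + y\<^sup>2 / 2"
  have E: "norm E \<le> 2 * norm y ^ 3" unfolding E_def using norm_Ln_cubic_le Rey by blast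
  have "(z + 1) / z = 1 + y" using nz by (simp add: y_def field_simps)
  then have L: "Ln (1 + y) = Ln (z + 1) - Ln z"
    using Ln_quotient_right_half_plane[of "z+1" z] z by simp
  have "stirling_step z = (z + 1/2) * (Ln (z + 1) - Ln z) - 1"
    by (simp add: stirling_step_def stirling_exponent_def algebra_simps)
  also have "\<dots> = (1/y + 1/2) * (E + y - y\<^sup>2/2) - 1"
    by (simp add: L[symmetric] zy[symmetric] E_def)
  also have "\<dots> = E / y - y\<^sup>2 / 4 + E / 2"
    using y0 by (simp add: field_simps power2_eq_square)
  also have "norm \<dots> \<le> norm (E / y) + norm (y\<^sup>2 / 4) + norm (E / 2)"
    by (meson add_mono norm_triangle_ineq norm_triangle_ineq4 order_trans order_refl)
  also have "\<dots> = norm E / norm y + (norm y)\<^sup>2 / 4 + norm E / 2"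
    by (simp add: norm_divide norm_power)
  also have "\<dots> \<le> 2 * (norm y)\<^sup>2 + (norm y)\<^sup>2 / 4 + (norm y)\<^sup>2"
  proof -
    have "norm E / norm y \<le> 2 * (norm y)\<^sup>2"
      using E y0 by (simp add: field_simps power3_eq_cube power2_eq_square)
    moreover have "norm E \<le> 2 * (norm y)\<^sup>2"
    proof -
      have "norm y ^ 3 \<le> (norm y)\<^sup>2" using y1 by (intro power_decreasing) auto
      then show ?thesis using E by linarith
    qed
    ultimately show ?thesis by linarith
  qed
  also have "\<dots> \<le> 4 * (norm y)\<^sup>2" by simp
  finally show ?thesis by (simp add: y_def norm_divide power_divide)
qed

lemma norm_add_of_nat_ge:
  assumes "Re z \<ge> 0"
  shows "(norm z + real k)\<^sup>2 \<le> 2 * (norm (z + of_nat k))\<^sup>2"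
proof -
  have "(norm (z + of_nat k))\<^sup>2 = (norm z)\<^sup>2 + 2 * real k * Re z + (real k)\<^sup>2"
    unfolding cmod_power2 by (simp add: power2_eq_square algebra_simps)
  then have "(norm (z + of_nat k))\<^sup>2 \<ge> (norm z)\<^sup>2 + (real k)\<^sup>2" using assms by simp
  then have "2 * ((norm z)\<^sup>2 + (real k)\<^sup>2) \<le> 2 * (norm (z + of_nat k))\<^sup>2"
    by (intro mult_left_mono) auto
  moreover have "(norm z + real k)\<^sup>2 \<le> 2 * ((norm z)\<^sup>2 + (real k)\<^sup>2)"
    using sum_squares_bound[of "norm z" "real k"] by (simp add: power2_eq_square algebra_simps)
  ultimately show ?thesis by (rule order_trans[rotated])
qed

text \<open>In the right half-plane \<open>norm (z + of_nat k)\<close> is comparable with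
  \<open>norm z + real k\<close>, so the sum is dominated by a telescoping one. The bound is free of
  \<open>n\<close> and therefore survives the passage to the limit.\<close>

lemma norm_sum_stirling_step_le:
  assumes z: "Re z \<ge> 1"
  shows "norm (\<Sum>k<n. stirling_step (z + of_nat k)) \<le> 16 / norm z"
proof -
  define r where "r = norm z"
  have r: "r \<ge> 1" using z complex_Re_le_cmod[of z] by (simp add: r_def)
  have "norm (\<Sum>k<n. stirling_step (z + of_nat k)) \<le> 16 / r - 16 / (r + real n)"
  proof (induction n)
    case (Suc n)
    have "norm (stirling_step (z + of_nat n)) \<le> 4 / (norm (z + of_nat n))\<^sup>2"
      using z by (intro norm_stirling_step_le) auto
    also have "\<dots> \<le> 8 / (r + real n)\<^sup>2"
    proof -
      have p: "(r + real n)\<^sup>2 > 0" using r by (intro zero_less_power) linarith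
      have le: "(r + real n)\<^sup>2 \<le> 2 * (norm (z + of_nat n))\<^sup>2"
        using norm_add_of_nat_ge[of z n] z by (simp add: r_def)
      then have "4 / (norm (z + of_nat n))\<^sup>2 \<le> 4 / ((r + real n)\<^sup>2 / 2)"
        using p by (intro divide_left_mono mult_pos_pos) auto
      then show ?thesis by simp
    qed
    also have "\<dots> \<le> 16 / (r + real n) - 16 / (r + real (Suc n))"
    proof -
      define q where "q = r + real n"
      have q: "q \<ge> 1" using r by (simp add: q_def)
      have "8 / q\<^sup>2 \<le> 16 / (q * (q + 1))"
      proof -
        have "q * (q + 1) \<le> 2 * q\<^sup>2" using q by (simp add: power2_eq_square algebra_simps)
        then have "16 / (2 * q\<^sup>2) \<le> 16 / (q * (q + 1))"
          using q by (intro divide_left_mono mult_pos_pos) auto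
        then show ?thesis by simp
      qed
      also have "\<dots> = 16 / q - 16 / (q + 1)" using q by (simp add: field_simps)
      finally show ?thesis by (simp add: q_def add_ac)
    qed
    finally have "norm (stirling_step (z + of_nat n)) \<le> 16 / (r + real n) - 16 / (r + real (Suc n))" .
    moreover have "norm (\<Sum>k<Suc n. stirling_step (z + of_nat k))
        \<le> norm (\<Sum>k<n. stirling_step (z + of_nat k)) + norm (stirling_step (z + of_nat n))"
      by (simp add: norm_triangle_ineq)
    ultimately show ?case using Suc by linarith
  qed simp
  also have "\<dots> \<le> 16 / r" using r by simp
  finally show ?thesis by (simp add: r_def)
qed

definition stirling_quotient :: "complex \<Rightarrow> complex" where
  "stirling_quotient z = Gamma z * exp (- stirling_exponent z)"

text \<open>
  Stirling's formula says that this quotient tends to \<open>sqrt (2 * pi)\<close>. Its increments are summable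
  along \<open>z + n\<close>, and Euler's product shows that the limit does not depend on \<open>z\<close>; Legendre's
  duplication formula then identifies it.
\<close>

lemma stirling_quotient_shift:
  assumes z: "Re z > 0"
  shows "stirling_quotient (z + of_nat n)
       = stirling_quotient z * exp (- (\<Sum>k<n. stirling_step (z + of_nat k)))"
proof (induction n)
  case (Suc n)
  define w where "w = z + of_nat n"
  have w: "Re w > 0" using z by (simp add: w_def)
  then have "w \<noteq> 0" "w \<notin> \<int>\<^sub>\<le>\<^sub>0"
    by (auto elim!: nonpos_Ints_cases)
  then have "stirling_quotient (w + 1) = Gamma w * exp (Ln w) * exp (- stirling_exponent (w + 1))"
    by (simp add: stirling_quotient_def Gamma_plus1)
  also have "\<dots> = stirling_quotient w * exp (- stirling_step w)"
    by (simp add: stirling_quotient_def stirling_step_def mult.assoc flip: exp_add)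
  finally have "stirling_quotient (w + 1) = stirling_quotient w * exp (- stirling_step w)" .
  then show ?case using Suc by (simp add: w_def add_ac exp_add exp_diff exp_minus field_simps)
qed simp

text \<open>The term with \<open>ln (real n)\<close> matches the power of \<open>n\<close> in
  Euler's product for the Gamma function.\<close>

lemma stirling_exponent_diff_tendsto:
  assumes z: "Re z > 0"
  shows "(\<lambda>n. stirling_exponent (of_nat n) - stirling_exponent (z + of_nat n) + z * of_real (ln (real n))) \<longlonglongrightarrow> 0"
proof -
  define w where "w n = z / of_nat n" for n :: nat
  define E where "E n = Ln (1 + w n) - w n + (w n)\<^sup>2 / 2" for n
  have w0: "w \<longlonglongrightarrow> 0"
    unfolding w_def by (rule lim_const_over_n)
  have Rew: "Re (w n) \<ge> 0" for n using z by (simp add: w_def Re_divide)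
  have nE: "(\<lambda>n. of_nat n * E n) \<longlonglongrightarrow> 0"
  proof (rule Lim_null_comparison)
    have "norm (of_nat n * E n) \<le> 2 * norm z * (norm (w n))\<^sup>2" for n
    proof (cases "n = 0")
      case False
      have "norm (of_nat n * E n) \<le> real n * (2 * norm (w n) ^ 3)"
        unfolding norm_mult E_def using norm_Ln_cubic_le[of "w n"] Rew[of n]
        by (intro mult_mono) auto
      also have "\<dots> = 2 * norm z * (norm (w n))\<^sup>2"
        using False by (simp add: w_def norm_divide power3_eq_cube power2_eq_square)
      finally show ?thesis .
    qed simp
    then show "\<forall>\<^sub>F n in sequentially. norm (of_nat n * E n) \<le> 2 * norm z * (norm (w n))\<^sup>2"
      by (rule always_eventually[OF allI])
    show "(\<lambda>n. 2 * norm z * (norm (w n))\<^sup>2) \<longlonglongrightarrow> 0"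
      using tendsto_mult[OF tendsto_const[of "2 * norm z"] tendsto_power[OF tendsto_norm[OF w0], of 2]] by simp
  qed
  have L0: "(\<lambda>n. Ln (1 + w n)) \<longlonglongrightarrow> 0"
  proof -
    have "(\<lambda>n. Ln (1 + w n)) \<longlonglongrightarrow> Ln (1 + 0)"
      by (intro tendsto_intros w0) auto
    then show ?thesis by simp
  qed
  have "(\<lambda>n. z * w n / 2 - of_nat n * E n - (z - 1/2) * Ln (1 + w n)) \<longlonglongrightarrow> z * 0 / 2 - 0 - (z - 1/2) * 0"
    by (intro tendsto_intros w0 nE L0) simp_all
  then have "(\<lambda>n. z * w n / 2 - of_nat n * E n - (z - 1/2) * Ln (1 + w n)) \<longlonglongrightarrow> 0" by simp
  moreover have "\<forall>\<^sub>F n in sequentially. z * w n / 2 - of_nat n * E n - (z - 1/2) * Ln (1 + w n)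
     = stirling_exponent (of_nat n) - stirling_exponent (z + of_nat n) + z * of_real (ln (real n))"
  proof (rule eventually_sequentiallyI[of 1])
    fix n :: nat assume n: "1 \<le> n"
    have "(z + of_nat n) / of_nat n = 1 + w n" using n by (simp add: w_def field_simps)
    then have L: "Ln (z + of_nat n) = Ln (1 + w n) + of_real (ln (real n))"
      using Ln_quotient_right_half_plane[of "z + of_nat n" "of_nat n"] z n
      by (simp add: Ln_of_nat)
    have nw: "of_nat n * w n = z" using n by (simp add: w_def)
    have "stirling_exponent (of_nat n) - stirling_exponent (z + of_nat n) + z * of_real (ln (real n))
        = z - (z - 1/2) * Ln (1 + w n) - of_nat n * Ln (1 + w n)"
      using n by (simp add: stirling_exponent_def L Ln_of_nat algebra_simps)
    also have "of_nat n * Ln (1 + w n) = of_nat n * E n + of_nat n * w n - (of_nat n * w n) * w n / 2"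
      by (simp add: E_def algebra_simps power2_eq_square)
    finally show "z * w n / 2 - of_nat n * E n - (z - 1/2) * Ln (1 + w n)
      = stirling_exponent (of_nat n) - stirling_exponent (z + of_nat n) + z * of_real (ln (real n))"
      by (simp add: nw algebra_simps)
  qed
  ultimately show ?thesis by (rule Lim_transform_eventually)
qed

text \<open>\<open>Gamma (z + of_nat n)\<close> is \<open>Gamma z\<close> times a Pochhammer symbol,
  which Euler's product compares with \<open>fact (n - 1)\<close>. The limit of the Stirling
  quotient is thus the same for every \<open>z\<close>.\<close>

lemma stirling_quotient_ratio_tendsto:
  assumes z: "Re z > 0"
  shows "(\<lambda>n. stirling_quotient (z + of_nat n) / stirling_quotient (of_nat n)) \<longlonglongrightarrow> 1"
proof -
  have zn: "z \<notin> \<int>\<^sub>\<le>\<^sub>0" using z by (auto elim!: nonpos_Ints_cases)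
  have G: "Gamma z \<noteq> 0" using zn by (simp add: Gamma_eq_zero_iff)
  have "(\<lambda>n. Gamma z / Gamma_series' z n * exp (stirling_exponent (of_nat n) - stirling_exponent (z + of_nat n) + z * of_real (ln (real n))))
      \<longlonglongrightarrow> Gamma z / Gamma z * exp 0"
    by (intro tendsto_intros Gamma_series'_LIMSEQ stirling_exponent_diff_tendsto z G)
  then have "(\<lambda>n. Gamma z / Gamma_series' z n * exp (stirling_exponent (of_nat n) - stirling_exponent (z + of_nat n) + z * of_real (ln (real n))))
      \<longlonglongrightarrow> 1" using G by simp
  moreover have "\<forall>\<^sub>F n in sequentially. Gamma z / Gamma_series' z n * exp (stirling_exponent (of_nat n) - stirling_exponent (z + of_nat n) + z * of_real (ln (real n)))
     = stirling_quotient (z + of_nat n) / stirling_quotient (of_nat n)"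
  proof (rule eventually_sequentiallyI[of 1])
    fix n :: nat assume n: "1 \<le> n"
    have g: "Gamma (of_nat n :: complex) = fact (n - 1)"
      using Gamma_fact[of "n-1", where 'a = complex] n by (simp add: of_nat_diff)
    have p: "Gamma (z + of_nat n) = Gamma z * pochhammer z n"
      using pochhammer_Gamma[OF zn, of n] G by simp
    show "Gamma z / Gamma_series' z n * exp (stirling_exponent (of_nat n) - stirling_exponent (z + of_nat n) + z * of_real (ln (real n)))
     = stirling_quotient (z + of_nat n) / stirling_quotient (of_nat n)"
      by (simp add: Gamma_series'_def stirling_quotient_def g p exp_diff exp_minus exp_add field_simps)
  qed
  ultimately show ?thesis by (rule Lim_transform_eventually)
qed

text \<open>The limit is a nonzero value times the exponential of a convergent series, hence not 0.
  This permits cancelling \<open>L\<close> once the duplication formula has produced an equation for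
  it.\<close>

lemma stirling_quotient_of_nat_convergent:
  obtains L where "L \<noteq> 0" "(\<lambda>n. stirling_quotient (of_nat n)) \<longlonglongrightarrow> L"
proof -
  have "summable (\<lambda>k. stirling_step (1 + of_nat k))"
  proof (rule summable_comparison_test')
    show "summable (\<lambda>k. 4 * inverse ((real (Suc k))\<^sup>2))"
      by (intro summable_mult, subst summable_Suc_iff) (use inverse_power_summable[of 2, where 'a=real] in simp)
    fix k :: nat assume "0 \<le> k"
    have "norm (stirling_step (1 + of_nat k)) \<le> 4 / (norm (1 + of_nat k :: complex))\<^sup>2"
      by (intro norm_stirling_step_le) auto
    also have "norm (1 + of_nat k :: complex) = real (Suc k)"
      using norm_of_nat[of "Suc k", where 'a = complex] by simp
    finally show "norm (stirling_step (1 + of_nat k)) \<le> 4 * inverse ((real (Suc k))\<^sup>2)"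
      by (simp add: divide_inverse)
  qed
  then have "(\<lambda>n. \<Sum>k<n. stirling_step (1 + of_nat k)) \<longlonglongrightarrow> (\<Sum>k. stirling_step (1 + of_nat k))" (is "_ \<longlonglongrightarrow> ?s")
    by (rule summable_LIMSEQ)
  then have "(\<lambda>n. stirling_quotient 1 * exp (- (\<Sum>k<n. stirling_step (1 + of_nat k)))) \<longlonglongrightarrow> stirling_quotient 1 * exp (- ?s)"
    by (intro tendsto_intros)
  then have "(\<lambda>n. stirling_quotient (1 + of_nat n)) \<longlonglongrightarrow> stirling_quotient 1 * exp (- ?s)"
    by (simp add: stirling_quotient_shift)
  then have "(\<lambda>n. stirling_quotient (of_nat (Suc n))) \<longlonglongrightarrow> stirling_quotient 1 * exp (- ?s)"
    by simp
  then have "(\<lambda>n. stirling_quotient (of_nat n)) \<longlonglongrightarrow> stirling_quotient 1 * exp (- ?s)"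
    by (rule LIMSEQ_imp_Suc)
  moreover have "stirling_quotient 1 * exp (- ?s) \<noteq> 0"
    by (simp add: stirling_quotient_def)
  ultimately show ?thesis using that by blast
qed

lemma stirling_quotient_duplication:
  assumes n: "n > (0::nat)"
  shows "stirling_quotient (of_nat n) * stirling_quotient (1/2 + of_nat n)
       = of_real (sqrt (2 * pi)) * stirling_quotient (of_nat (2 * n))
         * exp (of_nat n * (Ln (of_nat n) - Ln (1/2 + of_nat n)) + 1 / 2)"
proof -
  have zn: "of_nat n \<notin> (\<int>\<^sub>\<le>\<^sub>0 :: complex set)" "of_nat n + 1/2 \<notin> (\<int>\<^sub>\<le>\<^sub>0 :: complex set)"
    using n by (auto elim!: nonpos_Ints_cases simp: complex_eq_iff)
  have dup: "Gamma (of_nat n) * Gamma (of_nat n + 1/2 :: complex)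
      = exp ((1 - 2 * of_nat n) * of_real (ln 2)) * of_real (sqrt pi) * Gamma (2 * of_nat n)"
    by (rule Gamma_legendre_duplication[OF zn])
  have L2: "Ln (of_nat (2 * n)) = of_real (ln 2) + Ln (of_nat n)"
  proof -
    have "ln (real (2 * n)) = ln 2 + ln (real n)" using n by (simp add: ln_mult)
    then show ?thesis using n by (simp add: Ln_of_nat del: of_nat_mult)
  qed
  have s2: "of_real (sqrt (2 * pi)) = of_real (sqrt pi) * exp (of_real (ln 2) / 2 :: complex)"
  proof -
    have "sqrt 2 = exp (ln 2 / 2)" by (simp add: powr_half_sqrt[symmetric] powr_def)
    then have "sqrt (2 * pi) = sqrt pi * exp (ln 2 / 2)" by (simp add: real_sqrt_mult)
    then have "of_real (sqrt (2 * pi)) = (of_real (sqrt pi * exp (ln 2 / 2)) :: complex)" by simp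
    also have "\<dots> = of_real (sqrt pi) * exp (of_real (ln 2 / 2))"
      by (simp only: of_real_mult exp_of_real)
    finally show ?thesis by simp
  qed
  have "stirling_quotient (of_nat n) * stirling_quotient (1/2 + of_nat n)
     = Gamma (of_nat n) * Gamma (of_nat n + 1/2)
        * exp (- stirling_exponent (of_nat n) - stirling_exponent (1/2 + of_nat n))"
    by (simp add: stirling_quotient_def exp_diff exp_minus add_ac field_simps)
  also have "\<dots> = of_real (sqrt pi) * Gamma (of_nat (2 * n)) *
      exp ((1 - 2 * of_nat n) * of_real (ln 2) - stirling_exponent (of_nat n) - stirling_exponent (1/2 + of_nat n))"
    unfolding dup by (simp add: exp_diff exp_minus exp_add field_simps)
  also have "(1 - 2 * of_nat n) * of_real (ln 2) - stirling_exponent (of_nat n) - stirling_exponent (1/2 + of_nat n)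
     = of_real (ln 2) / 2 - stirling_exponent (of_nat (2 * n))
        + (of_nat n * (Ln (of_nat n) - Ln (1/2 + of_nat n)) + 1 / 2)"
    unfolding stirling_exponent_def L2 by (simp add: algebra_simps)
  also have "of_real (sqrt pi) * Gamma (of_nat (2 * n)) * exp \<dots>
     = of_real (sqrt (2 * pi)) * stirling_quotient (of_nat (2 * n))
         * exp (of_nat n * (Ln (of_nat n) - Ln (1/2 + of_nat n)) + 1 / 2)"
  proof -
    have "a * G * exp (l - Y + X) = a * exp l * (G * exp (- Y)) * exp X" for a G l Y X :: complex
      by (simp add: exp_add exp_diff exp_minus field_simps)
    then show ?thesis unfolding s2 stirling_quotient_def .
  qed
  finally show ?thesis .
qed

text \<open>In the limit the duplication formula reads \<open>L * L = sqrt (2 * pi) * L\<close>,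
  since the arguments \<open>n\<close>, \<open>n + 1/2\<close> and \<open>2 * n\<close> all lead to
  the same \<open>L\<close>.\<close>

lemma stirling_quotient_of_nat_tendsto:
  "(\<lambda>n. stirling_quotient (of_nat n)) \<longlonglongrightarrow> of_real (sqrt (2 * pi))"
proof -
  obtain L where L: "L \<noteq> 0" "(\<lambda>n. stirling_quotient (of_nat n)) \<longlonglongrightarrow> L"
    by (rule stirling_quotient_of_nat_convergent)
  have "(\<lambda>n. stirling_quotient (1/2 + of_nat n) / stirling_quotient (of_nat n) * stirling_quotient (of_nat n)) \<longlonglongrightarrow> 1 * L"
    by (intro tendsto_intros stirling_quotient_ratio_tendsto L) auto
  moreover have "\<forall>\<^sub>F n in sequentially. stirling_quotient (1/2 + of_nat n) / stirling_quotient (of_nat n) * stirling_quotient (of_nat n)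
      = stirling_quotient (1/2 + of_nat n)"
  proof (rule eventually_sequentiallyI[of 1])
    fix n :: nat assume "1 \<le> n"
    then have "Gamma (of_nat n :: complex) \<noteq> 0"
      using Gamma_fact[of "n - 1", where 'a = complex] by (simp add: of_nat_diff)
    then show "stirling_quotient (1/2 + of_nat n) / stirling_quotient (of_nat n) * stirling_quotient (of_nat n)
      = stirling_quotient (1/2 + of_nat n)" by (simp add: stirling_quotient_def)
  qed
  ultimately have half: "(\<lambda>n. stirling_quotient (1/2 + of_nat n)) \<longlonglongrightarrow> 1 * L"
    by (rule Lim_transform_eventually)
  have dbl: "(\<lambda>n. stirling_quotient (of_nat (2 * n))) \<longlonglongrightarrow> L"
    using LIMSEQ_subseq_LIMSEQ[OF L(2), of "\<lambda>n. 2 * n"] by (simp add: o_def strict_mono_def)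
  have e: "(\<lambda>n. of_nat n * (Ln (of_nat n) - Ln (1/2 + of_nat n)) + 1 / 2 :: complex) \<longlonglongrightarrow> 0"
  proof -
    have "(\<lambda>n. of_real (real n * (ln (real n) - ln (1/2 + real n)) + 1 / 2) :: complex) \<longlonglongrightarrow> of_real 0"
      by (intro tendsto_of_real) real_asymp
    moreover have "\<forall>\<^sub>F n in sequentially. (of_real (real n * (ln (real n) - ln (1/2 + real n)) + 1 / 2) :: complex)
        = of_nat n * (Ln (of_nat n) - Ln (1/2 + of_nat n)) + 1 / 2"
    proof (rule eventually_sequentiallyI[of 1])
      fix n :: nat assume n: "1 \<le> n"
      have "Ln (1/2 + of_nat n) = of_real (ln (1/2 + real n))"
        using Ln_of_real[of "1/2 + real n"] by simp
      then show "(of_real (real n * (ln (real n) - ln (1/2 + real n)) + 1 / 2) :: complex)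
        = of_nat n * (Ln (of_nat n) - Ln (1/2 + of_nat n)) + 1 / 2"
        using n by (simp add: Ln_of_nat)
    qed
    ultimately have "(\<lambda>n. of_nat n * (Ln (of_nat n) - Ln (1/2 + of_nat n)) + 1 / 2 :: complex) \<longlonglongrightarrow> of_real 0"
      by (rule Lim_transform_eventually)
    then show ?thesis by simp
  qed
  have "(\<lambda>n. of_real (sqrt (2 * pi)) * stirling_quotient (of_nat (2 * n))
         * exp (of_nat n * (Ln (of_nat n) - Ln (1/2 + of_nat n)) + 1 / 2)) \<longlonglongrightarrow> of_real (sqrt (2 * pi)) * L * exp 0"
    by (intro tendsto_intros dbl e)
  moreover have "\<forall>\<^sub>F n in sequentially. of_real (sqrt (2 * pi)) * stirling_quotient (of_nat (2 * n))
         * exp (of_nat n * (Ln (of_nat n) - Ln (1/2 + of_nat n)) + 1 / 2)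
       = stirling_quotient (of_nat n) * stirling_quotient (1/2 + of_nat n)"
    by (rule eventually_sequentiallyI[of 1]) (simp add: stirling_quotient_duplication)
  ultimately have "(\<lambda>n. stirling_quotient (of_nat n) * stirling_quotient (1/2 + of_nat n)) \<longlonglongrightarrow> of_real (sqrt (2 * pi)) * L * exp 0"
    by (rule Lim_transform_eventually)
  moreover have "(\<lambda>n. stirling_quotient (of_nat n) * stirling_quotient (1/2 + of_nat n)) \<longlonglongrightarrow> L * (1 * L)"
    by (intro tendsto_intros L half)
  ultimately have "of_real (sqrt (2 * pi)) * L * exp 0 = L * (1 * L)"
    by (rule LIMSEQ_unique)
  then have "of_real (sqrt (2 * pi)) = L" using L(1) by simp
  then show ?thesis using L(2) by simp
qed

text \<open>\<open>Re\<close> is affine on the segment, so the exponential is largest at an end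
  point. The maximum is kept because in the application neither of the two exponentials is known
  beforehand to dominate.\<close>

lemma norm_exp_diff_le:
  fixes a b :: complex
  shows "norm (exp a - exp b) \<le> norm (a - b) * max (norm (exp a)) (norm (exp b))"
proof -
  have "norm (exp a - exp b) \<le> max (norm (exp a)) (norm (exp b)) * norm (a - b)"
  proof (rule field_differentiable_bound[where S = "closed_segment a b"])
    fix u assume "u \<in> closed_segment a b"
    then obtain c where c: "0 \<le> c" "c \<le> 1" "u = (1 - c) *\<^sub>R a + c *\<^sub>R b"
      by (auto simp: in_segment)
    show "(exp has_field_derivative exp u) (at u within closed_segment a b)"
      by (auto intro!: derivative_eq_intros)
    have "Re u = (1 - c) * Re a + c * Re b" using c by simp
    also have "\<dots> \<le> max (Re a) (Re b)"
      using c convex_bound_le[of "Re a" "max (Re a) (Re b)" "Re b" "1 - c" c] by simp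
    finally show "norm (exp u) \<le> max (norm (exp a)) (norm (exp b))"
      by (auto simp: norm_exp_eq_Re le_max_iff_disj)
  qed auto
  then show ?thesis by (simp add: mult.commute)
qed

lemma norm_exp_minus_one_le:
  fixes z :: complex
  shows "norm (exp z - 1) \<le> norm z * exp (norm z)"
proof -
  have "norm (exp z - exp 0) \<le> norm (z - 0) * max (norm (exp z)) (norm (exp (0::complex)))"
    by (rule norm_exp_diff_le)
  also have "\<dots> \<le> norm z * exp (norm z)"
    using norm_exp[of z] by (intro mult_mono) auto
  finally show ?thesis by simp
qed

text \<open>The quotient at \<open>z\<close> equals its limit \<open>sqrt (2 * pi)\<close> times the
  exponential of the sum of all steps. That sum is at most \<open>16 / norm z\<close>, and at most
  16 because \<open>norm z \<ge> 1\<close>; this explains \<open>exp 16\<close>.\<close>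

theorem Gamma_stirling_right_half_plane:
  assumes z: "Re z \<ge> 1"
  shows "norm (Gamma z / (of_real (sqrt (2 * pi)) * exp (stirling_exponent z)) - 1) \<le> 16 * exp 16 / norm z"
proof -
  define r where "r = norm z"
  have r: "r \<ge> 1" using z complex_Re_le_cmod[of z] by (simp add: r_def)
  have "(\<lambda>n. stirling_quotient (z + of_nat n) / stirling_quotient (of_nat n) * stirling_quotient (of_nat n)) \<longlonglongrightarrow> 1 * of_real (sqrt (2 * pi))"
    by (intro tendsto_intros stirling_quotient_ratio_tendsto stirling_quotient_of_nat_tendsto) (use z in auto)
  moreover have "\<forall>\<^sub>F n in sequentially. stirling_quotient (z + of_nat n) / stirling_quotient (of_nat n) * stirling_quotient (of_nat n)
      = stirling_quotient z * exp (- (\<Sum>k<n. stirling_step (z + of_nat k)))"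
  proof (rule eventually_sequentiallyI[of 1])
    fix n :: nat assume "1 \<le> n"
    then have "Gamma (of_nat n :: complex) \<noteq> 0"
      using Gamma_fact[of "n - 1", where 'a = complex] by (simp add: of_nat_diff)
    then show "stirling_quotient (z + of_nat n) / stirling_quotient (of_nat n) * stirling_quotient (of_nat n)
      = stirling_quotient z * exp (- (\<Sum>k<n. stirling_step (z + of_nat k)))"
      using z stirling_quotient_shift[of z n] by (simp add: stirling_quotient_def[of "of_nat n"])
  qed
  ultimately have "(\<lambda>n. stirling_quotient z * exp (- (\<Sum>k<n. stirling_step (z + of_nat k)))) \<longlonglongrightarrow> 1 * of_real (sqrt (2 * pi))"
    by (rule Lim_transform_eventually)
  then have qlim: "(\<lambda>n. stirling_quotient z * exp (- (\<Sum>k<n. stirling_step (z + of_nat k)))) \<longlonglongrightarrow> of_real (sqrt (2 * pi))"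
    by simp
  have q0: "stirling_quotient z \<noteq> 0"
    using z by (auto simp: stirling_quotient_def Gamma_eq_zero_iff elim!: nonpos_Ints_cases)
  have "(\<lambda>n. inverse (stirling_quotient z * exp (- (\<Sum>k<n. stirling_step (z + of_nat k))))) \<longlonglongrightarrow> inverse (of_real (sqrt (2 * pi)))"
    by (intro tendsto_inverse qlim) simp
  then have this_lim: "(\<lambda>n. stirling_quotient z * inverse (stirling_quotient z * exp (- (\<Sum>k<n. stirling_step (z + of_nat k)))) - 1)
     \<longlonglongrightarrow> stirling_quotient z * inverse (of_real (sqrt (2 * pi))) - 1"
    by (intro tendsto_diff tendsto_mult tendsto_const)
  then have lim: "(\<lambda>n. exp (\<Sum>k<n. stirling_step (z + of_nat k)) - 1)
     \<longlonglongrightarrow> stirling_quotient z * inverse (of_real (sqrt (2 * pi))) - 1"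
  proof -
    have "stirling_quotient z * inverse (stirling_quotient z * exp (- T)) = exp T" for T
      using q0 by (simp add: exp_minus)
    with this_lim show ?thesis by (simp only:)
  qed
  have bd: "norm (exp (\<Sum>k<n. stirling_step (z + of_nat k)) - 1) \<le> 16 * exp 16 / r" for n
  proof -
    define T where "T = (\<Sum>k<n. stirling_step (z + of_nat k))"
    have T: "norm T \<le> 16 / r" using norm_sum_stirling_step_le[OF z, of n] by (simp add: T_def r_def)
    have "16 / r \<le> 16" using r by (simp add: field_simps)
    then have T': "norm T \<le> 16" using T by linarith
    have "norm (exp T - 1) \<le> norm T * exp (norm T)" by (rule norm_exp_minus_one_le)
    also have "\<dots> \<le> (16 / r) * exp 16" using T T' r by (intro mult_mono) auto
    finally show ?thesis by (simp add: T_def)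
  qed
  have "norm (stirling_quotient z * inverse (of_real (sqrt (2 * pi))) - 1) \<le> 16 * exp 16 / r"
    by (rule Lim_bounded[OF tendsto_norm[OF lim]]) (use bd in auto)
  then show ?thesis by (simp add: stirling_quotient_def r_def exp_minus field_simps)
qed

section \<open>Integrals along lines of slope 1\<close>

definition sin_kernel :: "complex \<Rightarrow> complex" where
  "sin_kernel x = exp (of_real pi * \<i> * x) - exp (- (of_real pi * \<i> * x))"

text \<open>The numerator is a parameter so that one shift lemma serves both the original integrand
  and the Gaussian.\<close>

definition line_integral :: "(complex \<Rightarrow> complex) \<Rightarrow> real \<Rightarrow> complex" where
  "line_integral h c =
     (\<integral>u. h (aux_line c u) / sin_kernel (aux_line c u) * (- cis (pi / 4)) \<partial>lborel)"

section \<open>Zeros and size of the kernel\<close>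

lemma sin_kernel_eq: "sin_kernel x = 2 * \<i> * sin (of_real pi * x)"
  by (simp add: sin_kernel_def sin_exp_eq mult_ac)

lemma sin_kernel_eq_0D:
  assumes "sin_kernel x = 0"
  shows "Im x = 0" "Re x \<in> \<int>"
proof -
  obtain n :: int where "of_real pi * x = of_real (of_int n * pi)"
    using assms by (auto simp: sin_kernel_eq sin_eq_0)
  then have "x = of_int n" by (simp add: complex_eq_iff)
  then show "Im x = 0" "Re x \<in> \<int>" by auto
qed

lemma sin_kernel_add_one: "sin_kernel (x + 1) = - sin_kernel x"
  by (simp add: sin_kernel_eq distrib_left sin_add)

text \<open>Serves the two short sides of the rectangle in the contour shift, which leave the
  half-integer lines.\<close>

lemma norm_sin_kernel_ge:
  assumes "\<bar>Im x\<bar> \<ge> 1"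
  shows "norm (sin_kernel x) \<ge> 1"
proof -
  define y where "y = \<bar>Im x\<bar>"
  have y: "y \<ge> 1" using assms by (simp add: y_def)
  have "exp (pi * y) - exp (- (pi * y)) \<le> norm (sin_kernel x)"
  proof (cases "Im x \<ge> 0")
    case True
    have "norm (exp (- (of_real pi * \<i> * x))) - norm (exp (of_real pi * \<i> * x)) \<le> norm (sin_kernel x)"
      unfolding sin_kernel_def by (metis norm_minus_commute norm_triangle_ineq2)
    then show ?thesis using True by (simp add: norm_exp_eq_Re y_def)
  next
    case False
    have "norm (exp (of_real pi * \<i> * x)) - norm (exp (- (of_real pi * \<i> * x))) \<le> norm (sin_kernel x)"
      unfolding sin_kernel_def by (rule norm_triangle_ineq2)
    then show ?thesis using False by (simp add: norm_exp_eq_Re y_def)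
  qed
  moreover have "pi * y \<ge> 1" using y pi_gt3 mult_mono[of 1 pi 1 y] by simp
  then have "exp (pi * y) \<ge> 2" using exp_ge_add_one_self[of "pi * y"] by linarith
  moreover have "exp (- (pi * y)) \<le> 1" using y by simp
  ultimately show ?thesis by linarith
qed

text \<open>With \<open>y = pi * Im x\<close> the squared modulus is
  \<open>exp (- 2 * y) + exp (2 * y) - 2 * cos (2 * pi * Re x)\<close>. On a line of slope 1 through
  a half-integer the cosine becomes \<open>- cos (2 * y)\<close>, which is favourable near the real
  axis, where the exponentials alone would not suffice.\<close>

lemma norm_sin_kernel_half_line:
  assumes x: "Re x - Im x = real m + 1/2"
  shows "norm (sin_kernel x) \<ge> exp (pi * \<bar>Im x\<bar>) / 2"
proof -
  define y where "y = pi * Im x"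
  have "of_real pi * \<i> * x = Complex (- y) (pi * Re x)"
    by (simp add: complex_eq_iff y_def)
  then have k: "sin_kernel x = exp (Complex (- y) (pi * Re x)) - exp (- Complex (- y) (pi * Re x))"
    by (simp add: sin_kernel_def)
  have re: "Re (sin_kernel x) = (exp (- y) - exp y) * cos (pi * Re x)"
   and im: "Im (sin_kernel x) = (exp (- y) + exp y) * sin (pi * Re x)"
    by (simp_all add: k Re_exp Im_exp algebra_simps)
  have ee: "exp (- y) * exp y = 1" by (simp flip: exp_add)
  have "(norm (sin_kernel x))\<^sup>2 = ((exp (- y))\<^sup>2 + (exp y)\<^sup>2) * ((sin (pi * Re x))\<^sup>2 + (cos (pi * Re x))\<^sup>2)
      - 2 * (exp (- y) * exp y) * ((cos (pi * Re x))\<^sup>2 - (sin (pi * Re x))\<^sup>2)"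
  proof -
    have "((a - b) * c)\<^sup>2 + ((a + b) * d)\<^sup>2 = (a\<^sup>2 + b\<^sup>2) * (d\<^sup>2 + c\<^sup>2) - 2 * (a * b) * (c\<^sup>2 - d\<^sup>2)"
      for a b c d :: real by (simp add: power2_eq_square algebra_simps)
    then show ?thesis unfolding cmod_power2 re im .
  qed
  also have "\<dots> = (exp (- y))\<^sup>2 + (exp y)\<^sup>2 - 2 * cos (2 * (pi * Re x))"
    unfolding ee cos_double by simp
  also have "cos (2 * (pi * Re x)) = - cos (2 * y)"
  proof -
    have "2 * (pi * Re x) = (2 * y + pi) + 2 * real m * pi"
      using x by (simp add: y_def algebra_simps)
    also have "cos \<dots> = cos (2 * y + pi)"
      by (simp only: cos_add[of "2 * y + pi"] cos_2npi sin_2npi mult_1_right mult_zero_right diff_0_right)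
    finally show ?thesis by simp
  qed
  finally have n2: "(norm (sin_kernel x))\<^sup>2 = (exp (- y))\<^sup>2 + (exp y)\<^sup>2 + 2 * cos (2 * y)" by simp
  have sym: "(exp (- y))\<^sup>2 + (exp y)\<^sup>2 = (exp \<bar>y\<bar>)\<^sup>2 + (exp (- \<bar>y\<bar>))\<^sup>2"
    by (cases "y \<ge> 0") auto
  have "(exp \<bar>y\<bar> / 2)\<^sup>2 \<le> (norm (sin_kernel x))\<^sup>2"
  proof (cases "cos (2 * y) \<ge> 0")
    case True
    have "(exp \<bar>y\<bar> / 2)\<^sup>2 \<le> (exp \<bar>y\<bar>)\<^sup>2" by (intro power_mono) auto
    then show ?thesis unfolding n2 sym using True zero_le_power2[of "exp (- \<bar>y\<bar>)"] by linarith
  next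
    case False
    have "\<bar>2 * y\<bar> > pi / 2"
    proof (rule ccontr)
      assume "\<not> \<bar>2 * y\<bar> > pi / 2"
      then have "cos (2 * y) \<ge> 0" by (intro cos_ge_zero) auto
      then show False using False by simp
    qed
    then have "2 * \<bar>y\<bar> \<ge> 3/2" using pi_gt3 by simp
    then have "exp (2 * \<bar>y\<bar>) \<ge> exp (3/2)" by simp
    \<comment> \<open>From 8/3 on, three quarters of \<open>exp (2 * \<bar>y\<bar>)\<close> outweigh
      the worst value -2 of the cosine term.\<close>
    moreover have "exp (3/2 :: real) \<ge> 8/3"
    proof -
      have "exp (3/2 :: real) = exp (3/4) * exp (3/4)" by (simp flip: exp_add)
      moreover have "exp (3/4 :: real) \<ge> 7/4" using exp_ge_add_one_self[of "3/4::real"] by simp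
      then have "exp (3/4 :: real) * exp (3/4) \<ge> 7/4 * (7/4)" by (intro mult_mono) auto
      ultimately show ?thesis by simp
    qed
    ultimately have "exp (2 * \<bar>y\<bar>) \<ge> 8/3" by linarith
    moreover have "exp (2 * \<bar>y\<bar>) = (exp \<bar>y\<bar>)\<^sup>2" by (simp add: exp_double)
    moreover have "cos (2 * y) \<ge> -1" by simp
    moreover have "(exp \<bar>y\<bar> / 2)\<^sup>2 = (exp \<bar>y\<bar>)\<^sup>2 / 4" by (simp add: power_divide)
    moreover have "(exp (- \<bar>y\<bar>))\<^sup>2 \<ge> 0" by simp
    ultimately show ?thesis unfolding n2 sym by linarith
  qed
  then have "exp \<bar>y\<bar> / 2 \<le> norm (sin_kernel x)" by (rule power2_le_imp_le) simp
  then show ?thesis by (simp add: y_def abs_mult)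
qed

section \<open>Convergence on the half-integer lines and the crossing of one pole\<close>

lemma Re_aux_line: "Re (aux_line c u) = c - u * (sqrt 2 / 2)"
  and Im_aux_line: "Im (aux_line c u) = - u * (sqrt 2 / 2)"
  by (simp_all add: aux_line_def cos_45 sin_45)

lemma aux_line_crossing: "Re (aux_line c u) - Im (aux_line c u) = c"
  by (simp add: Re_aux_line Im_aux_line)

lemma norm_sin_kernel_aux_line_ge:
  "norm (sin_kernel (aux_line (real m + 1/2) u)) \<ge> exp (pi * \<bar>Im (aux_line (real m + 1/2) u)\<bar>) / 2"
  by (rule norm_sin_kernel_half_line) (simp add: aux_line_crossing)

lemma norm_sin_kernel_aux_line_ge_half: "norm (sin_kernel (aux_line (real m + 1/2) u)) \<ge> 1/2"
proof -
  have "1 \<le> exp (pi * \<bar>Im (aux_line (real m + 1/2) u)\<bar>)" by simp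
  then show ?thesis using norm_sin_kernel_aux_line_ge[of m u] by linarith
qed

lemma integrable_exp_minus_square: "integrable lborel (\<lambda>u::real. exp (- u\<^sup>2))"
proof -
  have "integrable lborel (\<lambda>u. sqrt pi * normal_density 0 (1 / sqrt 2) u)"
    by (intro integrable_mult_right integrable_normal_density) simp
  moreover have "sqrt pi * normal_density 0 (1 / sqrt 2) u = exp (- u\<^sup>2)" for u
    by (simp add: normal_density_def power_divide)
  ultimately show ?thesis by simp
qed

lemma integrable_aux_line:
  assumes cont: "continuous_on {x. Re x > Im x} h"
    and bd: "\<And>u. norm (h (aux_line (real m + 1/2) u)) \<le> C * exp (- u\<^sup>2)"
  defines "f \<equiv> \<lambda>u. h (aux_line (real m + 1/2) u) / sin_kernel (aux_line (real m + 1/2) u) * (- cis (pi / 4))"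
  shows "integrable lborel f" "continuous_on UNIV f"
proof -
  have nz: "sin_kernel (aux_line (real m + 1/2) u) \<noteq> 0" for u
    using norm_sin_kernel_aux_line_ge_half[of m u] by auto
  have cl: "continuous_on UNIV (aux_line (real m + 1/2))"
    unfolding aux_line_def by (intro continuous_intros)
  show cf: "continuous_on UNIV f"
    unfolding f_def
  proof (intro continuous_intros nz)
    show "continuous_on UNIV (\<lambda>u. h (aux_line (real m + 1/2) u))"
    proof (intro continuous_on_compose2[OF cont cl] subsetI)
      fix x assume "x \<in> range (aux_line (real m + 1/2))"
      then have "Re x - Im x = real m + 1/2" using aux_line_crossing by auto
      then show "x \<in> {x. Re x > Im x}" using of_nat_0_le_iff[where 'a = real, of m]
        by (intro CollectI) linarith
    qed
    show "continuous_on UNIV (\<lambda>u. sin_kernel (aux_line (real m + 1/2) u))"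
      unfolding sin_kernel_def by (intro continuous_intros cl)
  qed (use nz in auto)
  show "integrable lborel f"
  proof (rule Bochner_Integration.integrable_bound)
    show "integrable lborel (\<lambda>u::real. 2 * C * exp (- u\<^sup>2))"
      by (intro integrable_mult_right integrable_exp_minus_square)
    show "f \<in> borel_measurable lborel"
      using borel_measurable_continuous_onI[OF cf] by simp
    have "norm (f u) \<le> 2 * C * exp (- u\<^sup>2)" for u
    proof -
      have "norm (f u) = norm (h (aux_line (real m + 1/2) u)) / norm (sin_kernel (aux_line (real m + 1/2) u))"
        by (simp add: f_def norm_mult norm_divide)
      also have "\<dots> \<le> (C * exp (- u\<^sup>2)) / (1/2)"
        using norm_sin_kernel_aux_line_ge_half[of m u] bd[of u] order_trans[OF norm_ge_zero bd[of u]]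
        by (intro frac_le) auto
      finally show ?thesis by simp
    qed
    then show "AE u in lborel. norm (f u) \<le> norm (2 * C * exp (- u\<^sup>2))"
      by (intro AE_I2) (metis abs_ge_self order_trans real_norm_def)
  qed
qed

lemma integral_symmetric_interval_tendsto:
  fixes G :: "real \<Rightarrow> complex"
  assumes int: "integrable lborel G"
  shows "(\<lambda>k. integral {- real k..real k} G) \<longlonglongrightarrow> (\<integral>v. G v \<partial>lborel)"
proof -
  have "(\<lambda>k. \<integral>v. indicator {- real k..real k} v *\<^sub>R G v \<partial>lborel) \<longlonglongrightarrow> (\<integral>v. G v \<partial>lborel)"
  proof (rule integral_dominated_convergence[where w = "\<lambda>v. norm (G v)"])
    show "AE v in lborel. (\<lambda>k. indicator {- real k..real k} v *\<^sub>R G v) \<longlonglongrightarrow> G v"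
    proof (rule AE_I2)
      fix v :: real
      have "\<forall>\<^sub>F k in sequentially. G v = indicator {- real k..real k} v *\<^sub>R G v"
      proof (rule eventually_sequentiallyI[of "nat \<lceil>\<bar>v\<bar>\<rceil>"])
        fix k assume "nat \<lceil>\<bar>v\<bar>\<rceil> \<le> k"
        then have "\<bar>v\<bar> \<le> real k" by linarith
        then show "G v = indicator {- real k..real k} v *\<^sub>R G v" by (simp add: indicator_def abs_le_iff)
      qed
      then show "(\<lambda>k. indicator {- real k..real k} v *\<^sub>R G v) \<longlonglongrightarrow> G v"
        by (rule Lim_transform_eventually[OF tendsto_const])
    qed
  qed (use int in \<open>auto simp: indicator_def\<close>)
  moreover have "(\<integral>v. indicator {- real k..real k} v *\<^sub>R G v \<partial>lborel) = integral {- real k..real k} G" for k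
  proof -
    have "set_integrable lborel {- real k..real k} G"
      unfolding set_integrable_def by (rule integrable_mult_indicator) (use int in auto)
    then show ?thesis
      using set_borel_integral_eq_integral(2)[of "{- real k..real k}" G] by (simp add: set_lebesgue_integral_def)
  qed
  ultimately show ?thesis by simp
qed

text \<open>
  In the coordinate \<open>w\<close> with \<open>x = m + 1 + cis (- pi / 4) * w\<close> the two lines become vertical, so that
  the residue theorem can be applied to a rectangle.
\<close>

lemma line_integral_shift:
  fixes m :: nat
  assumes hol: "h holomorphic_on {x. Re x > Im x}"
    and bd: "\<And>c u. real m + 1/2 \<le> c \<Longrightarrow> c \<le> real m + 3/2 \<Longrightarrow> norm (h (aux_line c u)) \<le> C * exp (- u\<^sup>2)"
  shows "line_integral h (real m + 1/2) = line_integral h (real m + 3/2) + (-1) ^ (m + 1) * h (of_nat (m + 1))"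
proof -
  \<comment> \<open>The vertical line with real part \<open>Re w\<close> crosses the real
    \<open>x\<close>-axis at \<open>m + 1 + sqrt 2 * Re w\<close>, so
    \<open>\<plusminus>\<beta>\<close> are the lines through \<open>m + 3/2\<close> and
    \<open>m + 1/2\<close>.\<close>
  define \<beta> where "\<beta> = sqrt 2 / 4"
  define \<gamma> where "\<gamma> = cis (- pi / 4)"
  define X where "X w = of_nat (m + 1) + \<gamma> * w" for w
  define k where "k w = (h (X w) * \<gamma>) / sin_kernel (X w)" for w
  have \<beta>: "0 < \<beta>" "\<beta> < 1" "sqrt 2 * \<beta> = 1/2"
    using real_sqrt_less_mono[of 2 4] by (auto simp: \<beta>_def)
  have \<gamma>: "\<gamma> = Complex (sqrt 2 / 2) (- (sqrt 2 / 2))" "\<gamma> \<noteq> 0"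
    by (simp_all add: \<gamma>_def complex_eq_iff cos_45 sin_45)
  have \<gamma>i: "\<gamma> * \<i> = cis (pi / 4)"
    by (simp add: \<gamma> complex_eq_iff cos_45 sin_45)
  have Xline: "X w = aux_line (real (m + 1) + sqrt 2 * Re w) (Re w - Im w)" for w
    by (rule complex_eqI) (simp_all add: X_def \<gamma> Re_aux_line Im_aux_line field_simps)
  have Xcross: "Re (X w) - Im (X w) = real (m + 1) + sqrt 2 * Re w" for w
    by (simp add: Xline aux_line_crossing)
  \<comment> \<open>This strip corresponds to crossing points strictly between \<open>m\<close> and
    \<open>m + 2\<close>. It contains the single pole \<open>w = 0\<close> and, as
    \<open>m \<ge> 0\<close>, stays in the half-plane where \<open>h\<close> is holomorphic.\<close>
  define S where "S = {w. Re w > - sqrt 2 / 2 \<and> Re w < sqrt 2 / 2}"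
  have S: "open S" "convex S" 
  proof -
    have *: "S = {w. Re w > - sqrt 2 / 2} \<inter> {w. Re w < sqrt 2 / 2}" by (auto simp: S_def)
    show "open S" unfolding * by (intro open_Int open_halfspace_Re_gt open_halfspace_Re_lt)
    show "convex S" unfolding * by (intro convex_Int convex_halfspace_Re_gt convex_halfspace_Re_lt)
  qed
  have Sstrip: "\<bar>sqrt 2 * Re w\<bar> < 1" if "w \<in> S" for w
  proof -
    have "\<bar>Re w\<bar> < sqrt 2 / 2" using that by (auto simp: S_def)
    then have "sqrt 2 * \<bar>Re w\<bar> < sqrt 2 * (sqrt 2 / 2)" by (intro mult_strict_left_mono) auto
    then show ?thesis by (simp add: abs_mult)
  qed
  have XS: "Re (X w) > Im (X w)" if "w \<in> S" for w
  proof -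
    have "real (m + 1) \<ge> 1" by simp
    then show ?thesis using Xcross[of w] Sstrip[OF that] by linarith
  qed
  have zero: "w = 0" if "w \<in> S" "sin_kernel (X w) = 0" for w
  proof -
    have i: "Im (X w) = 0" "Re (X w) \<in> \<int>" using sin_kernel_eq_0D that(2) by auto
    then obtain j :: int where j: "Re (X w) = of_int j" by (auto elim: Ints_cases)
    have "sqrt 2 * Re w = of_int (j - int (m + 1))" using Xcross[of w] i(1) j by simp
    then have "\<bar>of_int (j - int (m + 1)) :: real\<bar> < 1" using Sstrip[OF that(1)] by simp
    then have "j = int (m + 1)" by linarith
    then have "X w = of_nat (m + 1)" using i(1) j by (simp add: complex_eq_iff)
    then show "w = 0" using \<gamma>(2) by (simp add: X_def)
  qed
  have holX: "(\<lambda>w. h (X w)) holomorphic_on S"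
  proof -
    have "X holomorphic_on S" unfolding X_def by (intro holomorphic_intros)
    from holomorphic_on_compose_gen[OF this hol] show ?thesis using XS by (auto simp: o_def)
  qed
  have holK: "(\<lambda>w. sin_kernel (X w)) holomorphic_on S"
    unfolding sin_kernel_def X_def by (intro holomorphic_intros)
  have holk: "k holomorphic_on S - {0}"
    unfolding k_def using zero
    by (intro holomorphic_intros holomorphic_on_subset[OF holX] holomorphic_on_subset[OF holK]) auto
  have "0 \<in> S" by (simp add: S_def)
  have pin: "of_real pi * of_nat (m + 1) = (of_real (real (m + 1) * pi) :: complex)" by simp
  have X00: "X 0 = of_nat (m + 1)" by (simp add: X_def)
  \<comment> \<open>At \<open>m + 1\<close> the kernel has derivative
    \<open>2 * pi * \<i> * (-1) ^ (m + 1)\<close>; the factor \<gamma> of the substitution appears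
    in numerator and denominator and cancels.\<close>
  have res: "2 * of_real pi * \<i> * residue k 0 = (-1) ^ (m + 1) * h (of_nat (m + 1))"
  proof -
    have k0: "sin_kernel (X 0) = 0"
      unfolding sin_kernel_eq X00 pin sin_of_real sin_npi by simp
    define D where "D = 2 * of_real pi * \<i> * \<gamma> * (-1) ^ (m + 1)"
    have "((\<lambda>w. sin_kernel (X w)) has_field_derivative (2 * \<i> * (cos (of_real pi * X 0) * (of_real pi * \<gamma>)))) (at 0)"
      unfolding sin_kernel_eq X_def by (auto intro!: derivative_eq_intros)
    moreover have "cos (of_real pi * X 0) = (-1) ^ (m + 1)"
      unfolding X00 pin cos_of_real cos_npi by simp
    ultimately have "((\<lambda>w. sin_kernel (X w)) has_field_derivative D) (at 0)"
      by (simp add: D_def mult_ac)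
    then have L: "((\<lambda>w. sin_kernel (X w) / w) \<longlongrightarrow> D) (at 0)"
      using k0 by (simp add: has_field_derivative_iff)
    have "isCont (\<lambda>w. h (X w)) 0"
      using holX S(1) \<open>0 \<in> S\<close> holomorphic_on_imp_continuous_on continuous_on_eq_continuous_at by blast
    then have "((\<lambda>w. h (X w) * \<gamma>) \<longlongrightarrow> h (X 0) * \<gamma>) (at 0)"
      by (intro tendsto_intros) (simp add: isCont_def)
    moreover have D0: "D \<noteq> 0" using \<gamma>(2) by (simp add: D_def)
    ultimately have "((\<lambda>w. (h (X w) * \<gamma>) / (sin_kernel (X w) / w)) \<longlongrightarrow> h (X 0) * \<gamma> / D) (at 0)"
      by (intro tendsto_divide L)
    then have "((\<lambda>w. k w * (w - 0)) \<longlongrightarrow> h (X 0) * \<gamma> / D) (at 0)"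
      by (simp add: k_def)
    then have "residue k 0 = h (X 0) * \<gamma> / D"
      by (intro residue_simple'[OF S(1) \<open>0 \<in> S\<close> holk])
    then have "2 * of_real pi * \<i> * residue k 0 = h (of_nat (m + 1)) / (-1) ^ (m + 1)"
      unfolding X00 D_def using \<gamma>(2) by (simp del: power_Suc of_nat_add add: field_simps)
    also have "\<dots> = (-1) ^ (m + 1) * h (of_nat (m + 1))"
      by (cases "even m") simp_all
    finally show ?thesis .
  qed
  define f1 where "f1 u = h (aux_line (real m + 1/2) u) / sin_kernel (aux_line (real m + 1/2) u) * (- cis (pi / 4))" for u
  define f2 where "f2 u = h (aux_line (real (m + 1) + 1/2) u) / sin_kernel (aux_line (real (m + 1) + 1/2) u) * (- cis (pi / 4))" for u
  have conth: "continuous_on {x. Re x > Im x} h" using hol by (rule holomorphic_on_imp_continuous_on)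
  have int1: "integrable lborel f1"
    unfolding f1_def by (rule integrable_aux_line[OF conth]) (rule bd; simp)
  have int2: "integrable lborel f2"
    unfolding f2_def by (rule integrable_aux_line[OF conth]) (rule bd; simp)
  \<comment> \<open>Going up in \<open>w\<close> means going to the upper right in \<open>x\<close>,
    against the orientation of \<open>aux_line\<close>; hence the sign and the reflected
    parameter.\<close>
  have kR: "k (Complex \<beta> v) * \<i> = - f2 (\<beta> - v)" for v
  proof -
    have "X (Complex \<beta> v) = aux_line (real (m + 1) + 1/2) (\<beta> - v)"
      by (simp add: Xline \<beta>(3))
    then have "k (Complex \<beta> v) * \<i> = h (aux_line (real (m + 1) + 1/2) (\<beta> - v)) / sin_kernel (aux_line (real (m + 1) + 1/2) (\<beta> - v)) * (\<gamma> * \<i>)"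
      by (simp add: k_def)
    then show ?thesis by (simp add: \<gamma>i f2_def)
  qed
  have kL: "k (Complex (- \<beta>) v) * \<i> = - f1 (- \<beta> - v)" for v
  proof -
    have "real (m + 1) + sqrt 2 * (- \<beta>) = real m + 1/2" using \<beta>(3) by simp
    then have "X (Complex (- \<beta>) v) = aux_line (real m + 1/2) (- \<beta> - v)"
      unfolding Xline complex.sel by (simp only:)
    then have "k (Complex (- \<beta>) v) * \<i> = h (aux_line (real m + 1/2) (- \<beta> - v)) / sin_kernel (aux_line (real m + 1/2) (- \<beta> - v)) * (\<gamma> * \<i>)"
      by (simp add: k_def)
    then show ?thesis by (simp add: \<gamma>i f1_def)
  qed
  have C0: "C \<ge> 0"
  proof -
    have "0 \<le> C * exp (- (0::real)\<^sup>2)" by (rule order_trans[OF norm_ge_zero bd[of "real m + 1/2" 0]]) auto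
    then show ?thesis by simp
  qed
  have contk: "continuous_on (S - {0}) k" using holk by (rule holomorphic_on_imp_continuous_on)
  define B where "B K = contour_integral (linepath (Complex (- \<beta>) (- real K)) (Complex \<beta> (- real K))) k" for K
  define T where "T K = contour_integral (linepath (Complex \<beta> (real K)) (Complex (- \<beta>) (real K))) k" for K
  have \<beta>S: "\<beta> < sqrt 2 / 2" by (simp add: \<beta>_def)
  have seg: "w \<in> S - {0}" if "\<bar>Re w\<bar> \<le> \<beta>" "Re w = \<beta> \<or> Re w = - \<beta> \<or> \<bar>Im w\<bar> \<ge> 1" for w
    using that \<beta> \<beta>S by (auto simp: S_def)
  have ends: "(\<lambda>K. B K + T K) \<longlonglongrightarrow> 0"
  proof (rule Lim_null_comparison)
    \<comment> \<open>On a horizontal side the line parameter is \<open>Re w - Im w\<close>, of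
      modulus at least \<open>K - 1\<close> because \<beta> < 1. For \<open>K \<ge> 3\<close> this
      forces \<open>\<bar>Im (X w)\<bar> \<ge> 1\<close>, where the kernel is bounded below.\<close>
    have kb: "norm (k w) \<le> C * exp (- (real K - 1)\<^sup>2)" if w: "\<bar>Re w\<bar> \<le> \<beta>" "\<bar>Im w\<bar> = real K" and K: "K \<ge> 3" for w K
    proof -
      define u where "u = Re w - Im w"
      have u: "\<bar>u\<bar> \<ge> real K - 1" using w \<beta> by (auto simp: u_def)
      have "\<bar>u\<bar> * (sqrt 2 / 2) \<ge> 2 * (1 / 2)"
        using u K real_sqrt_le_mono[of 1 2] by (intro mult_mono) auto
      then have "\<bar>Im (X w)\<bar> \<ge> 1" by (simp add: Xline Im_aux_line u_def[symmetric] abs_mult)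
      then have s: "norm (sin_kernel (X w)) \<ge> 1" by (rule norm_sin_kernel_ge)
      have "\<bar>sqrt 2 * Re w\<bar> \<le> sqrt 2 * \<beta>" unfolding abs_mult using w(1) by (intro mult_mono) auto
      then have c: "\<bar>sqrt 2 * Re w\<bar> \<le> 1/2" by (simp add: \<beta>(3))
      have "norm (h (X w)) \<le> C * exp (- u\<^sup>2)"
        unfolding Xline u_def by (rule bd) (use c in auto)
      also have "\<dots> \<le> C * exp (- (real K - 1)\<^sup>2)"
      proof -
        have "(real K - 1)\<^sup>2 \<le> \<bar>u\<bar>\<^sup>2" using u K by (intro power_mono) auto
        then show ?thesis using C0 by (intro mult_left_mono) auto
      qed
      finally have "norm (h (X w)) \<le> C * exp (- (real K - 1)\<^sup>2)" .
      moreover have "norm (k w) = norm (h (X w)) / norm (sin_kernel (X w))"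
        by (simp add: k_def norm_mult norm_divide \<gamma>_def)
      moreover have "norm (h (X w)) / norm (sin_kernel (X w)) \<le> norm (h (X w)) / 1"
        using s by (intro divide_left_mono) auto
      ultimately show ?thesis by linarith
    qed
    show "\<forall>\<^sub>F K in sequentially. norm (B K + T K) \<le> C * exp (- (real K - 1)\<^sup>2) * 4"
    proof (rule eventually_sequentiallyI[of 3])
      fix K :: nat assume K: "3 \<le> K"
      have segs: "\<bar>Re w\<bar> \<le> \<beta> \<and> Im w = y"
        if "w \<in> closed_segment (Complex (- \<beta>) y) (Complex \<beta> y)" for w y
        using that \<beta> by (auto simp: closed_segment_same_Im closed_segment_eq_real_ivl)
      have sub: "closed_segment (Complex (- \<beta>) y) (Complex \<beta> y) \<subseteq> S - {0}" if "\<bar>y\<bar> = real K" for y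
      proof
        fix w assume "w \<in> closed_segment (Complex (- \<beta>) y) (Complex \<beta> y)"
        then have w: "\<bar>Re w\<bar> \<le> \<beta>" "Im w = y" using segs by auto
        then have "\<bar>Im w\<bar> \<ge> 1" using that K by simp
        with w(1) show "w \<in> S - {0}" by (intro seg) auto
      qed
      have "norm (B K) \<le> C * exp (- (real K - 1)\<^sup>2) * norm (Complex \<beta> (- real K) - Complex (- \<beta>) (- real K))"
        unfolding B_def
      proof (rule contour_integral_bound_linepath)
        show "k contour_integrable_on linepath (Complex (- \<beta>) (- real K)) (Complex \<beta> (- real K))"
          using sub by (intro contour_integrable_continuous_linepath continuous_on_subset[OF contk]) auto
        fix w assume w: "w \<in> closed_segment (Complex (- \<beta>) (- real K)) (Complex \<beta> (- real K))"
        show "norm (k w) \<le> C * exp (- (real K - 1)\<^sup>2)" using segs[OF w] K by (intro kb) auto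
      qed (use C0 in auto)
      moreover have "norm (T K) \<le> C * exp (- (real K - 1)\<^sup>2) * norm (Complex (- \<beta>) (real K) - Complex \<beta> (real K))"
        unfolding T_def
      proof (rule contour_integral_bound_linepath)
        show "k contour_integrable_on linepath (Complex \<beta> (real K)) (Complex (- \<beta>) (real K))"
          using sub[of "real K"] by (intro contour_integrable_continuous_linepath continuous_on_subset[OF contk]) (auto simp: closed_segment_commute)
        fix w assume w: "w \<in> closed_segment (Complex \<beta> (real K)) (Complex (- \<beta>) (real K))"
        show "norm (k w) \<le> C * exp (- (real K - 1)\<^sup>2)"
          using segs[of w "real K"] w K by (intro kb) (auto simp: closed_segment_commute)
      qed (use C0 in auto)
      moreover have "norm (Complex \<beta> (- real K) - Complex (- \<beta>) (- real K)) \<le> 2"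
        "norm (Complex (- \<beta>) (real K) - Complex \<beta> (real K)) \<le> 2"
        using \<beta> cmod_le[of "Complex \<beta> (- real K) - Complex (- \<beta>) (- real K)"] cmod_le[of "Complex (- \<beta>) (real K) - Complex \<beta> (real K)"] by auto
      then have "C * exp (- (real K - 1)\<^sup>2) * norm (Complex \<beta> (- real K) - Complex (- \<beta>) (- real K)) \<le> C * exp (- (real K - 1)\<^sup>2) * 2"
        "C * exp (- (real K - 1)\<^sup>2) * norm (Complex (- \<beta>) (real K) - Complex \<beta> (real K)) \<le> C * exp (- (real K - 1)\<^sup>2) * 2"
        using C0 by (auto intro!: mult_left_mono)
      ultimately show "norm (B K + T K) \<le> C * exp (- (real K - 1)\<^sup>2) * 4"
        using norm_triangle_ineq[of "B K" "T K"] by linarith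
    qed
    have "(\<lambda>K. exp (- (real K - 1)\<^sup>2)) \<longlonglongrightarrow> 0" by real_asymp
    from tendsto_mult[OF tendsto_mult[OF tendsto_const[of C] this] tendsto_const[of 4]]
    show "(\<lambda>K. C * exp (- (real K - 1)\<^sup>2) * 4) \<longlonglongrightarrow> 0" by simp
  qed
  have rect: "(-1) ^ (m + 1) * h (of_nat (m + 1))
      = (B K + T K) + integral {- real K..real K} (\<lambda>v. - f2 (\<beta> - v)) + integral {- real K..real K} (\<lambda>v. f1 (- \<beta> - v))"
    if K: "K \<ge> 1" for K :: nat
  proof -
    define a1 where "a1 = Complex (- \<beta>) (- real K)"
    define a2 where "a2 = Complex \<beta> (- real K)"
    define a3 where "a3 = Complex \<beta> (real K)"
    define a4 where "a4 = Complex (- \<beta>) (real K)"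
    define R where "R = rectpath a1 a3"
    have le: "Re a1 \<le> Re a3" "Im a1 \<le> Im a3" using \<beta> by (auto simp: a1_def a3_def)
    have pim: "path_image R = cbox a1 a3 - box a1 a3"
      unfolding R_def by (rule path_image_rectpath_cbox_minus_box[OF le])
    have pimS: "path_image R \<subseteq> S - {0}"
    proof
      fix w assume "w \<in> path_image R"
      then have "w \<in> cbox a1 a3" "w \<notin> box a1 a3" by (auto simp: pim)
      then have w: "\<bar>Re w\<bar> \<le> \<beta>" "\<bar>Im w\<bar> \<le> real K" "Re w = \<beta> \<or> Re w = - \<beta> \<or> \<bar>Im w\<bar> = real K"
        by (auto simp: in_cbox_complex_iff in_box_complex_iff a1_def a3_def)
      show "w \<in> S - {0}" using w K by (intro seg) auto
    qed
    have cboxS: "cbox a1 a3 \<subseteq> S"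
      using \<beta>S by (auto simp: in_cbox_complex_iff a1_def a3_def S_def)
    have Rdef: "R = linepath a1 a2 +++ linepath a2 a3 +++ linepath a3 a4 +++ linepath a4 a1"
      by (simp add: R_def rectpath_def Let_def a1_def a2_def a3_def a4_def)
    have segsS: "closed_segment a1 a2 \<subseteq> S - {0}" "closed_segment a2 a3 \<subseteq> S - {0}"
        "closed_segment a3 a4 \<subseteq> S - {0}" "closed_segment a4 a1 \<subseteq> S - {0}"
      using pimS unfolding Rdef by (simp_all add: path_image_join)
    note ci = contour_integrable_continuous_linepath[OF continuous_on_subset[OF contk]]
    have sum: "contour_integral R k = contour_integral (linepath a1 a2) k + (contour_integral (linepath a2 a3) k
        + (contour_integral (linepath a3 a4) k + contour_integral (linepath a4 a1) k))"
      unfolding Rdef using ci[OF segsS(1)] ci[OF segsS(2)] ci[OF segsS(3)] ci[OF segsS(4)] by simp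
    have "contour_integral R k = 2 * pi * \<i> * (\<Sum>p\<in>{0}. winding_number R p * residue k p)"
    proof (rule Residue_theorem[OF S(1) convex_connected[OF S(2)] _ holk])
      show "\<forall>z. z \<notin> S \<longrightarrow> winding_number R z = 0"
        unfolding R_def using cboxS by (intro allI impI winding_number_rectpath_outside le) auto
    qed (use pimS in \<open>auto simp: R_def\<close>)
    also have "winding_number R 0 = 1"
      unfolding R_def by (rule winding_number_rectpath) (use \<beta> K in \<open>auto simp: in_box_complex_iff a1_def a3_def\<close>)
    then have "2 * pi * \<i> * (\<Sum>p\<in>{0}. winding_number R p * residue k p) = (-1) ^ (m + 1) * h (of_nat (m + 1))"
      using res by simp
    finally have total: "contour_integral R k = (-1) ^ (m + 1) * h (of_nat (m + 1))" .
    have ii: "- \<i> * I * \<i> = I" for I by (simp add: complex_eq_iff)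
    have I2: "contour_integral (linepath a2 a3) k = integral {- real K..real K} (\<lambda>v. - f2 (\<beta> - v))"
    proof -
      have "(k has_contour_integral contour_integral (linepath a2 a3) k) (linepath a2 a3)"
        by (rule has_contour_integral_integral[OF ci[OF segsS(2)]])
      then have "((\<lambda>v. k (Complex \<beta> v)) has_integral (- \<i> * contour_integral (linepath a2 a3) k)) {- real K..real K}"
        by (subst (asm) has_contour_integral_linepath_same_Re_iff[where c = \<beta> and a = "- real K" and b = "real K"])
           (use K in \<open>auto simp: a2_def a3_def\<close>)
      from has_integral_mult_left[OF this, of \<i>]
      have "((\<lambda>v. k (Complex \<beta> v) * \<i>) has_integral (contour_integral (linepath a2 a3) k)) {- real K..real K}"
        by (simp only: ii)
      then show ?thesis unfolding kR by (rule integral_unique[symmetric])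
    qed
    have I4: "contour_integral (linepath a4 a1) k = integral {- real K..real K} (\<lambda>v. f1 (- \<beta> - v))"
    proof -
      have seg': "closed_segment a1 a4 \<subseteq> S - {0}" using segsS(4) by (simp add: closed_segment_commute)
      have "(k has_contour_integral contour_integral (linepath a1 a4) k) (linepath a1 a4)"
        by (rule has_contour_integral_integral[OF ci[OF seg']])
      then have "((\<lambda>v. k (Complex (- \<beta>) v)) has_integral (- \<i> * contour_integral (linepath a1 a4) k)) {- real K..real K}"
        by (subst (asm) has_contour_integral_linepath_same_Re_iff[where c = "- \<beta>" and a = "- real K" and b = "real K"])
           (use K in \<open>auto simp: a1_def a4_def\<close>)
      from has_integral_neg[OF has_integral_mult_left[OF this, of \<i>]]
      have "((\<lambda>v. - (k (Complex (- \<beta>) v) * \<i>)) has_integral (- contour_integral (linepath a1 a4) k)) {- real K..real K}"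
        by (simp only: ii)
      then have "integral {- real K..real K} (\<lambda>v. f1 (- \<beta> - v)) = - contour_integral (linepath a1 a4) k"
        unfolding kL minus_minus by (rule integral_unique)
      also have "\<dots> = contour_integral (linepath a4 a1) k"
        using contour_integral_reversepath[of "linepath a4 a1" k] by simp
      finally show ?thesis by simp
    qed
    show ?thesis
    proof -
      have "B K = contour_integral (linepath a1 a2) k" "T K = contour_integral (linepath a3 a4) k"
        by (simp_all add: B_def T_def a1_def a2_def a3_def a4_def)
      then show ?thesis using total unfolding sum I2[symmetric] I4[symmetric] by (simp only: ac_simps)
    qed
  qed
  have af: "integrable lborel (\<lambda>v. - f2 (\<beta> - v))" "(\<integral>v. - f2 (\<beta> - v) \<partial>lborel) = - (\<integral>v. f2 v \<partial>lborel)"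
      "integrable lborel (\<lambda>v. f1 (- \<beta> - v))" "(\<integral>v. f1 (- \<beta> - v) \<partial>lborel) = (\<integral>v. f1 v \<partial>lborel)"
    using lborel_integrable_real_affine[OF int2, of "-1" \<beta>] lborel_integral_real_affine[of "-1" f2 \<beta>]
      lborel_integrable_real_affine[OF int1, of "-1" "- \<beta>"] lborel_integral_real_affine[of "-1" f1 "- \<beta>"]
    by auto
  have "(\<lambda>K. (B K + T K) + integral {- real K..real K} (\<lambda>v. - f2 (\<beta> - v)) + integral {- real K..real K} (\<lambda>v. f1 (- \<beta> - v)))
      \<longlonglongrightarrow> 0 + - (\<integral>v. f2 v \<partial>lborel) + (\<integral>v. f1 v \<partial>lborel)"
    using integral_symmetric_interval_tendsto[OF af(1)] integral_symmetric_interval_tendsto[OF af(3)]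
    unfolding af(2,4) by (intro tendsto_add ends)
  moreover have "\<forall>\<^sub>F K in sequentially. (B K + T K) + integral {- real K..real K} (\<lambda>v. - f2 (\<beta> - v)) + integral {- real K..real K} (\<lambda>v. f1 (- \<beta> - v))
      = (-1) ^ (m + 1) * h (of_nat (m + 1))"
    by (rule eventually_sequentiallyI[of 1]) (use rect in simp)
  ultimately have "(\<lambda>K. (-1) ^ (m + 1) * h (of_nat (m + 1))) \<longlonglongrightarrow> 0 + - (\<integral>v. f2 v \<partial>lborel) + (\<integral>v. f1 v \<partial>lborel)"
    by (rule Lim_transform_eventually)
  then have "(-1) ^ (m + 1) * h (of_nat (m + 1)) = 0 + - (\<integral>v. f2 v \<partial>lborel) + (\<integral>v. f1 v \<partial>lborel)"
    by (simp only: tendsto_const_iff[OF sequentially_bot])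
  moreover have "(\<integral>v. f1 v \<partial>lborel) = line_integral h (real m + 1/2)"
    by (simp add: f1_def line_integral_def)
  moreover have "(\<integral>v. f2 v \<partial>lborel) = line_integral h (real m + 3/2)"
  proof -
    have "real (m + 1) + 1/2 = real m + 3/2" by simp
    then show ?thesis unfolding f2_def line_integral_def by (simp only:)
  qed
  ultimately show ?thesis by simp
qed

section \<open>The Mordell integral\<close>

text \<open>The imaginary part of the centre produces an oscillating factor, so the integral is a
  value of the characteristic function of the normal distribution; no contour has to be
  moved.\<close>

lemma integral_gaussian_complex_shift:
  fixes a :: complex
  shows
  "(\<integral>u. exp (- 2 * of_real pi * (of_real u - a)\<^sup>2) \<partial>lborel) = of_real (1 / sqrt 2)"
proof -
  \<comment> \<open>This scale turns \<open>2 * pi * (c * v)\<^sup>2\<close> into the exponent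
    \<open>v\<^sup>2 / 2\<close> of the standard normal density.\<close>
  define c where "c = 1 / (2 * sqrt pi)"
  define t where "t = 2 * sqrt pi * Im a"
  have c: "c > 0" by (simp add: c_def)
  define f where "f u = exp (- 2 * of_real pi * (of_real u - a)\<^sup>2)" for u :: real
  have rescale: "f (Re a + c * v) = of_real (sqrt (2 * pi) * exp (t\<^sup>2 / 2)) * (std_normal_density v *\<^sub>R iexp (t * v))" for v
  proof -
    have pp: "complex_of_real (sqrt pi) * complex_of_real (sqrt pi) = of_real pi"
      by (simp flip: of_real_mult)
    have e: "of_real (Re a + c * v) - a = of_real (c * v) - \<i> * of_real (Im a)"
      by (simp add: complex_eq_iff)
    have "- 2 * of_real pi * (of_real (Re a + c * v) - a)\<^sup>2
        = of_real (- 2 * pi * (c * v)\<^sup>2 + 2 * pi * (Im a)\<^sup>2) + \<i> * of_real (4 * pi * c * v * Im a)"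
      unfolding e by (simp add: power2_eq_square algebra_simps)
    also have "- 2 * pi * (c * v)\<^sup>2 + 2 * pi * (Im a)\<^sup>2 = t\<^sup>2 / 2 - v\<^sup>2 / 2"
      by (simp add: c_def t_def power_mult_distrib power_divide)
    also have "4 * pi * c * v * Im a = t * v"
    proof -
      have "4 * pi * c = 2 * sqrt pi" by (simp add: c_def field_simps)
      then show ?thesis by (simp add: t_def)
    qed
    finally have "f (Re a + c * v) = of_real (exp (t\<^sup>2 / 2 - v\<^sup>2 / 2)) * iexp (t * v)"
      by (simp only: f_def exp_add exp_of_real)
    also have "exp (t\<^sup>2 / 2 - v\<^sup>2 / 2) = sqrt (2 * pi) * exp (t\<^sup>2 / 2) * std_normal_density v"
    proof -
      have "exp (t\<^sup>2 / 2 - v\<^sup>2 / 2) = exp (t\<^sup>2 / 2) * exp (- v\<^sup>2 / 2)"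
        by (simp flip: exp_add)
      then show ?thesis by (simp add: std_normal_density_def)
    qed
    finally show ?thesis by (simp add: scaleR_conv_of_real)
  qed
  have "(\<integral>u. f u \<partial>lborel) = c *\<^sub>R (\<integral>v. f (Re a + c * v) \<partial>lborel)"
    using lborel_integral_real_affine[of c f "Re a"] c by simp
  also have "(\<integral>v. f (Re a + c * v) \<partial>lborel)
      = of_real (sqrt (2 * pi) * exp (t\<^sup>2 / 2)) * (\<integral>v. std_normal_density v *\<^sub>R iexp (t * v) \<partial>lborel)"
    unfolding rescale by (rule integral_mult_right_zero)
  also have "(\<integral>v. std_normal_density v *\<^sub>R iexp (t * v) \<partial>lborel) = char std_normal_distribution t"
    unfolding char_def by (subst integral_density) auto
  also have "\<dots> = of_real (exp (- (t\<^sup>2) / 2))" by (simp add: char_std_normal_distribution)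
  also have "c *\<^sub>R (of_real (sqrt (2 * pi) * exp (t\<^sup>2 / 2)) * of_real (exp (- (t\<^sup>2) / 2)))
      = (of_real (c * sqrt (2 * pi) * (exp (t\<^sup>2 / 2) * exp (- (t\<^sup>2) / 2))) :: complex)"
    by (simp add: scaleR_conv_of_real)
  also have "c * sqrt (2 * pi) * (exp (t\<^sup>2 / 2) * exp (- (t\<^sup>2) / 2)) = 1 / sqrt 2"
    by (simp add: c_def real_sqrt_mult field_simps flip: exp_add)
  finally show ?thesis by (simp add: f_def)
qed

text \<open>At the saddle \<open>x powr (1 - s)\<close> and
  \<open>exp (pi * \<i> * x\<^sup>2)\<close> contribute equally to the second derivative of the
  exponent, \<open>2 * pi * \<i>\<close> each; half of the total is the coefficient here.\<close>

definition gauss :: "complex \<Rightarrow> complex \<Rightarrow> complex" where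
  "gauss z x = exp (2 * of_real pi * \<i> * (x - z)\<^sup>2)"

text \<open>The square of the direction \<open>cis (pi / 4)\<close> is \<open>\<i>\<close>, so along
  the line the exponent is \<open>- 2 * pi\<close> times the square of a shifted parameter. Neither
  \<open>z\<close> nor \<open>c\<close> influences the value.\<close>

lemma integral_gauss_aux_line:
  "(\<integral>u. gauss z (aux_line c u) * (- cis (pi / 4)) \<partial>lborel) = - cis (pi / 4) / of_real (sqrt 2)"
proof -
  define a where "a = (of_real c - z) / cis (pi / 4)"
  have cis2: "cis (pi / 4) * cis (pi / 4) = \<i>" by (simp add: cis_mult)
  have "gauss z (aux_line c u) = exp (- 2 * of_real pi * (of_real u - a)\<^sup>2)" for u
  proof -
    have "aux_line c u - z = cis (pi / 4) * (a - of_real u)"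
      by (simp add: a_def aux_line_def right_diff_distrib mult.commute)
    then have sq: "(aux_line c u - z)\<^sup>2 = \<i> * (a - of_real u)\<^sup>2"
      by (simp add: power_mult_distrib power2_eq_square[of "cis (pi/4)"] cis2)
    have "2 * of_real pi * \<i> * (\<i> * Y) = - 2 * of_real pi * Y" for Y by (simp add: complex_eq_iff)
    then have "2 * of_real pi * \<i> * (aux_line c u - z)\<^sup>2 = - 2 * of_real pi * (a - of_real u)\<^sup>2"
      unfolding sq .
    then show ?thesis unfolding gauss_def power2_commute[of "of_real u" a] by (rule arg_cong)
  qed
  then have "(\<integral>u. gauss z (aux_line c u) * (- cis (pi / 4)) \<partial>lborel)
      = (\<integral>u. exp (- 2 * of_real pi * (of_real u - a)\<^sup>2) \<partial>lborel) * (- cis (pi / 4))"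
    by (simp only: integral_mult_left_zero)
  also have "\<dots> = - cis (pi / 4) / of_real (sqrt 2)"
    unfolding integral_gaussian_complex_shift by simp
  finally show ?thesis .
qed

lemma quadratic_decay:
  fixes a b u :: real
  assumes "a \<ge> 2" "b \<ge> 0"
  shows "exp (- a * u\<^sup>2 + b * \<bar>u\<bar> + c) \<le> exp (c + b\<^sup>2 / 4) * exp (- u\<^sup>2)"
proof -
  have "0 \<le> (\<bar>u\<bar> - b / 2)\<^sup>2" by simp
  then have "b * \<bar>u\<bar> \<le> u\<^sup>2 + b\<^sup>2 / 4" by (simp add: power2_diff power_divide mult.commute)
  moreover have "2 * u\<^sup>2 \<le> a * u\<^sup>2" using assms by (intro mult_right_mono) auto
  ultimately show ?thesis by (simp flip: exp_add)
qed

lemma gauss_decay: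
  obtains C where "\<And>c u. real m + 1/2 \<le> c \<Longrightarrow> c \<le> real m + 3/2 \<Longrightarrow> norm (gauss z (aux_line c u)) \<le> C * exp (- u\<^sup>2)"
proof -
  define q where "q = real m + 3/2 + norm z"
  have q: "q \<ge> 0" by (simp add: q_def)
  define b where "b = 8 * pi * q"
  define e where "e = 4 * pi * q * q"
  have "norm (gauss z (aux_line c u)) \<le> exp (e + b\<^sup>2 / 4) * exp (- u\<^sup>2)"
    if c: "real m + 1/2 \<le> c" "c \<le> real m + 3/2" for c u
  proof -
    define A where "A = c - Re z"
    define B where "B = Im z"
    define r where "r = sqrt 2 / 2"
    have r: "0 \<le> r" "r \<le> 1" "r * r = 1/2" using real_sqrt_le_mono[of 2 4] by (auto simp: r_def)
    have A: "\<bar>A\<bar> \<le> q" using c abs_Re_le_cmod[of z] by (auto simp: A_def q_def)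
    have B: "\<bar>B\<bar> \<le> q" using abs_Im_le_cmod[of z] by (auto simp: B_def q_def)
    have "norm (gauss z (aux_line c u)) = exp (- 4 * pi * ((A - u * r) * (- u * r - B)))"
      by (simp add: gauss_def norm_exp_eq_Re Re_aux_line Im_aux_line A_def B_def r_def power2_eq_square algebra_simps)
    also have "(A - u * r) * (- u * r - B) = u\<^sup>2 * (r * r) - (A * r * u - B * r * u) - A * B"
      by (simp add: power2_eq_square algebra_simps)
    also have "- 4 * pi * (u\<^sup>2 * (r * r) - (A * r * u - B * r * u) - A * B)
        = - (2 * pi) * u\<^sup>2 + 4 * pi * ((A - B) * r * u) + 4 * pi * (A * B)"
      unfolding r(3) by (simp add: algebra_simps)
    also have "\<dots> \<le> - (2 * pi) * u\<^sup>2 + b * \<bar>u\<bar> + e"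
    proof -
      have "\<bar>A - B\<bar> * r \<le> (2 * q) * 1" using A B r by (intro mult_mono) auto
      then have "\<bar>A - B\<bar> * r * \<bar>u\<bar> \<le> (2 * q) * \<bar>u\<bar>" by (intro mult_right_mono) auto
      then have "(A - B) * r * u \<le> 2 * q * \<bar>u\<bar>"
        using abs_ge_self[of "(A - B) * r * u"] r by (simp add: abs_mult)
      then have "4 * pi * ((A - B) * r * u) \<le> 4 * pi * (2 * q * \<bar>u\<bar>)" by (intro mult_left_mono) auto
      moreover have "\<bar>A\<bar> * \<bar>B\<bar> \<le> q * q" using A B q by (intro mult_mono) auto
      then have "A * B \<le> q * q" using abs_ge_self[of "A * B"] by (simp add: abs_mult)
      then have "4 * pi * (A * B) \<le> 4 * pi * (q * q)" by (intro mult_left_mono) auto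
      moreover have "b * \<bar>u\<bar> = 4 * pi * (2 * q * \<bar>u\<bar>)" "e = 4 * pi * (q * q)"
        by (simp_all add: b_def e_def)
      ultimately show ?thesis by linarith
    qed
    finally have "norm (gauss z (aux_line c u)) \<le> exp (- (2 * pi) * u\<^sup>2 + b * \<bar>u\<bar> + e)" by simp
    also have "\<dots> \<le> exp (e + b\<^sup>2 / 4) * exp (- u\<^sup>2)"
      using pi_gt3 q by (intro quadratic_decay) (auto simp: b_def)
    finally show ?thesis .
  qed
  then show ?thesis using that by blast
qed

lemma gauss_holomorphic: "gauss z holomorphic_on A"
  unfolding gauss_def by (intro holomorphic_intros)

lemma gauss_integrable:
  "integrable lborel (\<lambda>u. gauss z (aux_line (real m + 1/2) u) / sin_kernel (aux_line (real m + 1/2) u) * (- cis (pi / 4)))"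
proof -
  obtain C where C: "\<And>c u. real m + 1/2 \<le> c \<Longrightarrow> c \<le> real m + 3/2 \<Longrightarrow> norm (gauss z (aux_line c u)) \<le> C * exp (- u\<^sup>2)"
    using gauss_decay by blast
  show ?thesis
    by (rule integrable_aux_line(1)[OF holomorphic_on_imp_continuous_on[OF gauss_holomorphic]]) (rule C; simp)
qed

text \<open>
  Moving \<open>z\<close> by \<open>\<plusminus>1/4\<close> multiplies the Gaussian by \<open>exp (\<plusminus>pi * \<i> * x)\<close>, up to a factor that does not
  depend on \<open>x\<close>, so the difference cancels the kernel. Together with the shift of \<open>z\<close> by 1, which moves
  the line across one pole, this determines the integral.
\<close>

lemma gauss_line_integral_quarter_shift:
  fixes z :: complex and m :: nat
  defines "J \<equiv> \<lambda>z. line_integral (gauss z) (real m + 1/2)"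
  shows "exp (- 2 * of_real pi * \<i> * (z - 1/4)\<^sup>2) * J (z - 1/4) - exp (- 2 * of_real pi * \<i> * (z + 1/4)\<^sup>2) * J (z + 1/4)
     = - cis (pi / 4) / of_real (sqrt 2) * exp (- 2 * of_real pi * \<i> * z\<^sup>2)"
proof -
  let ?x = "aux_line (real m + 1/2)"
  let ?G = "\<lambda>w u. gauss w (?x u) / sin_kernel (?x u) * (- cis (pi / 4))"
  let ?p = "exp (- 2 * of_real pi * \<i> * (z - 1/4)\<^sup>2)" and ?q = "exp (- 2 * of_real pi * \<i> * (z + 1/4)\<^sup>2)"
  let ?r = "exp (- 2 * of_real pi * \<i> * z\<^sup>2)"
  have nz: "sin_kernel (?x u) \<noteq> 0" for u
    using norm_sin_kernel_aux_line_ge_half[of m u] by auto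
  have alg: "?p * gauss (z - 1/4) x - ?q * gauss (z + 1/4) x = ?r * gauss z x * sin_kernel x" for x
  proof -
    have e1: "- 2 * of_real pi * \<i> * (z - 1/4)\<^sup>2 + 2 * of_real pi * \<i> * (x - (z - 1/4))\<^sup>2
        = (- 2 * of_real pi * \<i> * z\<^sup>2 + 2 * of_real pi * \<i> * (x - z)\<^sup>2) + of_real pi * \<i> * x"
      by (simp add: power2_eq_square algebra_simps)
    have e2: "- 2 * of_real pi * \<i> * (z + 1/4)\<^sup>2 + 2 * of_real pi * \<i> * (x - (z + 1/4))\<^sup>2
        = (- 2 * of_real pi * \<i> * z\<^sup>2 + 2 * of_real pi * \<i> * (x - z)\<^sup>2) + - (of_real pi * \<i> * x)"
      by (simp add: power2_eq_square algebra_simps)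
    have "?p * gauss (z - 1/4) x - ?q * gauss (z + 1/4) x
      = exp ((- 2 * of_real pi * \<i> * z\<^sup>2 + 2 * of_real pi * \<i> * (x - z)\<^sup>2) + of_real pi * \<i> * x)
       - exp ((- 2 * of_real pi * \<i> * z\<^sup>2 + 2 * of_real pi * \<i> * (x - z)\<^sup>2) + - (of_real pi * \<i> * x))"
      unfolding gauss_def exp_add[symmetric] e1 e2 ..
    also have "\<dots> = ?r * gauss z x * sin_kernel x"
      unfolding exp_add gauss_def sin_kernel_def by (simp only: right_diff_distrib)
    finally show ?thesis .
  qed
  have "?p * J (z - 1/4) - ?q * J (z + 1/4) = (\<integral>u. ?p * ?G (z - 1/4) u - ?q * ?G (z + 1/4) u \<partial>lborel)"
  proof -
    have "integrable lborel (\<lambda>u. ?p * ?G (z - 1/4) u)" "integrable lborel (\<lambda>u. ?q * ?G (z + 1/4) u)"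
      by (intro integrable_mult_right gauss_integrable)+
    from Bochner_Integration.integral_diff[OF this]
    show ?thesis unfolding J_def line_integral_def by (simp only: integral_mult_right_zero)
  qed
  also have "\<dots> = (\<integral>u. ?r * (gauss z (?x u) * (- cis (pi / 4))) \<partial>lborel)"
  proof (rule Bochner_Integration.integral_cong[OF refl])
    fix u
    have "?p * ?G (z - 1/4) u - ?q * ?G (z + 1/4) u
        = (?p * gauss (z - 1/4) (?x u) - ?q * gauss (z + 1/4) (?x u)) / sin_kernel (?x u) * (- cis (pi / 4))"
      by (simp add: diff_divide_distrib algebra_simps)
    also have "\<dots> = ?r * (gauss z (?x u) * (- cis (pi / 4)))"
      unfolding alg using nz[of u] by simp
    finally show "?p * ?G (z - 1/4) u - ?q * ?G (z + 1/4) u = ?r * (gauss z (?x u) * (- cis (pi / 4)))" .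
  qed
  also have "\<dots> = ?r * (- cis (pi / 4) / of_real (sqrt 2))"
    by (subst integral_mult_right_zero) (simp only: integral_gauss_aux_line)
  finally show ?thesis by (simp only: mult.commute)
qed

lemma gauss_line_integral_unit_shift:
  "line_integral (gauss (z + 1)) (c + 1) = - line_integral (gauss z) c"
proof -
  have x1: "aux_line (c + 1) u = aux_line c u + 1" for u by (simp add: aux_line_def)
  have "line_integral (gauss (z + 1)) (c + 1)
     = (\<integral>u. - (gauss z (aux_line c u) / sin_kernel (aux_line c u) * (- cis (pi / 4))) \<partial>lborel)"
    unfolding line_integral_def x1 sin_kernel_add_one by (simp add: gauss_def)
  also have "\<dots> = - line_integral (gauss z) c"
    unfolding line_integral_def by (rule integral_minus)
  finally show ?thesis .
qed

text \<open>The quarter shifts about \<open>z + 1/4\<close> and \<open>z + 3/4\<close> link the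
  integral at \<open>z\<close> with that at \<open>z + 1\<close>. The unit shift, together with the
  residue at \<open>N\<close>, leads back to \<open>z\<close>. The result is a linear equation for
  the integral, with coefficient \<open>1 + 1 / y ^ 4\<close> because completing the square at
  \<open>z + 1\<close> brings in \<open>1 / y ^ 4\<close>.\<close>

lemma gauss_line_integral_eq:
  fixes z :: complex and N :: nat
  assumes N: "N \<ge> 1"
  defines "y \<equiv> exp (of_real pi * \<i> * z)"
  shows "line_integral (gauss z) (real N + 1/2) * (1 + 1 / y ^ 4) + (-1) ^ N * gauss z (of_nat N) / y ^ 4
      = - cis (pi / 8) / of_real (sqrt 2) * (1 / y - 1 / y ^ 3)"
proof -
  define J where "J w = line_integral (gauss w) (real N + 1/2)" for w
  define k where "k = cis (pi / 4) / of_real (sqrt 2)"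
  define F where "F w = exp (- 2 * of_real pi * \<i> * w\<^sup>2)" for w :: complex
  have y0: "y \<noteq> 0" by (simp add: y_def)
  have s1: "F z * J z - F (z + 1/2) * J (z + 1/2) = - k * F (z + 1/4)"
  proof -
    have "z + 1/4 - 1/4 = z" "z + 1/4 + 1/4 = z + 1/2" by simp_all
    then show ?thesis
      using gauss_line_integral_quarter_shift[of "z + 1/4" N] by (simp only: J_def F_def k_def minus_divide_left)
  qed
  have s2: "F (z + 1/2) * J (z + 1/2) - F (z + 1) * J (z + 1) = - k * F (z + 3/4)"
  proof -
    have "z + 3/4 - 1/4 = z + 1/2" "z + 3/4 + 1/4 = z + 1" by simp_all
    then show ?thesis
      using gauss_line_integral_quarter_shift[of "z + 3/4" N] by (simp only: J_def F_def k_def minus_divide_left)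
  qed
  have Jz1: "J (z + 1) = - (J z + (-1) ^ N * gauss z (of_nat N))"
  proof -
    obtain m where m: "N = m + 1" using N by (metis Suc_eq_plus1 Suc_le_D One_nat_def)
    obtain C where C: "\<And>c u. real m + 1/2 \<le> c \<Longrightarrow> c \<le> real m + 3/2 \<Longrightarrow> norm (gauss z (aux_line c u)) \<le> C * exp (- u\<^sup>2)"
      using gauss_decay by blast
    have e: "real N + 1/2 = (real m + 1/2) + 1" "real N + 1/2 = real m + 3/2" by (simp_all add: m)
    have "J (z + 1) = - line_integral (gauss z) (real m + 1/2)"
      unfolding J_def e(1) by (rule gauss_line_integral_unit_shift)
    also have "line_integral (gauss z) (real m + 1/2) = line_integral (gauss z) (real m + 3/2) + (-1) ^ (m + 1) * gauss z (of_nat (m + 1))"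
      by (rule line_integral_shift[OF gauss_holomorphic C])
    finally show ?thesis using e(2) by (simp only: J_def m)
  qed
  have F1: "F (z + 1) = F z / y ^ 4"
  proof -
    have "- 2 * of_real pi * \<i> * (z + 1)\<^sup>2 = - 2 * of_real pi * \<i> * z\<^sup>2 - of_nat 4 * (of_real pi * \<i> * z) - 2 * of_real pi * \<i>"
      by (simp add: power2_eq_square algebra_simps)
    then have "F (z + 1) = exp (- 2 * of_real pi * \<i> * z\<^sup>2 - of_nat 4 * (of_real pi * \<i> * z) - 2 * of_real pi * \<i>)"
      by (simp only: F_def)
    also have "\<dots> = F z / y ^ 4"
      unfolding exp_diff exp_of_nat_mult y_def F_def by simp
    finally show ?thesis .
  qed
  have F14: "F (z + 1/4) = F z / y * cis (- pi / 8)"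
  proof -
    have "- 2 * of_real pi * \<i> * (z + 1/4)\<^sup>2 = - 2 * of_real pi * \<i> * z\<^sup>2 - of_real pi * \<i> * z + \<i> * of_real (- pi / 8)"
      by (simp add: power2_eq_square algebra_simps)
    then have "F (z + 1/4) = exp (- 2 * of_real pi * \<i> * z\<^sup>2 - of_real pi * \<i> * z + \<i> * of_real (- pi / 8))"
      by (simp only: F_def)
    then show ?thesis unfolding exp_add exp_diff y_def F_def cis_conv_exp .
  qed
  have F34: "F (z + 3/4) = - F z / y ^ 3 * cis (- pi / 8)"
  proof -
    have "- 2 * of_real pi * \<i> * (z + 3/4)\<^sup>2 = - 2 * of_real pi * \<i> * z\<^sup>2 - of_nat 3 * (of_real pi * \<i> * z) + \<i> * of_real (- pi / 8) - \<i> * of_real pi"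
      by (simp add: power2_eq_square algebra_simps)
    then have "F (z + 3/4) = exp (- 2 * of_real pi * \<i> * z\<^sup>2 - of_nat 3 * (of_real pi * \<i> * z) + \<i> * of_real (- pi / 8) - \<i> * of_real pi)"
      by (simp only: F_def)
    also have "\<dots> = - F z / y ^ 3 * cis (- pi / 8)"
      unfolding exp_diff exp_add exp_of_nat_mult y_def F_def cis_conv_exp by simp
    finally show ?thesis .
  qed
  have "F z * J z - F (z + 1) * J (z + 1) = - k * F (z + 1/4) + - k * F (z + 3/4)"
  proof -
    have "F z * J z - F (z + 1) * J (z + 1) = (F z * J z - F (z + 1/2) * J (z + 1/2)) + (F (z + 1/2) * J (z + 1/2) - F (z + 1) * J (z + 1))"
      by simp
    then show ?thesis by (simp only: s1 s2)
  qed
  then have "F z * (J z * (1 + 1 / y ^ 4) + (-1) ^ N * gauss z (of_nat N) / y ^ 4)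
      = F z * (- (k * cis (- pi / 8)) * (1 / y - 1 / y ^ 3))"
    unfolding Jz1 F1 F14 F34 using y0 by (simp add: field_simps)
  moreover have "F z \<noteq> 0" by (simp add: F_def)
  ultimately have "J z * (1 + 1 / y ^ 4) + (-1) ^ N * gauss z (of_nat N) / y ^ 4
      = - (k * cis (- pi / 8)) * (1 / y - 1 / y ^ 3)" by (rule mult_left_cancel[THEN iffD1, rotated])
  moreover have "k * cis (- pi / 8) = cis (pi / 8) / of_real (sqrt 2)"
    by (simp add: k_def cis_mult)
  ultimately show ?thesis by (simp add: J_def)
qed

text \<open>
  The residues at all integers to the left of the line, summed over \<open>n = N - j\<close>. The sign is
  \<open>(-1)\<^sup>n = (-1) ^ (N + j)\<close>, written so that no negative exponent occurs.
\<close>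

lemma gauss_mordell:
  fixes z :: complex and N :: nat
  assumes N: "N \<ge> 1" and z: "Im z > 0"
  shows "(\<lambda>j. (-1) ^ (N + j) * gauss z (of_nat N - of_nat j)) sums
     (- cis (5 * pi / 8) / of_real (sqrt 2) * (sin (of_real pi * z) / cos (2 * of_real pi * z))
       - line_integral (gauss z) (real N + 1/2))"
    and "cos (2 * of_real pi * z) \<noteq> 0"
proof -
  define y where "y = exp (of_real pi * \<i> * z)"
  define G where "G = (-1) ^ N * gauss z (of_nat N)"
  define J where "J = line_integral (gauss z) (real N + 1/2)"
  have y0: "y \<noteq> 0" by (simp add: y_def)
  have ny: "norm (y ^ 4) < 1"
  proof -
    have "norm y < 1" using z by (simp add: y_def norm_exp_eq_Re)
    then show ?thesis by (simp add: norm_power power_less_one_iff)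
  qed
  have y4: "1 + y ^ 4 \<noteq> 0"
  proof
    assume "1 + y ^ 4 = 0"
    then have "y ^ 4 = - 1" by (simp add: add_eq_0_iff)
    then show False using ny by simp
  qed
  have cosy: "cos (2 * of_real pi * z) = (y\<^sup>2 + 1 / y\<^sup>2) / 2"
  proof -
    have "exp (\<i> * (2 * of_real pi * z)) = y\<^sup>2"
      by (simp add: y_def power2_eq_square algebra_simps flip: exp_add)
    moreover have "exp (- (\<i> * (2 * of_real pi * z))) = 1 / y\<^sup>2"
      by (simp add: y_def power2_eq_square exp_minus divide_inverse algebra_simps flip: exp_add)
    ultimately show ?thesis by (simp add: cos_exp_eq)
  qed
  have siny: "sin (of_real pi * z) = (y - 1 / y) / (2 * \<i>)"
  proof -
    have "exp (\<i> * (of_real pi * z)) = y" by (simp add: y_def mult_ac)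
    moreover have "exp (- (\<i> * (of_real pi * z))) = 1 / y"
      by (simp add: y_def exp_minus divide_inverse mult_ac)
    ultimately show ?thesis by (simp add: sin_exp_eq)
  qed
  have c0: "y\<^sup>2 + 1 / y\<^sup>2 = (1 + y ^ 4) / y\<^sup>2"
    using y0 by (simp add: field_simps power2_eq_square eval_nat_numeral)
  show "cos (2 * of_real pi * z) \<noteq> 0"
    unfolding cosy c0 using y0 y4 by simp
  \<comment> \<open>Expanding the square about \<open>of_nat N - z\<close>, the integer part
    \<open>j * j - 2 * N * j\<close> disappears by periodicity and only the linear term in
    \<open>z\<close> survives. The series is exactly geometric with ratio \<open>- (y ^ 4)\<close>,
    of modulus below 1 since \<open>Im z > 0\<close>.\<close>
  have summand: "(-1) ^ (N + j) * gauss z (of_nat N - of_nat j) = G * (- (y ^ 4)) ^ j" for j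
  proof -
    have "2 * of_real pi * \<i> * (of_nat N - of_nat j - z)\<^sup>2
      = 2 * of_real pi * \<i> * (of_nat N - z)\<^sup>2 + of_nat (4 * j) * (of_real pi * \<i> * z)
        + 2 * of_int (int j * int j - 2 * int N * int j) * of_real pi * \<i>"
      by (simp add: power2_eq_square algebra_simps)
    moreover have "exp (2 * of_int (int j * int j - 2 * int N * int j) * of_real pi * \<i>) = 1"
      using exp_integer_2pi[of "of_int (int j * int j - 2 * int N * int j)"] by simp
    ultimately have "gauss z (of_nat N - of_nat j) = gauss z (of_nat N) * y ^ (4 * j)"
      unfolding gauss_def y_def by (simp only: exp_add exp_of_nat_mult mult_1_right)
    then show ?thesis by (simp add: G_def power_add power_mult power_minus[of "y ^ 4"])
  qed
  have "(\<lambda>j. (- (y ^ 4)) ^ j) sums (1 / (1 - (- (y ^ 4))))"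
    by (rule geometric_sums) (use ny in simp)
  then have "(\<lambda>j. G * (- (y ^ 4)) ^ j) sums (G * (1 / (1 - (- (y ^ 4)))))"
    by (rule sums_mult)
  moreover have "G * (1 / (1 - (- (y ^ 4)))) = - cis (5 * pi / 8) / of_real (sqrt 2) * (sin (of_real pi * z) / cos (2 * of_real pi * z)) - J"
  proof -
    define \<kappa> where "\<kappa> = cis (pi / 8) / of_real (sqrt 2)"
    have "cis (5 * pi / 8) = cis (pi / 8 + pi / 2)" by simp
    also have "\<dots> = cis (pi / 8) * \<i>" by (simp only: cis_mult[symmetric] cis_pi_half)
    finally have cis5: "cis (5 * pi / 8) / of_real (sqrt 2) = \<kappa> * \<i>" by (simp add: \<kappa>_def)
    have main: "J * (1 + 1 / y ^ 4) + G / y ^ 4 = - \<kappa> * (1 / y - 1 / y ^ 3)"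
      using gauss_line_integral_eq[OF N, of z] by (simp add: J_def G_def y_def \<kappa>_def)
    have "J * (y ^ 4 + 1) + G = (J * (1 + 1 / y ^ 4) + G / y ^ 4) * y ^ 4"
      using y0 by (simp add: field_simps)
    also have "\<dots> = - \<kappa> * (y ^ 3 - y)"
      unfolding main using y0 by (simp add: field_simps eval_nat_numeral)
    \<comment> \<open>After division by \<open>1 + y ^ 4\<close> the term with \<open>G\<close> is
      precisely the sum of the geometric series.\<close>
    finally have "J * (y ^ 4 + 1) + G = - \<kappa> * (y ^ 3 - y)" .
    then have "G = - \<kappa> * (y ^ 3 - y) - J * (1 + y ^ 4)" by (simp add: algebra_simps eq_diff_eq)
    then have "G * (1 / (1 - (- (y ^ 4)))) = - \<kappa> * (y ^ 3 - y) / (1 + y ^ 4) - J"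
      using y4 by (simp add: diff_divide_distrib)
    also have "- \<kappa> * (y ^ 3 - y) / (1 + y ^ 4) = - (\<kappa> * \<i>) * (((y - 1 / y) / (2 * \<i>)) / (((1 + y ^ 4) / y\<^sup>2) / 2))"
    proof -
      have "- \<kappa> * (y ^ 3 - y) / D = - (\<kappa> * \<i>) * (((y - 1 / y) / (2 * \<i>)) / ((D / y\<^sup>2) / 2))" if "D \<noteq> 0" for D
        using y0 that by (simp add: field_simps eval_nat_numeral)
      then show ?thesis using y4 by blast
    qed
    finally show ?thesis by (simp add: siny cosy c0 cis5)
  qed
  ultimately show "(\<lambda>j. (-1) ^ (N + j) * gauss z (of_nat N - of_nat j)) sums
     (- cis (5 * pi / 8) / of_real (sqrt 2) * (sin (of_real pi * z) / cos (2 * of_real pi * z))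
       - line_integral (gauss z) (real N + 1/2))"
    unfolding summand J_def by simp
qed

section \<open>Comparison with the Gaussian at the saddle point\<close>

text \<open>A turn by \<open>pi / 4\<close> carries the half-plane right of the diagonal onto the
  right half-plane without meeting the branch cut. There logarithms of quotients need no correction,
  and all integration lines in use lie in this half-plane.\<close>

lemma Ln_mult_cis_quarter_pi:
  assumes x: "Re x > Im x"
  shows "Re (x * cis (pi/4)) > 0" "Ln (x * cis (pi/4)) = Ln x + \<i> * of_real (pi/4)"
proof -
  have "Re (x * cis (pi/4)) = sqrt 2 / 2 * (Re x - Im x)"
    by (simp add: cos_45 sin_45 algebra_simps)
  then show pos: "Re (x * cis (pi/4)) > 0" using x by (simp only: zero_less_mult_iff) simp
  define y where "y = x * cis (pi/4)"
  have y: "Re y > 0" "y \<noteq> 0" using pos by (auto simp: y_def)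
  have ay: "\<bar>Im (Ln y)\<bar> < pi/2" using Re_Ln_pos_lt[of y] y by simp
  have x0: "x \<noteq> 0" using x by auto
  have "exp (Ln y - \<i> * of_real (pi/4)) = y * cis (- (pi/4))"
  proof -
    have "exp (Ln y - \<i> * of_real (pi/4)) = exp (Ln y) * exp (- (\<i> * of_real (pi/4)))"
      by (simp only: diff_conv_add_uminus exp_add)
    then show ?thesis using y by (simp add: cis_conv_exp)
  qed
  also have "\<dots> = x" by (simp add: y_def mult.assoc cis_mult)
  finally have "exp (Ln y - \<i> * of_real (pi/4)) = x" .
  moreover have "Ln (exp (Ln y - \<i> * of_real (pi/4))) = Ln y - \<i> * of_real (pi/4)"
    using ay by (intro Ln_exp) auto
  ultimately show "Ln (x * cis (pi/4)) = Ln x + \<i> * of_real (pi/4)" by (simp add: y_def)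
qed

lemma Ln_quotient_slanted:
  assumes "Re x > Im x" "Re z > Im z"
  shows "Ln (x / z) = Ln x - Ln z"
proof -
  have "Ln ((x * cis (pi/4)) / (z * cis (pi/4))) = Ln (x * cis (pi/4)) - Ln (z * cis (pi/4))"
    using assms by (intro Ln_quotient_right_half_plane Ln_mult_cis_quarter_pi)
  then show ?thesis using assms by (simp add: Ln_mult_cis_quarter_pi)
qed

text \<open>
  The saddle point \<open>\<eta>\<close> is the primary variable, and \<open>s\<close> is recovered from \<open>\<eta>\<^sup>2 = (s - 1) / (2 * pi * \<i>)\<close>.
  The last assumption says that \<open>Re s \<le> 0\<close>.
\<close>

locale saddle =
  fixes \<eta> :: complex
  assumes Im_pos: "Im \<eta> > 0"
    and Re_ge: "Re \<eta> \<ge> 100"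
    and Im_small: "100 * (Im \<eta> + Im \<eta> ^ 3) \<le> Re \<eta>"
    and prod_ge: "4 * pi * Re \<eta> * Im \<eta> \<ge> 1"
begin

definition s :: complex where "s = 1 + 2 * of_real pi * \<i> * \<eta>\<^sup>2"

definition phase :: "complex \<Rightarrow> complex" where
  "phase x = x powr (- s) * exp (of_real pi * \<i> * x\<^sup>2)"

definition model :: "complex \<Rightarrow> complex" where
  "model x = phase \<eta> * exp (2 * of_real pi * \<i> * (x - \<eta>)\<^sup>2)"

lemma Im_le: "100 * Im \<eta> \<le> Re \<eta>"
proof -
  have "100 * Im \<eta> \<le> 100 * (Im \<eta> + Im \<eta> ^ 3)" using Im_pos by simp
  then show ?thesis using Im_small by (rule order_trans)
qed

lemma eta_slanted: "Re \<eta> > Im \<eta>"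
  using Im_le Im_pos Re_ge by linarith

lemma eta_nz: "\<eta> \<noteq> 0"
  using Im_pos by auto

lemma norm_eta_ge: "norm \<eta> \<ge> Re \<eta>"
  by (rule complex_Re_le_cmod)

lemma norm_eta_le: "norm \<eta> \<le> 101/100 * Re \<eta>"
proof -
  have "norm \<eta> \<le> \<bar>Re \<eta>\<bar> + \<bar>Im \<eta>\<bar>" by (rule cmod_le)
  then show ?thesis using Im_le Im_pos Re_ge by linarith
qed

lemma Re_s: "Re s = 1 - 4 * pi * Re \<eta> * Im \<eta>"
  by (simp add: s_def power2_eq_square)

lemma phase_eq_exp:
  assumes "x \<noteq> 0"
  shows "phase x = exp (- s * Ln x + of_real pi * \<i> * x\<^sup>2)"
  using assms by (simp add: phase_def powr_def flip: exp_add)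

lemma phase_eta_nz: "phase \<eta> \<noteq> 0"
  by (simp add: phase_eq_exp eta_nz)

text \<open>With \<open>w = (x - \<eta>) / \<eta>\<close> and \<open>L = Ln (1 + w)\<close> the two
  exponents differ by exactly \<open>- L - 2 * pi * \<i> * \<eta>\<^sup>2 * (L - w + w\<^sup>2 /
  2)\<close>. The first term, of order \<open>v / norm \<eta>\<close>, appears because \<eta> is
  critical for \<open>x powr (1 - s)\<close> rather than \<open>x powr (- s)\<close>; the second is
  the cubic remainder and gives \<open>v ^ 3 / norm \<eta>\<close>.\<close>

lemma norm_phase_minus_model_le:
  assumes x: "Re x > Im x"
  defines "v \<equiv> norm (x - \<eta>)"
  shows "norm (phase x - model x) \<le> 4 * pi * (v + v ^ 3) / norm \<eta> * max (norm (phase x)) (norm (model x))"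
proof -
  define w where "w = (x - \<eta>) / \<eta>"
  define M where "M = max (norm (phase x)) (norm (model x))"
  have M0: "M \<ge> 0" by (simp add: M_def le_max_iff_disj)
  have nw: "norm w = v / norm \<eta>" by (simp add: w_def v_def norm_divide)
  have ne: "norm \<eta> > 0" using eta_nz by simp
  have v0: "v \<ge> 0" by (simp add: v_def)
  have x0: "x \<noteq> 0" using x by auto
  show ?thesis unfolding M_def[symmetric]
  proof (cases "norm w \<le> 1/2")
    case True
    define L where "L = Ln (1 + w)"
    define a where "a = - s * Ln x + of_real pi * \<i> * x\<^sup>2"
    define b where "b = - s * Ln \<eta> + of_real pi * \<i> * \<eta>\<^sup>2 + 2 * of_real pi * \<i> * (x - \<eta>)\<^sup>2"
    have a: "phase x = exp a" using x0 by (simp add: phase_eq_exp a_def)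
    have b: "model x = exp b" by (simp add: model_def phase_eq_exp eta_nz b_def exp_add)
    have "1 + w = x / \<eta>" using eta_nz by (simp add: w_def field_simps)
    then have L: "Ln x = Ln \<eta> + L"
      using Ln_quotient_slanted[OF x eta_slanted] by (simp add: L_def)
    have xw: "x = \<eta> + \<eta> * w" using eta_nz by (simp add: w_def field_simps)
    have "a - b = - s * L + of_real pi * \<i> * (x\<^sup>2 - \<eta>\<^sup>2 - 2 * (x - \<eta>)\<^sup>2)"
      unfolding a_def b_def L by (simp add: algebra_simps)
    also have "\<dots> = - L - 2 * of_real pi * \<i> * \<eta>\<^sup>2 * (L - w + w\<^sup>2 / 2)"
      unfolding s_def xw by (simp add: algebra_simps power2_eq_square)
    also have "norm \<dots> \<le> norm L + norm (2 * of_real pi * \<i> * \<eta>\<^sup>2 * (L - w + w\<^sup>2 / 2))"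
      using norm_triangle_ineq4[of "- L"] by simp
    also have "\<dots> = norm L + 2 * pi * (norm \<eta>)\<^sup>2 * norm (L - w + w\<^sup>2 / 2)"
      by (simp add: norm_mult norm_power)
    also have "\<dots> \<le> 2 * norm w + 2 * pi * (norm \<eta>)\<^sup>2 * (2 * norm w ^ 3)"
    proof -
      have E: "norm (L - w + w\<^sup>2 / 2) \<le> 2 * norm w ^ 3"
        unfolding L_def using True by (intro norm_Ln_cubic_le) auto
      have "norm L = norm ((L - w + w\<^sup>2 / 2) + w - w\<^sup>2 / 2)" by simp
      also have "\<dots> \<le> norm (L - w + w\<^sup>2 / 2) + norm w + norm (w\<^sup>2 / 2)"
        by (meson add_mono norm_triangle_ineq norm_triangle_ineq4 order_trans order_refl)
      also have "\<dots> \<le> 2 * norm w ^ 3 + norm w + (norm w)\<^sup>2 / 2"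
        using E by (simp add: norm_divide norm_power)
      also have "\<dots> \<le> 2 * norm w"
      proof -
        have "norm w * norm w \<le> 1/2 * norm w" using True by (intro mult_right_mono) auto
        moreover have "norm w * norm w * norm w \<le> 1/4 * norm w"
          using True mult_mono[OF True True] by (intro mult_right_mono) auto
        moreover have "2 * c + a + b / 2 \<le> 2 * a" if "0 \<le> a" "b \<le> 1/2 * a" "c \<le> 1/4 * a" for a b c :: real
          using that by linarith
        ultimately show ?thesis unfolding power2_eq_square power3_eq_cube using norm_ge_zero by blast
      qed
      finally show ?thesis using E by (intro add_mono mult_left_mono) auto
    qed
    also have "\<dots> = 2 * v / norm \<eta> + 4 * pi * v ^ 3 / norm \<eta>"
      using ne by (simp add: nw field_simps power2_eq_square power3_eq_cube)
    also have "\<dots> \<le> 4 * pi * (v + v ^ 3) / norm \<eta>"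
    proof -
      have "2 * v \<le> 4 * pi * v" using pi_gt3 v0 by (intro mult_right_mono) auto
      then show ?thesis using ne by (simp add: add_divide_distrib[symmetric] divide_right_mono algebra_simps)
    qed
    finally have ab: "norm (a - b) \<le> 4 * pi * (v + v ^ 3) / norm \<eta>" .
    have "norm (exp a - exp b) \<le> norm (a - b) * max (norm (exp a)) (norm (exp b))"
      by (rule norm_exp_diff_le)
    also have "\<dots> \<le> 4 * pi * (v + v ^ 3) / norm \<eta> * M"
      using ab M0 unfolding M_def a b by (intro mult_right_mono) auto
    finally show "norm (phase x - model x) \<le> 4 * pi * (v + v ^ 3) / norm \<eta> * M" by (simp add: a b)
  next
    case False
    \<comment> \<open>Far from the saddle nothing has to be compared: the factor in front of the
      maximum is at least 2, and the triangle inequality suffices.\<close>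
    then have v2: "1 \<le> 2 * v / norm \<eta>" using ne by (simp add: nw field_simps)
    have "norm (phase x - model x) \<le> norm (phase x) + norm (model x)" by (rule norm_triangle_ineq4)
    also have "\<dots> \<le> 2 * M" by (simp add: M_def)
    also have "\<dots> \<le> (4 * pi * (v + v ^ 3) / norm \<eta>) * M"
    proof (intro mult_right_mono M0)
      have "4 * v \<le> 4 * pi * v" using pi_gt3 v0 by (intro mult_right_mono) auto
      also have "\<dots> \<le> 4 * pi * (v + v ^ 3)" using v0 by (intro mult_left_mono) auto
      finally have "4 * v / norm \<eta> \<le> 4 * pi * (v + v ^ 3) / norm \<eta>" using ne by (intro divide_right_mono) auto
      then show "2 \<le> 4 * pi * (v + v ^ 3) / norm \<eta>" using v2 by simp
    qed
    finally show "norm (phase x - model x) \<le> 4 * pi * (v + v ^ 3) / norm \<eta> * M" .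
  qed
qed

text \<open>If \<open>phase\<close> is the larger of the two, the difference is at most half of it
  and can be absorbed on the left.\<close>

lemma norm_phase_le_2_model:
  assumes x: "Re x > Im x" and q: "8 * pi * (norm (x - \<eta>) + norm (x - \<eta>) ^ 3) \<le> norm \<eta>"
  shows "norm (phase x) \<le> 2 * norm (model x)"
proof (cases "norm (phase x) \<le> norm (model x)")
  case False
  let ?q = "4 * pi * (norm (x - \<eta>) + norm (x - \<eta>) ^ 3) / norm \<eta>"
  have "?q \<le> 1/2" using q eta_nz by (simp add: field_simps)
  then have "?q * norm (phase x) \<le> 1/2 * norm (phase x)" by (intro mult_right_mono) auto
  moreover have "norm (phase x - model x) \<le> ?q * norm (phase x)"
    using norm_phase_minus_model_le[OF x] False by (simp add: max_def)
  moreover have "norm (phase x) - norm (model x) \<le> norm (phase x - model x)"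
    by (rule norm_triangle_ineq2)
  ultimately show ?thesis by linarith
next
  case True
  then show ?thesis using norm_ge_zero[of "model x"] by linarith
qed

section \<open>Terms of the sum: estimates on the real axis\<close>

lemma norm_model: "norm (model x) = norm (phase \<eta>) * exp (- 4 * pi * (Re x - Re \<eta>) * (Im x - Im \<eta>))"
  by (simp add: model_def norm_mult norm_exp_eq_Re power2_eq_square algebra_simps)

lemma norm_phase_real:
  assumes "0 < n"
  shows "norm (phase (of_real n)) = n powr (- Re s)"
  using assms by (simp add: phase_def norm_mult norm_powr_real_powr norm_exp_eq_Re power2_eq_square)

text \<open>
  On the real axis the modulus of \<open>phase\<close> is a pure power, so that comparing with the point \<open>Re \<eta>\<close>
  covers the integers far from the saddle as well.
\<close>

lemma norm_phase_real_le:
  assumes n: "0 < n" "n \<le> Re \<eta>"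
  shows "norm (phase (of_real n)) \<le> 6 * norm (phase \<eta>) * exp (- 4 * pi * Im \<eta> * (Re \<eta> - n))"
proof -
  define p where "p = Re \<eta>"
  define b where "b = Im \<eta>"
  have p: "p > 0" using Re_ge by (simp add: p_def)
  \<comment> \<open>The reference point \<open>Re \<eta>\<close> is real, lies at distance
    \<open>Im \<eta>\<close> from the saddle, and there \<open>model\<close> has the modulus of
    \<open>phase \<eta>\<close>.\<close>
  have "norm (phase (of_real p)) \<le> 2 * norm (model (of_real p))"
  proof (rule norm_phase_le_2_model)
    show "Re (complex_of_real p) > Im (complex_of_real p)" using p by simp
    have "complex_of_real p - \<eta> = - \<i> * of_real b" by (simp add: p_def b_def complex_eq_iff)
    then have "norm (of_real p - \<eta>) = b" using Im_pos by (simp add: norm_mult b_def)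
    moreover have "8 * pi * (b + b ^ 3) \<le> 100 * (b + b ^ 3)"
      using Im_pos pi_less_4 by (intro mult_right_mono) (auto simp: b_def)
    ultimately show "8 * pi * (norm (of_real p - \<eta>) + norm (of_real p - \<eta>) ^ 3) \<le> norm \<eta>"
      using Im_small norm_eta_ge by (simp add: b_def)
  qed
  also have "norm (model (of_real p)) = norm (phase \<eta>)" by (simp add: norm_model p_def)
  finally have pp: "p powr (- Re s) \<le> 2 * norm (phase \<eta>)" using p by (simp add: norm_phase_real)
  have Res: "- Re s \<ge> 0" using prod_ge by (simp add: Re_s)
  \<comment> \<open>\<open>ln x \<le> x - 1\<close> turns the power into the desired exponential
    because \<open>- Re s = 4 * pi * p * b - 1\<close>; the final -1 costs at most
    \<open>exp 1 \<le> 3\<close>. With the factor 2 for the reference point this gives the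
    6.\<close>
  have "(n / p) powr (- Re s) = exp (- Re s * ln (n / p))" using n p by (simp add: powr_def)
  also have "\<dots> \<le> exp (- Re s * (n / p - 1))"
    using Res n p by (intro iffD2[OF exp_le_cancel_iff] mult_left_mono ln_le_minus_one) auto
  also have "- Re s * (n / p - 1) = (1 - n / p) - 4 * pi * b * (p - n)"
    using p by (simp add: Re_s p_def b_def field_simps)
  also have "exp \<dots> \<le> exp (1 - 4 * pi * b * (p - n))" using n p by simp
  also have "\<dots> = exp 1 * exp (- (4 * pi * b * (p - n)))" by (simp only: diff_conv_add_uminus exp_add)
  also have "\<dots> \<le> 3 * exp (- (4 * pi * b * (p - n)))" using exp_le by (intro mult_right_mono) auto
  finally have np: "(n / p) powr (- Re s) \<le> 3 * exp (- (4 * pi * b * (p - n)))" .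
  have "n powr (- Re s) = (n / p) powr (- Re s) * p powr (- Re s)"
    using n p by (simp add: powr_divide)
  also have "\<dots> \<le> 3 * exp (- (4 * pi * b * (p - n))) * (2 * norm (phase \<eta>))"
    by (intro mult_mono np pp) auto
  finally have "n powr (- Re s) \<le> 3 * exp (- (4 * pi * b * (p - n))) * (2 * norm (phase \<eta>))" .
  then show ?thesis using n by (simp add: norm_phase_real p_def b_def mult_ac)
qed

text \<open>Staying \<open>Im \<eta>\<close> to the left of \<open>Re \<eta>\<close> makes the
  complex distance to the saddle at most \<open>2 * k\<close>, which leaves a bound in the real
  distance \<open>k\<close> only. The constant is 4 * 8 * 6.\<close>

lemma norm_phase_minus_model_real_le:
  assumes n: "0 < n" "n \<le> Re \<eta> - Im \<eta>"
  defines "k \<equiv> Re \<eta> - n"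
  shows "norm (phase (of_real n) - model (of_real n))
     \<le> 192 * pi * norm (phase \<eta>) / norm \<eta> * ((k + k ^ 3) * exp (- 4 * pi * Im \<eta> * k))"
proof -
  define v where "v = norm (of_real n - \<eta>)"
  have k: "k \<ge> Im \<eta>" "k > 0" using n Im_pos by (auto simp: k_def)
  have "v \<le> \<bar>Re (of_real n - \<eta>)\<bar> + \<bar>Im (of_real n - \<eta>)\<bar>" unfolding v_def by (rule cmod_le)
  then have v: "v \<le> 2 * k" using k Im_pos by (simp add: k_def)
  have v0: "v \<ge> 0" by (simp add: v_def)
  have "v + v ^ 3 \<le> 2 * k + (2 * k) ^ 3" using v v0 by (intro add_mono power_mono) auto
  also have "\<dots> \<le> 8 * (k + k ^ 3)" using k by (simp add: power3_eq_cube)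
  finally have vv: "v + v ^ 3 \<le> 8 * (k + k ^ 3)" .
  define e where "e = 6 * norm (phase \<eta>) * exp (- 4 * pi * Im \<eta> * k)"
  have e1: "norm (phase (of_real n)) \<le> e"
    using norm_phase_real_le[of n] n Im_pos by (simp add: e_def k_def)
  have e2: "norm (model (of_real n)) \<le> e"
  proof -
    have "norm (model (of_real n)) = 1 * (norm (phase \<eta>) * exp (- 4 * pi * Im \<eta> * k))"
      by (simp add: norm_model k_def algebra_simps)
    also have "\<dots> \<le> 6 * (norm (phase \<eta>) * exp (- 4 * pi * Im \<eta> * k))"
      by (intro mult_right_mono) auto
    finally show ?thesis by (simp add: e_def)
  qed
  have "norm (phase (of_real n) - model (of_real n))
      \<le> 4 * pi * (v + v ^ 3) / norm \<eta> * max (norm (phase (of_real n))) (norm (model (of_real n)))"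
    unfolding v_def by (rule norm_phase_minus_model_le) (use n in simp)
  also have "\<dots> \<le> 4 * pi * (8 * (k + k ^ 3)) / norm \<eta> * e"
    using vv v0 k e1 e2 by (intro mult_mono divide_right_mono mult_left_mono) (auto simp: le_max_iff_disj)
  also have "\<dots> = 192 * pi * norm (phase \<eta>) / norm \<eta> * ((k + k ^ 3) * exp (- 4 * pi * Im \<eta> * k))"
    by (simp add: e_def algebra_simps add_divide_distrib)
  finally show ?thesis .
qed

text \<open>The Mordell series runs on to the nonpositive integers, where the finite sum has no term
  to compare with. There \<open>k \<ge> Re \<eta>\<close>, so
  \<open>(k + k ^ 3) / norm \<eta>\<close> is bounded below, and these terms fit under the same
  majorant as the others.\<close>

lemma norm_model_nonpos_le:
  assumes n: "n \<le> 0"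
  defines "k \<equiv> Re \<eta> - n"
  shows "norm (model (of_real n))
     \<le> 192 * pi * norm (phase \<eta>) / norm \<eta> * ((k + k ^ 3) * exp (- 4 * pi * Im \<eta> * k))"
proof -
  have ne: "norm \<eta> > 0" using eta_nz by simp
  have k: "k \<ge> Re \<eta>" "k > 0" using n Re_ge by (auto simp: k_def)
  have kk: "norm \<eta> \<le> 192 * pi * (k + k ^ 3)"
  proof -
    have "norm \<eta> \<le> 2 * k" using norm_eta_le k by linarith
    also have "\<dots> \<le> 192 * pi * k" using pi_gt3 k by (intro mult_right_mono) auto
    also have "\<dots> \<le> 192 * pi * (k + k ^ 3)" using k by (intro mult_left_mono) auto
    finally show ?thesis .
  qed
  define e where "e = norm (phase \<eta>) * exp (- 4 * pi * Im \<eta> * k)"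
  have "norm (model (of_real n)) = 1 * e"
    by (simp add: norm_model k_def e_def algebra_simps)
  also have "\<dots> \<le> (192 * pi * (k + k ^ 3) / norm \<eta>) * e"
    using kk ne by (intro mult_right_mono) (auto simp: e_def)
  finally show ?thesis by (simp add: e_def field_simps)
qed

end

section \<open>Absorbing polynomial factors into exponentials\<close>

lemma cube_le_exp:
  fixes x :: real
  assumes "x \<ge> 0"
  shows "x ^ 3 \<le> 27 * exp x"
proof -
  have "(x / 3) ^ 3 \<le> exp (x / 3) ^ 3"
  proof (intro power_mono)
    show "x / 3 \<le> exp (x / 3)" using exp_ge_add_one_self[of "x/3"] by linarith
  qed (use assms in simp)
  also have "exp (x / 3) ^ 3 = exp x" by (simp flip: exp_of_nat_mult)
  finally show ?thesis by (simp add: power_divide)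
qed

text \<open>The decay is divided into four parts \<open>x = pi * b * k\<close>. One absorbs the
  polynomial at the price of powers of \<open>1 / b\<close>, one yields the geometric decay in
  \<open>j\<close>, and two are reserved for the factor \<open>exp (- pi * b)\<close> of the main
  term.\<close>

lemma cubic_exp_bound:
  fixes b k j :: real
  assumes b: "b > 0" and k: "k \<ge> b" "k \<ge> j"
  shows "(k + k ^ 3) * exp (- 4 * pi * b * k) \<le> 2 * exp (- pi * b) * ((1/b + 1/b^3) * exp (- pi * b * j))"
proof -
  define x where "x = pi * b * k"
  have k0: "k > 0" using b k by linarith
  have x0: "x > 0" using b k0 by (simp add: x_def)
  have xb: "3 * b * k \<le> x" unfolding x_def using pi_gt3 b k0 by (intro mult_right_mono) auto
  have e3: "x ^ 3 \<le> 27 * exp x" using x0 by (intro cube_le_exp) simp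
  have e1: "x \<le> exp x" using exp_ge_add_one_self[of x] by linarith
  have "k \<le> exp x / b"
  proof -
    have "0 < b * k" using b k0 by simp
    then have "k * b \<le> exp x" using e1 xb by (simp only: mult.commute mult.left_commute)
    then show ?thesis using b by (simp add: pos_le_divide_eq)
  qed
  moreover have "k ^ 3 \<le> exp x / b ^ 3"
  proof -
    have "(3 * b * k) ^ 3 \<le> x ^ 3" using xb b k0 by (intro power_mono) auto
    then have "27 * (b ^ 3 * k ^ 3) \<le> 27 * exp x" using e3 by (simp add: power_mult_distrib)
    then have "b ^ 3 * k ^ 3 \<le> exp x" using exp_gt_zero[of x] by linarith
    then show ?thesis using b by (simp add: field_simps)
  qed
  ultimately have A: "k + k ^ 3 \<le> (1/b + 1/b^3) * exp x" by (simp add: field_simps)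
  have "exp (- 4 * pi * b * k) = exp (- x) * (exp (- x) * exp (- 2 * x))"
    by (simp add: x_def flip: exp_add)
  also have "\<dots> \<le> exp (- x) * (exp (- pi * b * j) * (2 * exp (- pi * b)))"
  proof (intro mult_left_mono mult_mono)
    show "exp (- x) \<le> exp (- pi * b * j)" using b k by (simp add: x_def)
    have "2 * x \<ge> 2 * pi * b\<^sup>2" using b k by (simp add: x_def power2_eq_square)
    \<comment> \<open>Only \<open>k \<ge> b\<close> is available here, and \<open>b\<^sup>2\<close>
      falls below \<open>b\<close> for small \<open>b\<close>. Completing the square bridges the gap
      with a loss of \<open>pi / 8\<close>, which is less than \<open>ln 2\<close>; hence the factor
      2.\<close>
    moreover have "2 * pi * b\<^sup>2 \<ge> pi * b - pi / 8"
    proof -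
      have "2 * pi * (b - 1/4)\<^sup>2 \<ge> 0" by simp
      then show ?thesis by (simp add: power2_eq_square algebra_simps)
    qed
    ultimately have "- 2 * x \<le> ln 2 + - pi * b"
      using ln2_ge_two_thirds pi_less_4 by linarith
    then have "exp (- 2 * x) \<le> exp (ln 2 + - pi * b)" by simp
    then show "exp (- 2 * x) \<le> 2 * exp (- pi * b)" by (simp only: exp_add) simp
  qed auto
  finally have B: "exp (- 4 * pi * b * k) \<le> exp (- x) * (exp (- pi * b * j) * (2 * exp (- pi * b)))" .
  have "(k + k ^ 3) * exp (- 4 * pi * b * k) \<le> ((1/b + 1/b^3) * exp x) * (exp (- x) * (exp (- pi * b * j) * (2 * exp (- pi * b))))"
    using A B k0 b by (intro mult_mono) auto
  also have "\<dots> = 2 * exp (- pi * b) * ((1/b + 1/b^3) * exp (- pi * b * j)) * (exp x * exp (- x))"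
    by (simp only: mult_ac)
  finally show ?thesis by (simp add: exp_minus)
qed

section \<open>Estimates on the line passing close to the saddle\<close>

context saddle begin

text \<open>The crossing point is at least 98/100 of \<open>Re \<eta>\<close>, which controls the
  distance of the line from 0. For a real saddle on the line the infimum of
  \<open>Re (\<eta> / x)\<close> is \<open>(1 - sqrt 2) / 2\<close>, so the value -1/2 leaves room
  for \<open>Im \<eta>\<close> and \<open>w\<close>.\<close>

lemma phase_slanted_line_bound:
  fixes w r :: real
  assumes w: "\<bar>w\<bar> \<le> 1/2"
  defines "x \<equiv> \<eta> + of_real w + of_real r * cis (pi/4)"
  shows "Re x > Im x"
    and "Re x - Im x = Re \<eta> - Im \<eta> + w"
    and "norm \<eta> \<le> 2 * norm x"
    and "Re (\<eta> / x) \<ge> - 1/2"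
    and "norm x \<ge> 1/2"
proof -
  define p where "p = Re \<eta>"
  define b where "b = Im \<eta>"
  have pb: "p \<ge> 100" "b > 0" "100 * b \<le> p" using Re_ge Im_pos Im_le by (auto simp: p_def b_def)
  show c: "Re x - Im x = Re \<eta> - Im \<eta> + w"
    by (simp add: x_def cos_45 sin_45)
  define c where "c = p - b + w"
  have cx: "Re x - Im x = c" using c by (simp add: c_def p_def b_def)
  have c98: "c \<ge> 98/100 * p" "c \<le> p + 1/2" using pb w by (auto simp: c_def)
  then show gt: "Re x > Im x" using cx pb by linarith
  have n2: "c\<^sup>2 \<le> 2 * (norm x)\<^sup>2"
  proof -
    have "c\<^sup>2 + (Re x + Im x)\<^sup>2 = 2 * ((Re x)\<^sup>2 + (Im x)\<^sup>2)"
      by (simp add: cx[symmetric] power2_eq_square algebra_simps)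
    then show ?thesis unfolding cmod_power2 using zero_le_power2[of "Re x + Im x"] by linarith
  qed
  have c32: "c \<le> 3/2 * norm x"
  proof (rule power2_le_imp_le)
    show "c\<^sup>2 \<le> (3/2 * norm x)\<^sup>2" 
    proof -
      have "(3/2 * norm x)\<^sup>2 = 9/4 * (norm x)\<^sup>2" by (simp add: power_mult_distrib power2_eq_square)
      then show ?thesis using n2 zero_le_power2[of "norm x"] by linarith
    qed
  qed simp
  show "norm \<eta> \<le> 2 * norm x" using c32 c98 norm_eta_le pb by (simp add: p_def)
  show "norm x \<ge> 1/2" using c32 c98 pb by linarith
  have x0: "x \<noteq> 0" using gt by auto
  define a where "a = Re x"
  have ax: "Im x = a - c" using cx by (simp add: a_def)
  define e where "e = 2 * b - w"
  have e: "\<bar>e\<bar> \<le> c / 20" "b \<le> c / 20" 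
    using pb w c98 unfolding e_def abs_le_iff by linarith+
  have pe: "p + b - c = e" by (simp add: c_def e_def)
  \<comment> \<open>The claim on \<open>Re (\<eta> / x)\<close>, cleared of its denominator, is a
    quadratic inequality in \<open>a = Re x\<close>. Its linear coefficient is
    \<open>p + b - c = e\<close>, small because the line nearly passes through the saddle.\<close>
  have "0 \<le> (a + e / 2)\<^sup>2 + (c\<^sup>2 / 2 - b * c - e\<^sup>2 / 4)"
  proof -
    have c0: "c \<ge> 0" using c98 pb by linarith
    have "e\<^sup>2 \<le> (c / 20)\<^sup>2" using power_mono[OF e(1), of 2] by simp
    moreover have "b * c \<le> c / 20 * c" using e(2) c0 by (intro mult_right_mono) auto
    moreover have "c\<^sup>2 \<ge> 0" by simp
    moreover have "(c / 20)\<^sup>2 = c\<^sup>2 / 400" "c / 20 * c = c\<^sup>2 / 20" by (simp_all add: power2_eq_square)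
    ultimately have "c\<^sup>2 / 2 - b * c - e\<^sup>2 / 4 \<ge> 0" by linarith
    then show ?thesis using zero_le_power2[of "a + e/2"] by linarith
  qed
  also have "\<dots> = (a\<^sup>2 + (a - c)\<^sup>2) / 2 + p * a + b * (a - c)"
    by (simp add: pe[symmetric] power2_eq_square field_simps)
  finally have key: "- 1/2 * ((Re x)\<^sup>2 + (Im x)\<^sup>2) \<le> Re \<eta> * Re x + Im \<eta> * Im x"
    by (simp add: ax a_def[symmetric] p_def b_def)
  have pos: "(Re x)\<^sup>2 + (Im x)\<^sup>2 > 0"
    using x0 by (simp add: complex_neq_0)
  show "Re (\<eta> / x) \<ge> - 1/2"
    unfolding Re_divide using key pos by (simp add: pos_le_divide_eq)
qed

text \<open>
  With \<open>v = x - \<eta>\<close>, the logarithmic derivative of \<open>x * phase x\<close> is \<open>2 * pi * \<i> * v * (1 + \<eta> / x)\<close>;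
  the lower bound on \<open>Re (\<eta> / x)\<close> makes it push towards the saddle on the whole line.
\<close>

lemma norm_phase_slanted_line_le:
  fixes w r :: real
  assumes w: "\<bar>w\<bar> \<le> 1/2"
  defines "x \<equiv> \<eta> + of_real w + of_real r * cis (pi/4)"
  shows "norm (phase x) \<le> 6 * norm (phase \<eta>) * exp (3 * pi * \<bar>r\<bar> - pi * r\<^sup>2 / 2)"
proof -
  define X where "X r = \<eta> + of_real w + of_real r * cis (pi/4)" for r
  define \<Lambda> where "\<Lambda> z = (1 - s) * Ln z + of_real pi * \<i> * z\<^sup>2" for z
  have sl: "Re (X r) > Im (X r)" "norm \<eta> \<le> 2 * norm (X r)" "Re (\<eta> / X r) \<ge> - 1/2" "norm (X r) \<ge> 1/2" for r
    using phase_slanted_line_bound[OF w, of r] by (auto simp: X_def)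
  have X0: "X r \<noteq> 0" for r using sl(1)[of r] by auto
  have np: "X r \<notin> \<real>\<^sub>\<le>\<^sub>0" for r using sl(1)[of r] by (auto simp: complex_nonpos_Reals_iff)
  have cis2: "cis (pi/4) * cis (pi/4) = \<i>" by (simp add: cis_mult)
  define D where "D r = Re (2 * of_real pi * \<i> * cis (pi/4) * (of_real w + of_real r * cis (pi/4)) * (1 + \<eta> / X r))" for r
  have deriv: "((\<lambda>r. Re (\<Lambda> (X r))) has_field_derivative D r) (at r)" for r
  proof -
    have "(X has_vector_derivative cis (pi/4)) (at r)"
      unfolding X_def by (auto intro!: derivative_eq_intros has_vector_derivative_real_field)
    moreover have "(\<Lambda> has_field_derivative ((1 - s) / X r + 2 * of_real pi * \<i> * X r)) (at (X r))"
      unfolding \<Lambda>_def using np[of r] by (auto intro!: derivative_eq_intros simp: divide_inverse mult.commute)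
    ultimately have "((\<Lambda> \<circ> X) has_vector_derivative cis (pi/4) * ((1 - s) / X r + 2 * of_real pi * \<i> * X r)) (at r)"
      by (rule field_vector_diff_chain_at)
    moreover have "cis (pi/4) * ((1 - s) / X r + 2 * of_real pi * \<i> * X r)
        = 2 * of_real pi * \<i> * cis (pi/4) * (of_real w + of_real r * cis (pi/4)) * (1 + \<eta> / X r)"
    proof -
      have v: "of_real w + of_real r * cis (pi/4) = X r - \<eta>" by (simp add: X_def)
      show ?thesis unfolding v s_def using X0[of r] by (simp add: field_simps power2_eq_square)
    qed
    ultimately have "((\<lambda>r. Re ((\<Lambda> \<circ> X) r)) has_vector_derivative D r) (at r)"
      unfolding D_def using bounded_linear.has_vector_derivative[OF bounded_linear_Re] by metis
    then show ?thesis by (simp add: o_def has_real_derivative_iff_has_vector_derivative)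
  qed
  \<comment> \<open>Along the steepest direction \<open>\<i> * (cis (pi/4))\<^sup>2 = -1\<close>, so
    the part with \<open>r\<close> is a restoring force of strength at least
    \<open>pi * \<bar>r\<bar>\<close>. The offset \<open>w\<close> only adds a term bounded by
    \<open>3 * pi\<close>; integration from 0 gives the exponent of the claim.\<close>
  have D: "D r = w * Re (2 * of_real pi * \<i> * cis (pi/4) * (1 + \<eta> / X r)) - 2 * pi * r * (1 + Re (\<eta> / X r))" for r
  proof -
    have "2 * of_real pi * \<i> * cis (pi/4) * (of_real w + of_real r * cis (pi/4)) * (1 + \<eta> / X r)
      = of_real w * (2 * of_real pi * \<i> * cis (pi/4) * (1 + \<eta> / X r))
        + of_real (2 * pi * r) * (\<i> * (cis (pi/4) * cis (pi/4))) * (1 + \<eta> / X r)"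
      by (simp add: algebra_simps)
    also have "\<i> * (cis (pi/4) * cis (pi/4)) = -1" unfolding cis2 by simp
    finally show ?thesis unfolding D_def by simp
  qed
  have wb: "\<bar>w * Re (2 * of_real pi * \<i> * cis (pi/4) * (1 + \<eta> / X r))\<bar> \<le> 3 * pi" for r
  proof -
    have "norm (\<eta> / X r) \<le> 2" using sl(2)[of r] X0[of r] by (simp add: norm_divide divide_le_eq)
    then have "norm (1 + \<eta> / X r) \<le> 3" using norm_triangle_ineq[of 1 "\<eta> / X r"] by simp
    moreover define Z where "Z = 2 * of_real pi * \<i> * cis (pi/4) * (1 + \<eta> / X r)"
    ultimately have "norm Z \<le> 2 * pi * 3" by (simp add: norm_mult)
    then have "\<bar>Re Z\<bar> \<le> 2 * pi * 3" using abs_Re_le_cmod order_trans by blast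
    then have "\<bar>w\<bar> * \<bar>Re Z\<bar> \<le> 1/2 * (2 * pi * 3)"
      using w by (intro mult_mono) auto
    then show ?thesis by (simp add: abs_mult Z_def[symmetric])
  qed
  have main: "Re (\<Lambda> (X r)) \<le> Re (\<Lambda> (X 0)) + (3 * pi * \<bar>r\<bar> - pi * r\<^sup>2 / 2)"
  proof (cases "r \<ge> 0")
    case True
    have "Re (\<Lambda> (X r)) - 3 * pi * r + pi * r\<^sup>2 / 2 \<le> Re (\<Lambda> (X 0)) - 3 * pi * 0 + pi * 0\<^sup>2 / 2"
    proof (rule DERIV_nonpos_imp_nonincreasing[OF True])
      fix q assume q: "0 \<le> q" "q \<le> r"
      have "((\<lambda>r. Re (\<Lambda> (X r)) - 3 * pi * r + pi * r\<^sup>2 / 2) has_real_derivative D q - 3 * pi + pi * q) (at q)"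
        by (rule derivative_eq_intros deriv refl | simp)+
      moreover have "q * (1/2) \<le> q * (1 + Re (\<eta> / X q))" using q sl(3)[of q] by (intro mult_left_mono) auto
      then have "pi * q \<le> 2 * pi * q * (1 + Re (\<eta> / X q))" using mult_left_mono[of _ _ "2 * pi"] by fastforce
      then have "D q - 3 * pi + pi * q \<le> 0" unfolding D using wb[of q] by linarith
      ultimately show "\<exists>y. ((\<lambda>r. Re (\<Lambda> (X r)) - 3 * pi * r + pi * r\<^sup>2 / 2) has_real_derivative y) (at q) \<and> y \<le> 0"
        by blast
    qed
    then show ?thesis using True by simp
  next
    case False
    then have r: "r \<le> 0" by simp
    have "Re (\<Lambda> (X r)) + 3 * pi * r + pi * r\<^sup>2 / 2 \<le> Re (\<Lambda> (X 0)) + 3 * pi * 0 + pi * 0\<^sup>2 / 2"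
    proof (rule DERIV_nonneg_imp_nondecreasing[OF r])
      fix q assume q: "r \<le> q" "q \<le> 0"
      have "((\<lambda>r. Re (\<Lambda> (X r)) + 3 * pi * r + pi * r\<^sup>2 / 2) has_real_derivative D q + 3 * pi + pi * q) (at q)"
        by (rule derivative_eq_intros deriv refl | simp)+
      moreover have "q * (1 + Re (\<eta> / X q)) \<le> q * (1/2)" using q sl(3)[of q] by (intro mult_left_mono_neg) auto
      then have "2 * pi * q * (1 + Re (\<eta> / X q)) \<le> pi * q" using mult_left_mono[of _ _ "2 * pi"] by fastforce
      then have "D q + 3 * pi + pi * q \<ge> 0" unfolding D using wb[of q] by linarith
      ultimately show "\<exists>y. ((\<lambda>r. Re (\<Lambda> (X r)) + 3 * pi * r + pi * r\<^sup>2 / 2) has_real_derivative y) (at q) \<and> 0 \<le> y"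
        by blast
    qed
    then show ?thesis using r by simp
  qed
  have ph: "norm (phase (X r)) * norm (X r) = exp (Re (\<Lambda> (X r)))" for r
  proof -
    have "phase (X r) * X r = exp (- s * Ln (X r) + of_real pi * \<i> * (X r)\<^sup>2) * exp (Ln (X r))"
      using X0[of r] by (simp add: phase_eq_exp)
    also have "\<dots> = exp (\<Lambda> (X r))" by (simp add: \<Lambda>_def algebra_simps flip: exp_add)
    finally show ?thesis by (metis norm_mult norm_exp_eq_Re)
  qed
  have ph0: "norm (phase (X 0)) \<le> 2 * norm (phase \<eta>)"
  proof -
    have v: "norm (X 0 - \<eta>) = \<bar>w\<bar>" by (simp add: X_def)
    have "\<bar>w\<bar> ^ 3 \<le> (1/2) ^ 3" using w by (intro power_mono) auto
    then have "\<bar>w\<bar> + \<bar>w\<bar> ^ 3 \<le> 1" using w by (simp add: power3_eq_cube)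
    then have "8 * pi * (\<bar>w\<bar> + \<bar>w\<bar> ^ 3) \<le> 8 * pi" by simp
    also have "\<dots> \<le> norm \<eta>" using norm_eta_ge Re_ge pi_less_4 by linarith
    finally have "norm (phase (X 0)) \<le> 2 * norm (model (X 0))"
      by (intro norm_phase_le_2_model sl) (simp add: v)
    also have "norm (model (X 0)) = norm (phase \<eta>)" by (simp add: norm_model X_def)
    finally show ?thesis .
  qed
  \<comment> \<open>The monotonicity argument concerned \<open>x * phase x\<close>; this comparison
    removes the extra factor and accounts for 6 = 2 * 3.\<close>
  have "norm (X 0) \<le> 3 * norm (X r)"
  proof -
    have "norm (X 0) \<le> norm \<eta> + \<bar>w\<bar>" unfolding X_def using norm_triangle_ineq[of \<eta> "of_real w"] by simp
    then show ?thesis using w sl(2)[of r] sl(4)[of r] by linarith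
  qed
  then have "norm (phase (X 0)) * norm (X 0) \<le> (2 * norm (phase \<eta>)) * (3 * norm (X r))"
    using ph0 by (intro mult_mono) auto
  then have "exp (Re (\<Lambda> (X 0))) \<le> 6 * norm (phase \<eta>) * norm (X r)" unfolding ph by simp
  moreover have "norm (phase (X r)) * norm (X r) \<le> exp (Re (\<Lambda> (X 0))) * exp (3 * pi * \<bar>r\<bar> - pi * r\<^sup>2 / 2)"
    unfolding ph using main by (simp flip: exp_add)
  ultimately have "norm (phase (X r)) * norm (X r) \<le> (6 * norm (phase \<eta>) * norm (X r)) * exp (3 * pi * \<bar>r\<bar> - pi * r\<^sup>2 / 2)"
    by (meson exp_ge_zero mult_right_mono order_trans)
  then have "norm (phase (X r)) * norm (X r) \<le> (6 * norm (phase \<eta>) * exp (3 * pi * \<bar>r\<bar> - pi * r\<^sup>2 / 2)) * norm (X r)"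
    by (simp only: mult_ac)
  then have "norm (phase (X r)) \<le> 6 * norm (phase \<eta>) * exp (3 * pi * \<bar>r\<bar> - pi * r\<^sup>2 / 2)"
    using X0[of r] by (simp only: mult_le_cancel_right) auto
  then show ?thesis by (simp add: X_def x_def)
qed

lemma norm_model_slanted_line_le:
  fixes w r :: real
  assumes w: "\<bar>w\<bar> \<le> 1/2"
  defines "x \<equiv> \<eta> + of_real w + of_real r * cis (pi/4)"
  shows "norm (model x) \<le> norm (phase \<eta>) * exp (3 * pi * \<bar>r\<bar> - pi * r\<^sup>2 / 2)"
proof -
  have "(w + r * (sqrt 2 / 2)) * (r * (sqrt 2 / 2)) = w * r * (sqrt 2 / 2) + r\<^sup>2 / 2"
    by (simp add: algebra_simps power2_eq_square)
  then have "- 4 * pi * (Re x - Re \<eta>) * (Im x - Im \<eta>) = - 4 * pi * (w * r * (sqrt 2 / 2)) - 2 * pi * r\<^sup>2"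
    by (simp add: x_def cos_45 sin_45 algebra_simps)
  also have "\<dots> \<le> 3 * pi * \<bar>r\<bar> - pi * r\<^sup>2 / 2"
  proof -
    have "\<bar>w * r\<bar> \<le> 1/2 * \<bar>r\<bar>" unfolding abs_mult using w by (intro mult_right_mono) auto
    moreover have "sqrt 2 / 2 \<le> (1::real)" using real_sqrt_le_mono[of 2 4] by simp
    ultimately have "\<bar>w * r\<bar> * (sqrt 2 / 2) \<le> (1/2 * \<bar>r\<bar>) * 1" by (intro mult_mono) auto
    then have "- (w * r * (sqrt 2 / 2)) \<le> 1/2 * \<bar>r\<bar>"
      using abs_ge_minus_self[of "w * r * (sqrt 2 / 2)"] by (simp add: abs_mult)
    then have "pi * (- (w * r * (sqrt 2 / 2))) \<le> pi * (1/2 * \<bar>r\<bar>)"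
      by (intro mult_left_mono) auto
    then have "- (pi * (w * r * (sqrt 2 / 2))) \<le> 1/2 * (pi * \<bar>r\<bar>)" by simp
    moreover have "pi * \<bar>r\<bar> \<ge> 0" "pi * r\<^sup>2 \<ge> 0" by auto
    moreover have "- 4 * A - 2 * C \<le> 3 * B - C / 2"
      if "- A \<le> 1/2 * B" "B \<ge> 0" "C \<ge> 0" for A B C :: real using that by linarith
    ultimately show ?thesis by (simp only: mult.assoc)
  qed
  finally show ?thesis unfolding norm_model by (intro mult_left_mono) auto
qed

text \<open>The weight \<open>exp (- pi * \<bar>Im x\<bar>)\<close> is the decay of the reciprocal
  kernel. The heights of \<open>x\<close> and \<eta> differ by at most \<open>\<bar>r\<bar>\<close>,
  so the weight can be exchanged for \<open>exp (- pi * Im \<eta>)\<close>, and the cost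
  \<open>exp (pi * \<bar>r\<bar>)\<close> is paid by the Gaussian. The constant is 4 * 28 *
  6.\<close>

lemma norm_phase_minus_model_slanted_line_le:
  fixes w r :: real
  assumes w: "\<bar>w\<bar> \<le> 1/2"
  defines "x \<equiv> \<eta> + of_real w + of_real r * cis (pi/4)"
  shows "norm (phase x - model x) * exp (- pi * \<bar>Im x\<bar>)
     \<le> 672 * pi * exp 145 * norm (phase \<eta>) / norm \<eta> * exp (- pi * Im \<eta>) * exp (- r\<^sup>2)"
proof -
  define v where "v = norm (x - \<eta>)"
  have v0: "v \<ge> 0" by (simp add: v_def)
  have "v \<le> \<bar>w\<bar> + \<bar>r\<bar>"
    unfolding v_def x_def using norm_triangle_ineq[of "of_real w" "of_real r * cis (pi/4)"]
    by (simp add: norm_mult)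
  then have v: "v \<le> 1/2 + \<bar>r\<bar>" using w by linarith
  define y where "y = 1/2 + \<bar>r\<bar>"
  have y0: "y \<ge> 0" by (simp add: y_def)
  have vv: "v + v ^ 3 \<le> 28 * exp y"
  proof -
    have "v + v ^ 3 \<le> y + y ^ 3" using v v0 by (intro add_mono power_mono) (auto simp: y_def)
    moreover have "y \<le> exp y" using exp_ge_add_one_self[of y] by linarith
    moreover have "y ^ 3 \<le> 27 * exp y" using y0 by (rule cube_le_exp)
    ultimately show ?thesis by linarith
  qed
  define E where "E = exp (3 * pi * \<bar>r\<bar> - pi * r\<^sup>2 / 2)"
  have M: "max (norm (phase x)) (norm (model x)) \<le> 6 * norm (phase \<eta>) * E"
  proof -
    have "norm (model x) \<le> 1 * (norm (phase \<eta>) * E)"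
      using norm_model_slanted_line_le[OF w, of r] by (simp add: x_def E_def)
    also have "\<dots> \<le> 6 * (norm (phase \<eta>) * E)" by (intro mult_right_mono) (auto simp: E_def)
    finally show ?thesis using norm_phase_slanted_line_le[OF w, of r] by (simp add: x_def E_def)
  qed
  have I: "exp (- pi * \<bar>Im x\<bar>) \<le> exp (- pi * Im \<eta>) * exp (pi * \<bar>r\<bar>)"
  proof -
    have "sqrt 2 / 2 \<le> (1::real)" using real_sqrt_le_mono[of 2 4] by simp
    then have "\<bar>r\<bar> * (sqrt 2 / 2) \<le> \<bar>r\<bar> * 1" by (intro mult_left_mono) auto
    then have "- (r * (sqrt 2 / 2)) \<le> \<bar>r\<bar>" using abs_ge_minus_self[of "r * (sqrt 2 / 2)"] by (simp add: abs_mult)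
    moreover have "Im x = Im \<eta> + r * (sqrt 2 / 2)" by (simp add: x_def sin_45)
    ultimately have "Im \<eta> - \<bar>r\<bar> \<le> \<bar>Im x\<bar>" by linarith
    then have "pi * (Im \<eta> - \<bar>r\<bar>) \<le> pi * \<bar>Im x\<bar>" by (intro mult_left_mono) auto
    then show ?thesis by (simp add: algebra_simps flip: exp_add)
  qed
  have "norm (phase x - model x) * exp (- pi * \<bar>Im x\<bar>)
      \<le> (4 * pi * (v + v ^ 3) / norm \<eta> * max (norm (phase x)) (norm (model x))) * exp (- pi * \<bar>Im x\<bar>)"
    unfolding v_def x_def by (intro mult_right_mono norm_phase_minus_model_le phase_slanted_line_bound w) auto
  also have "\<dots> \<le> (4 * pi * (28 * exp y) / norm \<eta> * (6 * norm (phase \<eta>) * E)) * (exp (- pi * Im \<eta>) * exp (pi * \<bar>r\<bar>))"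
    using v0 by (intro mult_mono M I divide_right_mono mult_left_mono vv) (auto simp: le_max_iff_disj E_def)
  also have "\<dots> = 672 * pi * norm (phase \<eta>) / norm \<eta> * exp (- pi * Im \<eta>) * (exp y * E * exp (pi * \<bar>r\<bar>))"
    by (simp add: field_simps)
  also have "\<dots> \<le> 672 * pi * norm (phase \<eta>) / norm \<eta> * exp (- pi * Im \<eta>) * (exp 145 * exp (- r\<^sup>2))"
  proof (intro mult_left_mono)
    \<comment> \<open>With \<open>3 < pi < 4\<close> the linear terms total at most
      \<open>17 * \<bar>r\<bar> + 1/2\<close>. Half of \<open>r\<^sup>2\<close> is free to absorb
      them, leaving 289/2 + 1/2 = 145.\<close>
    have "pi * \<bar>r\<bar> \<le> 4 * \<bar>r\<bar>" "3 * r\<^sup>2 \<le> pi * r\<^sup>2"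
      using pi_less_4 pi_gt3 by (auto intro!: mult_right_mono)
    moreover have "0 \<le> (\<bar>r\<bar> - 17)\<^sup>2" by simp
    then have "34 * \<bar>r\<bar> \<le> r\<^sup>2 + 289" by (simp add: power2_eq_square algebra_simps)
    ultimately have "y + (3 * pi * \<bar>r\<bar> - pi * r\<^sup>2 / 2) + pi * \<bar>r\<bar> \<le> 145 - r\<^sup>2"
      unfolding y_def by linarith
    then show "exp y * E * exp (pi * \<bar>r\<bar>) \<le> exp 145 * exp (- r\<^sup>2)"
      by (simp add: E_def flip: exp_add)
  qed auto
  finally show ?thesis by (simp add: mult_ac)
qed

end

section \<open>The main term\<close>

definition aux_numerator :: "complex \<Rightarrow> complex \<Rightarrow> complex" where
  "aux_numerator s x = x powr (- s) * exp (of_real pi * \<i> * x\<^sup>2)"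

lemma riemann_aux_eq_line_integral: "riemann_aux s = line_integral (aux_numerator s) (1/2)"
  by (simp add: riemann_aux_def line_integral_def aux_integrand_def aux_numerator_def sin_kernel_def)

lemma aux_numerator_holomorphic: "aux_numerator s holomorphic_on {x. Re x > Im x}"
  unfolding aux_numerator_def by (intro holomorphic_intros) (auto simp: complex_nonpos_Reals_iff)

text \<open>Away from 0 the logarithm grows at most linearly, so \<open>x powr (- s)\<close> is at
  most exponential in \<open>\<bar>u\<bar>\<close> and loses against the Gaussian. The constant may
  depend on \<open>s\<close> and \<open>m\<close>, because the bound only justifies moving the
  line.\<close>

lemma aux_numerator_decay:
  obtains C where "\<And>c u. real m + 1/2 \<le> c \<Longrightarrow> c \<le> real m + 3/2 \<Longrightarrow> norm (aux_numerator s (aux_line c u)) \<le> C * exp (- u\<^sup>2)"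
proof -
  define q where "q = real m + 3/2"
  have q: "q \<ge> 3/2" by (simp add: q_def)
  define S where "S = norm s"
  define b where "b = S + 2 * pi * q"
  define e where "e = S * (q + 4 + pi)"
  have "norm (aux_numerator s (aux_line c u)) \<le> exp (e + b\<^sup>2 / 4) * exp (- u\<^sup>2)"
    if c: "real m + 1/2 \<le> c" "c \<le> real m + 3/2" for c u
  proof -
    define x where "x = aux_line c u"
    define r where "r = sqrt 2 / 2"
    have r: "0 \<le> r" "r \<le> 1" "r * r = 1/2" using real_sqrt_le_mono[of 2 4] by (auto simp: r_def)
    have c12: "c \<ge> 1/2" "c \<le> q" using c by (auto simp: q_def)
    have cr: "c = Re x - Im x" by (simp add: x_def aux_line_crossing)
    have x0: "x \<noteq> 0" using cr c12 by auto
    have nx1: "norm x \<ge> 1/4"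
    proof -
      have "c \<le> norm x + norm x"
        unfolding cr using abs_Re_le_cmod[of x] abs_Im_le_cmod[of x] by linarith
      then show ?thesis using c12 by linarith
    qed
    have nx2: "norm x \<le> c + \<bar>u\<bar>"
    proof -
      have "norm x \<le> norm (complex_of_real c) + norm (of_real u * cis (pi/4))"
        unfolding x_def aux_line_def by (rule norm_triangle_ineq4)
      then show ?thesis using c12 by (simp add: norm_mult)
    qed
    have lnx: "\<bar>ln (norm x)\<bar> \<le> norm x + 4"
    proof (cases "norm x \<ge> 1")
      case True
      then show ?thesis using ln_le_minus_one[of "norm x"] x0 by simp
    next
      case False
      have "- ln (norm x) = ln (1 / norm x)" using x0 by (simp add: ln_div)
      also have "\<dots> \<le> 1 / norm x - 1" using x0 by (intro ln_le_minus_one) simp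
      also have "1 / norm x \<le> 4" using nx1 x0 by (simp add: divide_le_eq)
      finally have "- ln (norm x) \<le> 3" by simp
      moreover have "ln (norm x) \<le> 0" using False x0 by simp
      ultimately show ?thesis using norm_ge_zero[of x] by linarith
    qed
    have "norm (Ln x) \<le> \<bar>Re (Ln x)\<bar> + \<bar>Im (Ln x)\<bar>" by (rule cmod_le)
    also have "\<dots> \<le> (norm x + 4) + pi"
      using lnx x0 mpi_less_Im_Ln[of x] Im_Ln_le_pi[of x] by (intro add_mono) auto
    also have "\<dots> \<le> q + \<bar>u\<bar> + 4 + pi" using nx2 c12 by linarith
    finally have nL: "norm (Ln x) \<le> q + \<bar>u\<bar> + 4 + pi" .
    have "norm (x powr (- s)) = exp (Re (- s * Ln x))"
      using x0 by (simp add: powr_def norm_exp_eq_Re)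
    also have "Re (- s * Ln x) \<le> S * norm (Ln x)"
      using complex_Re_le_cmod[of "- s * Ln x"] by (simp add: norm_mult S_def)
    also have "S * norm (Ln x) \<le> S * (q + \<bar>u\<bar> + 4 + pi)"
      using nL by (intro mult_left_mono) (auto simp: S_def)
    finally have p1: "norm (x powr (- s)) \<le> exp (S * (q + \<bar>u\<bar> + 4 + pi))" by simp
    have "Re (of_real pi * \<i> * x\<^sup>2) = - 2 * pi * ((c - u * r) * (- u * r))"
      by (simp add: x_def Re_aux_line Im_aux_line r_def power2_eq_square)
    also have "(c - u * r) * (- u * r) = u\<^sup>2 * (r * r) - c * r * u"
      by (simp add: power2_eq_square algebra_simps)
    also have "- 2 * pi * (u\<^sup>2 * (r * r) - c * r * u) = - pi * u\<^sup>2 + 2 * pi * (c * r * u)"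
      unfolding r(3) by (simp add: algebra_simps)
    also have "\<dots> \<le> - pi * u\<^sup>2 + 2 * pi * (q * \<bar>u\<bar>)"
    proof -
      have "c * r \<le> q * 1" using c12 r by (intro mult_mono) auto
      then have "c * r * \<bar>u\<bar> \<le> q * \<bar>u\<bar>" by (intro mult_right_mono) auto
      then have "c * r * u \<le> q * \<bar>u\<bar>"
      proof -
        have "c * r * u \<le> c * r * \<bar>u\<bar>" using r c12 by (intro mult_left_mono) auto
        then show ?thesis using \<open>c * r * \<bar>u\<bar> \<le> q * \<bar>u\<bar>\<close> by (rule order_trans)
      qed
      then show ?thesis by simp
    qed
    finally have p2: "norm (exp (of_real pi * \<i> * x\<^sup>2)) \<le> exp (- pi * u\<^sup>2 + 2 * pi * (q * \<bar>u\<bar>))"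
      by (simp add: norm_exp_eq_Re)
    have "norm (aux_numerator s x) \<le> exp (S * (q + \<bar>u\<bar> + 4 + pi)) * exp (- pi * u\<^sup>2 + 2 * pi * (q * \<bar>u\<bar>))"
      unfolding aux_numerator_def norm_mult using p1 p2 by (intro mult_mono) auto
    also have "\<dots> = exp (- pi * u\<^sup>2 + b * \<bar>u\<bar> + e)"
      by (simp add: b_def e_def algebra_simps flip: exp_add)
    also have "\<dots> \<le> exp (e + b\<^sup>2 / 4) * exp (- u\<^sup>2)"
      using pi_gt3 q by (intro quadratic_decay) (auto simp: b_def S_def)
    finally show ?thesis by (simp add: x_def)
  qed
  then show ?thesis using that by blast
qed

lemma aux_numerator_integrable:
  "integrable lborel (\<lambda>u. aux_numerator s (aux_line (real m + 1/2) u) / sin_kernel (aux_line (real m + 1/2) u) * (- cis (pi / 4)))"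
proof -
  obtain C where C: "\<And>c u. real m + 1/2 \<le> c \<Longrightarrow> c \<le> real m + 3/2 \<Longrightarrow> norm (aux_numerator s (aux_line c u)) \<le> C * exp (- u\<^sup>2)"
    using aux_numerator_decay by blast
  show ?thesis
    by (rule integrable_aux_line(1)[OF holomorphic_on_imp_continuous_on[OF aux_numerator_holomorphic]]) (rule C; simp)
qed

text \<open>The residues are listed as \<open>n = N - j\<close>, counting leftwards from the line,
  to match the Mordell series term by term.\<close>

lemma riemann_aux_shift:
  "riemann_aux s = line_integral (aux_numerator s) (real N + 1/2)
     + (\<Sum>j<N. (-1) ^ (N + j) * aux_numerator s (of_nat N - of_nat j))"
proof -
  have "riemann_aux s = line_integral (aux_numerator s) (real N + 1/2)
     + (\<Sum>m<N. (-1) ^ (m + 1) * aux_numerator s (of_nat (m + 1)))"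
  proof (induction N)
    case 0
    then show ?case by (simp add: riemann_aux_eq_line_integral)
  next
    case (Suc m)
    obtain C where C: "\<And>c u. real m + 1/2 \<le> c \<Longrightarrow> c \<le> real m + 3/2 \<Longrightarrow> norm (aux_numerator s (aux_line c u)) \<le> C * exp (- u\<^sup>2)"
      using aux_numerator_decay by blast
    have e: "real (Suc m) + 1/2 = real m + 3/2" by simp
    show ?case
      using Suc.IH line_integral_shift[OF aux_numerator_holomorphic C] unfolding e by simp
  qed
  also have "(\<Sum>m<N. (-1) ^ (m + 1) * aux_numerator s (of_nat (m + 1)))
     = (\<Sum>j<N. (-1) ^ (N - Suc j + 1) * aux_numerator s (of_nat (N - Suc j + 1)))"
    by (rule sum.nat_diff_reindex[symmetric])
  also have "\<dots> = (\<Sum>j<N. (-1) ^ (N + j) * aux_numerator s (of_nat N - of_nat j))"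
  proof (rule sum.cong[OF refl])
    fix j assume "j \<in> {..<N}"
    then have j: "N - Suc j + 1 = N - j" "j \<le> N" by auto
    obtain i where i: "N = i + j" using j(2) by (metis le_add_diff_inverse2)
    have "(-1 :: complex) ^ (i + j + j) = (-1) ^ i"
      by (simp add: power_add mult.assoc flip: power_mult_distrib)
    then show "(-1) ^ (N - Suc j + 1) * aux_numerator s (of_nat (N - Suc j + 1)) = (-1) ^ (N + j) * aux_numerator s (of_nat N - of_nat j)"
      unfolding j(1) by (simp add: i)
  qed
  finally show ?thesis .
qed

text \<open>The first summand accounts for the residue sum, the second for the integral, where 1344
  = 2 * 672 includes the factor 2 from the kernel bound.\<close>

definition error_const :: real where
  "error_const = 384 * pi + 1344 * pi * exp 145 * (\<integral>u. exp (- u\<^sup>2) \<partial>lborel)"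

lemma error_const_nonneg: "error_const \<ge> 0"
  unfolding error_const_def by (intro add_nonneg_nonneg mult_nonneg_nonneg integral_nonneg_AE) auto

text \<open>The left side is \<open>b / (1 + b)\<close>: linear for small \<open>b\<close> and
  bounded for large \<open>b\<close>, so that both regimes are treated at once.\<close>

lemma one_minus_exp_ge:
  fixes x b :: real
  assumes "0 < b" "b \<le> x"
  shows "1 / (1 + 1 / b) \<le> 1 - exp (- x)"
proof -
  have "exp (- x) \<le> exp (- b)" using assms by simp
  also have "\<dots> = 1 / exp b" by (simp add: exp_minus inverse_eq_divide)
  also have "\<dots> \<le> 1 / (1 + b)" using exp_ge_add_one_self[of b] assms by (intro divide_left_mono) auto
  also have "1 / (1 + b) = 1 - 1 / (1 + 1 / b)" using assms by (simp add: field_simps)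
  finally show ?thesis by simp
qed

section \<open>Collecting the errors and bounding the main term from below\<close>

context saddle begin

lemma phase_eq_aux_numerator: "phase = aux_numerator s"
  by (auto simp: phase_def aux_numerator_def)

lemma model_eq_gauss: "model x = phase \<eta> * gauss \<eta> x"
  by (simp add: model_def gauss_def)

definition main_term :: complex where
  "main_term = - cis (5 * pi / 8) / of_real (sqrt 2) * (sin (of_real pi * \<eta>) / cos (2 * of_real pi * \<eta>))"

lemma line_integral_phase_minus_model_le:
  assumes N: "real N \<le> Re \<eta> - Im \<eta>" "Re \<eta> - Im \<eta> < real N + 1"
  shows "norm (line_integral phase (real N + 1/2) - phase \<eta> * line_integral (gauss \<eta>) (real N + 1/2))
    \<le> norm (phase \<eta>) / norm \<eta> * exp (- pi * Im \<eta>) * (1344 * pi * exp 145 * (\<integral>u. exp (- u\<^sup>2) \<partial>lborel))"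
proof -
  define w where "w = real N + 1/2 - (Re \<eta> - Im \<eta>)"
  have w: "\<bar>w\<bar> \<le> 1/2" using N unfolding w_def abs_le_iff by linarith
  define B where "B = 1344 * pi * exp 145 * norm (phase \<eta>) / norm \<eta> * exp (- pi * Im \<eta>)"
  \<comment> \<open>The parameter measured from \<open>\<eta> + w\<close>, the point of the line at
    the height of the saddle, with the orientation reversed.\<close>
  define r where "r u = - u - sqrt 2 * Im \<eta>" for u
  let ?x = "aux_line (real N + 1/2)"
  let ?P = "\<lambda>u. phase (?x u) / sin_kernel (?x u) * (- cis (pi / 4))"
  let ?M = "\<lambda>u. model (?x u) / sin_kernel (?x u) * (- cis (pi / 4))"
  have x: "?x u = \<eta> + of_real w + of_real (r u) * cis (pi/4)" for u
    by (rule complex_eqI) (simp_all add: Re_aux_line Im_aux_line w_def r_def cos_45 sin_45 field_simps)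
  have iP: "integrable lborel ?P"
    unfolding phase_eq_aux_numerator by (rule aux_numerator_integrable)
  have Meq: "?M = (\<lambda>u. phase \<eta> * (gauss \<eta> (?x u) / sin_kernel (?x u) * (- cis (pi / 4))))"
    by (simp add: model_eq_gauss mult_ac)
  have iM: "integrable lborel ?M"
    unfolding Meq by (intro integrable_mult_right gauss_integrable)
  have M: "phase \<eta> * line_integral (gauss \<eta>) (real N + 1/2) = (\<integral>u. ?M u \<partial>lborel)"
    unfolding Meq line_integral_def by (rule integral_mult_right_zero[symmetric])
  have rr: "r = (\<lambda>u. - sqrt 2 * Im \<eta> + - 1 * u)" by (simp add: r_def fun_eq_iff)
  have iG: "integrable lborel (\<lambda>u. exp (- (r u)\<^sup>2))"
    using lborel_integrable_real_affine[OF integrable_exp_minus_square, of "-1" "- sqrt 2 * Im \<eta>"]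
    by (simp add: rr)
  have G: "(\<integral>u. exp (- (r u)\<^sup>2) \<partial>lborel) = (\<integral>u. exp (- u\<^sup>2) \<partial>lborel)"
    using lborel_integral_real_affine[of "-1" "\<lambda>u. exp (- u\<^sup>2)" "- sqrt 2 * Im \<eta>"]
    by (simp add: rr)
  have bd: "norm (?P u - ?M u) \<le> B * exp (- (r u)\<^sup>2)" for u
  proof -
    have "norm (?P u - ?M u) = norm (phase (?x u) - model (?x u)) / norm (sin_kernel (?x u))"
    proof -
      have "?P u - ?M u = (phase (?x u) - model (?x u)) / sin_kernel (?x u) * (- cis (pi / 4))"
        by (simp only: diff_divide_distrib left_diff_distrib)
      then show ?thesis by (simp add: norm_mult norm_divide)
    qed
    also have "\<dots> \<le> norm (phase (?x u) - model (?x u)) / (exp (pi * \<bar>Im (?x u)\<bar>) / 2)"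
      using norm_sin_kernel_aux_line_ge[of N u] by (intro divide_left_mono mult_pos_pos) (auto intro: less_le_trans[rotated])
    also have "\<dots> = 2 * (norm (phase (?x u) - model (?x u)) * exp (- pi * \<bar>Im (?x u)\<bar>))"
      by (simp add: exp_minus field_simps)
    also have "\<dots> \<le> 2 * (672 * pi * exp 145 * norm (phase \<eta>) / norm \<eta> * exp (- pi * Im \<eta>) * exp (- (r u)\<^sup>2))"
      unfolding x by (intro mult_left_mono norm_phase_minus_model_slanted_line_le w) auto
    finally show ?thesis by (simp add: B_def)
  qed
  have "norm (line_integral phase (real N + 1/2) - phase \<eta> * line_integral (gauss \<eta>) (real N + 1/2))
      = norm (\<integral>u. ?P u - ?M u \<partial>lborel)"
    unfolding M using Bochner_Integration.integral_diff[OF iP iM] by (simp only: line_integral_def)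
  also have "\<dots> \<le> (\<integral>u. norm (?P u - ?M u) \<partial>lborel)" by (rule integral_norm_bound)
  also have "\<dots> \<le> (\<integral>u. B * exp (- (r u)\<^sup>2) \<partial>lborel)"
    using bd by (intro integral_mono integrable_norm integrable_mult_right Bochner_Integration.integrable_diff iP iM iG) auto
  also have "\<dots> = B * (\<integral>u. exp (- u\<^sup>2) \<partial>lborel)" using G by simp
  finally show ?thesis by (simp add: B_def mult_ac)
qed

lemma riemann_aux_minus_main_le:
  "norm (riemann_aux s - phase \<eta> * main_term)
     \<le> error_const * (norm (phase \<eta>) / norm \<eta>) * exp (- pi * Im \<eta>) * (1 + 1 / Im \<eta>) ^ 4"
proof -
  define b where "b = Im \<eta>"
  have b: "b > 0" using Im_pos by (simp add: b_def)
  define P where "P = norm (phase \<eta>) / norm \<eta> * exp (- pi * b)"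
  have P0: "P \<ge> 0" by (simp add: P_def)
  \<comment> \<open>The floor serves two purposes: the crossing \<open>N + 1/2\<close> lies within
    1/2 of \<open>Re \<eta> - Im \<eta>\<close>, and every integer up to \<open>N\<close> keeps the
    distance \<open>Im \<eta>\<close> from \<open>Re \<eta>\<close> that the termwise comparison
    requires.\<close>
  define N where "N = nat \<lfloor>Re \<eta> - Im \<eta>\<rfloor>"
  have N: "real N \<le> Re \<eta> - Im \<eta>" "Re \<eta> - Im \<eta> < real N + 1" "N \<ge> 1"
  proof -
    have "Re \<eta> - Im \<eta> \<ge> 1" using Im_le Re_ge by linarith
    then show "real N \<le> Re \<eta> - Im \<eta>" "Re \<eta> - Im \<eta> < real N + 1" "N \<ge> 1"
      unfolding N_def by linarith+
  qed
  define M where "M j = (-1) ^ (N + j) * model (of_nat N - of_nat j)" for j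
  \<comment> \<open>Extending the finite sum by zeros allows one termwise estimate against the whole
    Mordell series.\<close>
  define Q where "Q j = (if j < N then (-1) ^ (N + j) * phase (of_nat N - of_nat j) else 0)" for j
  let ?J = "line_integral (gauss \<eta>) (real N + 1/2)"
  have Msum: "M sums (phase \<eta> * (main_term - ?J))"
  proof -
    have "(\<lambda>j. phase \<eta> * ((-1) ^ (N + j) * gauss \<eta> (of_nat N - of_nat j))) sums (phase \<eta> * (main_term - ?J))"
      unfolding main_term_def by (intro sums_mult gauss_mordell(1) N Im_pos)
    then show ?thesis by (simp add: M_def[abs_def] model_eq_gauss mult_ac)
  qed
  have Qsum: "Q sums (\<Sum>j<N. (-1) ^ (N + j) * phase (of_nat N - of_nat j))"
    using sums_If_finite_set[of "{..<N}" "\<lambda>j. (-1) ^ (N + j) * phase (of_nat N - of_nat j)"]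
    by (simp add: Q_def[abs_def])
  have QM: "(\<lambda>j. Q j - M j) sums ((\<Sum>j<N. (-1) ^ (N + j) * phase (of_nat N - of_nat j)) - phase \<eta> * (main_term - ?J))"
    by (rule sums_diff[OF Qsum Msum])
  define K where "K = 384 * pi * P * (1/b + 1/b^3)"
  have K0: "K \<ge> 0" using b P0 by (simp add: K_def)
  have bound: "norm (Q j - M j) \<le> K * exp (- pi * b) ^ j" for j
  proof -
    define n where "n = real N - real j"
    define k where "k = Re \<eta> - n"
    have nn: "of_nat N - of_nat j = complex_of_real n" by (simp add: n_def)
    have k: "k \<ge> b" "k \<ge> real j" using N(1) b by (auto simp: k_def n_def b_def)
    have "norm (Q j - M j) \<le> 192 * pi * norm (phase \<eta>) / norm \<eta> * ((k + k ^ 3) * exp (- 4 * pi * Im \<eta> * k))"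
    proof (cases "j < N")
      case True
      have "norm (Q j - M j) = norm ((-1) ^ (N + j) * (phase (of_real n) - model (of_real n)))"
        using True by (simp add: Q_def M_def nn right_diff_distrib)
      also have "\<dots> = norm (phase (of_real n) - model (of_real n))" by (simp add: norm_mult norm_power)
      also have "\<dots> \<le> 192 * pi * norm (phase \<eta>) / norm \<eta> * ((k + k ^ 3) * exp (- 4 * pi * Im \<eta> * k))"
        unfolding k_def by (rule norm_phase_minus_model_real_le) (use True N in \<open>auto simp: n_def\<close>)
      finally show ?thesis .
    next
      case False
      then have "norm (Q j - M j) = norm (model (of_real n))"
        by (simp add: Q_def M_def nn norm_mult norm_power)
      also have "\<dots> \<le> 192 * pi * norm (phase \<eta>) / norm \<eta> * ((k + k ^ 3) * exp (- 4 * pi * Im \<eta> * k))"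
        unfolding k_def by (rule norm_model_nonpos_le) (use False in \<open>simp add: n_def\<close>)
      finally show ?thesis .
    qed
    also have "\<dots> \<le> 192 * pi * norm (phase \<eta>) / norm \<eta> * (2 * exp (- pi * b) * ((1/b + 1/b^3) * exp (- pi * b * real j)))"
      unfolding b_def[symmetric] using b k by (intro mult_left_mono cubic_exp_bound) auto
    also have "exp (- pi * b * real j) = exp (- pi * b) ^ j"
    proof -
      have "- pi * b * real j = real j * (- pi * b)" by simp
      then show ?thesis by (simp only: exp_of_nat_mult)
    qed
    moreover have "192 * pi * A / n * (2 * E * (X * Y)) = 384 * pi * (A / n * E) * X * Y" for A n E X Y :: real
      by simp
    ultimately show ?thesis by (simp only: K_def P_def)
  qed
  have e1: "exp (- pi * b) < 1" using b by simp
  have "norm (\<Sum>j. Q j - M j) \<le> (\<Sum>j. K * exp (- pi * b) ^ j)"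
    by (rule norm_suminf_le) (use bound e1 in \<open>auto intro!: summable_mult summable_geometric\<close>)
  also have "(\<Sum>j. K * exp (- pi * b) ^ j) = K * (1 / (1 - exp (- pi * b)))"
    using sums_unique[OF sums_mult[OF geometric_sums[of "exp (- pi * b)"], of K]] e1 by simp
  also have "\<dots> \<le> K * (1 + 1 / b)"
  proof (intro mult_left_mono K0)
    have "b * 1 \<le> b * pi" using b pi_gt3 by (intro mult_left_mono) auto
    then have "1 / (1 + 1 / b) \<le> 1 - exp (- pi * b)"
      using one_minus_exp_ge[of b "pi * b"] b by (simp add: mult.commute)
    moreover have "1 + 1 / b > 0" using b by (simp add: add_pos_pos)
    ultimately show "1 / (1 - exp (- pi * b)) \<le> 1 + 1 / b"
      using e1 by (simp add: pos_divide_le_eq mult.commute)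
  qed
  \<comment> \<open>Three powers of \<open>1 / b\<close> come from the cubic factor and one from
    summing the geometric series.\<close>
  also have "\<dots> \<le> 384 * pi * P * (1 + 1 / b) ^ 4"
  proof -
    define q where "q = 1 / b"
    have q: "q \<ge> 0" using b by (simp add: q_def)
    have "(q + q ^ 3) * (1 + q) \<le> (1 + q) ^ 4"
      using q by (simp add: eval_nat_numeral algebra_simps)
    then have "384 * pi * P * ((q + q ^ 3) * (1 + q)) \<le> 384 * pi * P * (1 + q) ^ 4"
      using P0 by (intro mult_left_mono) auto
    then show ?thesis by (simp add: K_def q_def power_one_over mult.assoc)
  qed
  finally have S1: "norm (\<Sum>j. Q j - M j) \<le> 384 * pi * P * (1 + 1 / b) ^ 4" .
  define G :: real where "G = (\<integral>u. exp (- u\<^sup>2) \<partial>lborel)"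
  have G0: "G \<ge> 0" unfolding G_def by (rule integral_nonneg_AE) auto
  have "norm (line_integral phase (real N + 1/2) - phase \<eta> * ?J) \<le> P * (1344 * pi * exp 145 * G)"
    using line_integral_phase_minus_model_le[OF N(1,2)] by (simp add: P_def b_def G_def)
  also have "\<dots> \<le> P * (1344 * pi * exp 145 * G) * (1 + 1 / b) ^ 4"
  proof -
    have "1 \<le> (1 + 1 / b) ^ 4" using b by (intro one_le_power) simp
    then have "P * (1344 * pi * exp 145 * G) * 1 \<le> P * (1344 * pi * exp 145 * G) * (1 + 1 / b) ^ 4"
      using P0 G0 by (intro mult_left_mono) auto
    then show ?thesis by simp
  qed
  finally have S2: "norm (line_integral phase (real N + 1/2) - phase \<eta> * ?J) \<le> P * (1344 * pi * exp 145 * G) * (1 + 1 / b) ^ 4" .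
  have "riemann_aux s - phase \<eta> * main_term = (\<Sum>j. Q j - M j) + (line_integral phase (real N + 1/2) - phase \<eta> * ?J)"
    unfolding sums_unique[OF QM, symmetric] riemann_aux_shift[of s N] phase_eq_aux_numerator by (simp add: algebra_simps)
  then have "norm (riemann_aux s - phase \<eta> * main_term)
      \<le> 384 * pi * P * (1 + 1 / b) ^ 4 + P * (1344 * pi * exp 145 * G) * (1 + 1 / b) ^ 4"
    using norm_triangle_mono[OF S1 S2] by simp
  also have "\<dots> = error_const * P * (1 + 1 / b) ^ 4"
    by (simp add: error_const_def G_def algebra_simps)
  finally show ?thesis by (simp add: P_def b_def mult_ac)
qed

text \<open>The sine is bounded below by \<open>sinh (pi * b)\<close> and the cosine above by
  \<open>exp (2 * pi * b)\<close>. Near the real axis the sine may almost vanish, which is the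
  reason for the divisor \<open>1 + 1 / Im \<eta>\<close>.\<close>

lemma norm_main_term_ge:
  "norm main_term \<ge> 1/4 * exp (- pi * Im \<eta>) / (1 + 1 / Im \<eta>)"
proof -
  define b where "b = Im \<eta>"
  have b: "b > 0" using Im_pos by (simp add: b_def)
  have "exp (pi * b) - exp (- (pi * b)) \<le> 2 * norm (sin (of_real pi * \<eta>))"
  proof -
    have "2 * norm (sin (of_real pi * \<eta>)) = norm (sin_kernel \<eta>)"
      by (simp add: sin_kernel_eq norm_mult)
    moreover have "norm (exp (- (of_real pi * \<i> * \<eta>))) - norm (exp (of_real pi * \<i> * \<eta>)) \<le> norm (sin_kernel \<eta>)"
      unfolding sin_kernel_def by (metis norm_minus_commute norm_triangle_ineq2)
    ultimately show ?thesis by (simp add: norm_exp_eq_Re b_def)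
  qed
  moreover have "exp (pi * b) - exp (- (pi * b)) = exp (pi * b) * (1 - exp (- (2 * pi * b)))"
    by (simp add: right_diff_distrib flip: exp_add)
  moreover have "1 / (1 + 1 / b) \<le> 1 - exp (- (2 * pi * b))"
  proof (rule one_minus_exp_ge[OF b])
    have "b * 1 \<le> b * (2 * pi)" using b pi_gt3 by (intro mult_left_mono) auto
    then show "b \<le> 2 * pi * b" by (simp add: mult_ac)
  qed
  then have "exp (pi * b) * (1 / (1 + 1 / b)) \<le> exp (pi * b) * (1 - exp (- (2 * pi * b)))"
    by (intro mult_left_mono) auto
  moreover have "L / 2 \<le> S" if "X \<le> 2 * S" "X = A" "L \<le> A" for L S X A :: real
    using that by linarith
  ultimately have sin: "exp (pi * b) * (1 / (1 + 1 / b)) / 2 \<le> norm (sin (of_real pi * \<eta>))" by blast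
  have cos: "norm (cos (2 * of_real pi * \<eta>)) \<le> exp (2 * pi * b)"
  proof -
    have "norm (cos (2 * of_real pi * \<eta>)) \<le> (norm (exp (\<i> * (2 * of_real pi * \<eta>))) + norm (exp (- (\<i> * (2 * of_real pi * \<eta>))))) / 2"
      unfolding cos_exp_eq using norm_triangle_ineq[of "exp (\<i> * (2 * of_real pi * \<eta>))" "exp (- (\<i> * (2 * of_real pi * \<eta>)))"]
      by (simp add: norm_divide)
    also have "\<dots> = (exp (- (2 * pi * b)) + exp (2 * pi * b)) / 2"
      by (simp add: norm_exp_eq_Re b_def)
    also have "\<dots> \<le> exp (2 * pi * b)"
    proof -
      have "- (2 * pi * b) \<le> 2 * pi * b" using b by simp
      then have "exp (- (2 * pi * b)) \<le> exp (2 * pi * b)" by (simp only: exp_le_cancel_iff)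
      moreover have "(x + y) / 2 \<le> y" if "x \<le> y" for x y :: real using that by simp
      ultimately show ?thesis by blast
    qed
    finally show ?thesis .
  qed
  have cos0: "norm (cos (2 * of_real pi * \<eta>)) > 0"
    using gauss_mordell(2)[of 1 \<eta>] Im_pos by simp
  have "1/4 * exp (- pi * b) / (1 + 1 / b) \<le> 1 / sqrt 2 * ((exp (pi * b) * (1 / (1 + 1 / b)) / 2) / exp (2 * pi * b))"
  proof -
    have "exp (pi * b) / exp (2 * pi * b) = exp (- pi * b)" by (simp flip: exp_diff)
    then have "1 / sqrt 2 * ((exp (pi * b) * (1 / (1 + 1 / b)) / 2) / exp (2 * pi * b))
       = (1 / (2 * sqrt 2)) * (exp (- pi * b) / (1 + 1 / b))"
    proof -
      assume e: "exp (pi * b) / exp (2 * pi * b) = exp (- pi * b)"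
      have "1 / sqrt 2 * ((x * (1 / q) / 2) / y) = (1 / (2 * sqrt 2)) * ((x / y) / q)" for x y q :: real
        by simp
      then show ?thesis by (simp only: e)
    qed
    moreover have "1/4 \<le> 1 / (2 * sqrt 2)"
      using real_sqrt_le_mono[of 2 4] by (simp add: field_simps)
    then have "1/4 * (exp (- pi * b) / (1 + 1 / b)) \<le> (1 / (2 * sqrt 2)) * (exp (- pi * b) / (1 + 1 / b))"
      using b by (intro mult_right_mono) (auto intro!: divide_nonneg_pos add_pos_pos)
    ultimately show ?thesis by simp
  qed
  also have "\<dots> \<le> 1 / sqrt 2 * (norm (sin (of_real pi * \<eta>)) / norm (cos (2 * of_real pi * \<eta>)))"
    using sin cos cos0 b by (intro mult_left_mono frac_le) auto
  also have "\<dots> = norm main_term"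
    by (simp add: main_term_def norm_mult norm_divide)
  finally show ?thesis by (simp add: b_def)
qed

text \<open>On division the factors \<open>exp (- pi * Im \<eta>)\<close> of error and main term
  cancel, and the lower bound for the main term raises the fourth power to a fifth.\<close>

lemma riemann_aux_main_term:
  obtains U where "riemann_aux s = phase \<eta> * main_term * (1 + U)"
    "norm U \<le> 4 * error_const * (1 + 1 / Im \<eta>) ^ 5 / norm \<eta>"
proof -
  define q where "q = 1 + 1 / Im \<eta>"
  have q: "q > 0" using Im_pos by (simp add: q_def add_pos_pos)
  define E where "E = exp (- pi * Im \<eta>)"
  have E: "E > 0" by (simp add: E_def)
  define T where "T = phase \<eta> * main_term"
  define U where "U = (riemann_aux s - T) / T"
  have ne: "norm \<eta> > 0" using eta_nz by simp
  have p0: "norm (phase \<eta>) > 0" using phase_eta_nz by simp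
  have m: "norm main_term \<ge> 1/4 * E / q" using norm_main_term_ge by (simp add: E_def q_def)
  have lo: "norm T \<ge> norm (phase \<eta>) * (1/4 * E / q)"
    unfolding T_def norm_mult using m by (intro mult_left_mono) auto
  have lo0: "norm (phase \<eta>) * (1/4 * E / q) > 0" using p0 E q by simp
  then have T0: "T \<noteq> 0" using lo by auto
  then have "riemann_aux s = T * (1 + U)" by (simp add: U_def field_simps)
  moreover have "norm U \<le> 4 * error_const * q ^ 5 / norm \<eta>"
  proof -
    have "norm U = norm (riemann_aux s - T) / norm T" by (simp add: U_def norm_divide)
    also have "\<dots> \<le> (error_const * (norm (phase \<eta>) / norm \<eta>) * E * q ^ 4) / (norm (phase \<eta>) * (1/4 * E / q))"
    proof -
      have num: "norm (riemann_aux s - T) \<le> error_const * (norm (phase \<eta>) / norm \<eta>) * E * q ^ 4"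
        using riemann_aux_minus_main_le by (simp only: T_def E_def q_def)
      show ?thesis by (rule frac_le[OF order_trans[OF norm_ge_zero num] num lo0 lo])
    qed
    also have "\<dots> = 4 * error_const * q ^ 5 / norm \<eta>"
    proof -
      have "(c * (p / n) * e * q ^ 4) / (p * (1/4 * e / q)) = 4 * c * q ^ 5 / n"
        if "p > 0" "e > 0" "n > 0" for c p n e :: real
        using that q by (simp add: field_simps eval_nat_numeral)
      then show ?thesis using p0 E ne by blast
    qed
    finally show ?thesis .
  qed
  ultimately show ?thesis using that[of U] by (simp add: T_def q_def)
qed

end

section \<open>The factor of the functional equation\<close>

text \<open>Duplication at \<open>(1 - s) / 2\<close> and reflection at \<open>s / 2\<close> leave
  the single value \<open>Gamma (1 - s)\<close>. In the range considered its argument has real part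
  at least 1, where the Stirling estimate applies, whereas \<open>s / 2\<close> lies in the left
  half-plane.\<close>

lemma zeta_chi_eq_Gamma_sin:
  assumes "Im s \<noteq> 0"
  shows "zeta_chi s = exp (s * of_real (ln (2 * pi))) / of_real pi * Gamma (1 - s) * sin (of_real pi * (s / 2))"
proof -
  have nonint: "w \<notin> \<int>" if "Im w \<noteq> 0" for w :: complex using that by (auto elim!: Ints_cases)
  then have nz: "w \<notin> \<int>\<^sub>\<le>\<^sub>0" if "Im w \<noteq> 0" for w :: complex using that nonpos_Ints_Int by blast
  have g0: "Gamma (s / 2) \<noteq> 0" by (rule Gamma_nonzero) (use assms in \<open>auto intro!: nz\<close>)
  have "Gamma ((1 - s) / 2) * Gamma ((1 - s) / 2 + 1/2)
      = exp ((1 - 2 * ((1 - s) / 2)) * of_real (ln 2)) * of_real (sqrt pi) * Gamma (2 * ((1 - s) / 2))"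
    by (rule Gamma_legendre_duplication) (use assms in \<open>auto intro!: nz\<close>)
  moreover have "(1 - s) / 2 + 1/2 = 1 - s / 2" "1 - 2 * ((1 - s) / 2) = s" "2 * ((1 - s) / 2) = 1 - s"
    by (simp_all add: field_simps)
  ultimately have dup: "Gamma ((1 - s) / 2) * Gamma (1 - s / 2) = exp (s * of_real (ln 2)) * of_real (sqrt pi) * Gamma (1 - s)"
    by (simp only:)
  have refl: "Gamma (s / 2) * Gamma (1 - s / 2) = of_real pi / sin (of_real pi * (s / 2))"
    by (rule Gamma_reflection_complex)
  have sn: "sin (of_real pi * (s / 2)) \<noteq> 0"
  proof
    assume "sin (of_real pi * (s / 2)) = 0"
    then have "sin_kernel (s / 2) = 0" by (simp add: sin_kernel_eq)
    then show False using sin_kernel_eq_0D(1)[of "s / 2"] assms by simp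
  qed
  have inv: "1 / Gamma (s / 2) = Gamma (1 - s / 2) * sin (of_real pi * (s / 2)) / of_real pi"
    using refl g0 sn by (simp add: field_simps)
  have pw: "of_real pi powr (s - 1/2) * of_real (sqrt pi) = exp (s * of_real (ln pi))"
  proof -
    have "sqrt pi = exp (ln pi / 2)" by (simp add: powr_half_sqrt[symmetric] powr_def)
    then have "complex_of_real (sqrt pi) = exp (of_real (ln pi / 2))" by (simp only: exp_of_real)
    moreover have "of_real pi powr (s - 1/2) = exp ((s - 1/2) * of_real (ln pi))"
      by (simp add: powr_def Ln_of_real)
    ultimately show ?thesis by (simp add: algebra_simps flip: exp_add)
  qed
  have "zeta_chi s = of_real pi powr (s - 1/2) * Gamma ((1 - s) / 2) * (1 / Gamma (s / 2))"
    by (simp add: zeta_chi_def)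
  also have "\<dots> = of_real pi powr (s - 1/2) * (Gamma ((1 - s) / 2) * Gamma (1 - s / 2)) * (sin (of_real pi * (s / 2)) / of_real pi)"
    unfolding inv by simp
  also have "\<dots> = (of_real pi powr (s - 1/2) * of_real (sqrt pi)) * exp (s * of_real (ln 2)) * Gamma (1 - s) * (sin (of_real pi * (s / 2)) / of_real pi)"
    unfolding dup by (simp only: mult_ac)
  also have "\<dots> = exp (s * of_real (ln pi) + s * of_real (ln 2)) * Gamma (1 - s) * (sin (of_real pi * (s / 2)) / of_real pi)"
    unfolding pw exp_add ..
  also have "s * of_real (ln pi) + s * of_real (ln 2) = s * of_real (ln (2 * pi))"
    by (simp add: ln_mult algebra_simps)
  finally show ?thesis by simp
qed

text \<open>Twice \<open>4 * error_const + 16 * exp 16 + 4\<close>: the main-term, Stirling and sine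
  errors, doubled by the division by \<open>W\<close>.\<close>

definition expansion_const :: real where
  "expansion_const = 8 * error_const + 32 * exp 16 + 8"

context saddle begin

lemma one_minus_s: "1 - s = - (2 * of_real pi * \<i> * \<eta>\<^sup>2)"
  by (simp add: s_def)

lemma Im_s: "Im s = 2 * pi * ((Re \<eta>)\<^sup>2 - (Im \<eta>)\<^sup>2)"
  by (simp add: s_def power2_eq_square)

text \<open>A crude bound, as \<open>Im s\<close> has the order of
  \<open>(norm \<eta>)\<^sup>2\<close>, but errors of order \<open>1 / norm \<eta>\<close> are all
  that is needed.\<close>

lemma Im_s_ge: "Im s \<ge> norm \<eta>"
proof -
  have "(Im \<eta>)\<^sup>2 \<le> (Re \<eta> / 100)\<^sup>2" using Im_le Im_pos by (intro power_mono) auto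
  moreover have "(Re \<eta> / 100)\<^sup>2 = (Re \<eta>)\<^sup>2 / 10000" by (simp add: power_divide)
  ultimately have "(Re \<eta>)\<^sup>2 - (Im \<eta>)\<^sup>2 \<ge> 1/2 * (Re \<eta>)\<^sup>2" using zero_le_power2[of "Re \<eta>"] by linarith
  moreover have "100 * Re \<eta> \<le> Re \<eta> * Re \<eta>" using Re_ge by (intro mult_right_mono) auto
  ultimately have d: "(Re \<eta>)\<^sup>2 - (Im \<eta>)\<^sup>2 \<ge> 2 * Re \<eta>" using Re_ge unfolding power2_eq_square by linarith
  have "norm \<eta> \<le> 1 * (2 * Re \<eta>)" using norm_eta_le Re_ge by linarith
  also have "\<dots> \<le> (2 * pi) * ((Re \<eta>)\<^sup>2 - (Im \<eta>)\<^sup>2)"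
    using d Re_ge pi_gt3 by (intro mult_mono) auto
  finally show ?thesis by (simp add: Im_s)
qed

text \<open>As \<eta> lies in the first quadrant, doubling its argument and subtracting
  \<open>pi / 2\<close> stays within the principal range.\<close>

lemma Ln_one_minus_s: "Ln (1 - s) = of_real (ln (2 * pi)) + 2 * Ln \<eta> - \<i> * of_real (pi / 2)"
proof -
  let ?L = "of_real (ln (2 * pi)) + 2 * Ln \<eta> - \<i> * of_real (pi / 2)"
  have "exp ?L = exp (of_real (ln (2 * pi))) * (exp (Ln \<eta>) * exp (Ln \<eta>)) * exp (- (\<i> * of_real (pi / 2)))"
    by (simp only: diff_conv_add_uminus exp_add mult_2)
  also have "exp (complex_of_real (ln (2 * pi))) = of_real (2 * pi)" by (simp only: exp_of_real) simp
  also have "exp (- (\<i> * complex_of_real (pi / 2))) = - \<i>"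
    using cis_conv_exp[of "- pi / 2"] by (simp add: complex_eq_iff)
  also have "exp (Ln \<eta>) = \<eta>" using eta_nz by simp
  finally have "exp ?L = 1 - s" by (simp add: one_minus_s power2_eq_square mult_ac)
  moreover have "Ln (exp ?L) = ?L"
  proof (rule Ln_exp)
    have "Re \<eta> > 0" using Re_ge by linarith
    then have "\<bar>Im (Ln \<eta>)\<bar> < pi/2" using Re_Ln_pos_lt[of \<eta>] eta_nz by simp
    moreover have "Im (Ln \<eta>) > 0" using Im_Ln_pos_lt_imp[of \<eta>] Im_pos eta_nz by simp
    ultimately show "- pi < Im ?L" "Im ?L \<le> pi" by simp_all
  qed
  ultimately show ?thesis by simp
qed

text \<open>Of the two exponentials in the sine, the one with \<open>- \<i> * pi * s / 2\<close>
  dominates for large \<open>Im s\<close>; the last factor is the correction by the other. The error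
  \<open>u\<close> is that of Stirling's formula at \<open>1 - s\<close>.\<close>

lemma zeta_chi_asymptotic:
  obtains u where "zeta_chi s = cis (pi / 4) * exp ((1 - 2 * s) * Ln \<eta> + 2 * of_real pi * \<i> * \<eta>\<^sup>2) * (1 + u) * (1 - exp (\<i> * of_real pi * s))"
    "norm u \<le> 16 * exp 16 / norm \<eta>" "norm (exp (\<i> * of_real pi * s)) \<le> 1 / norm \<eta>"
proof -
  have ne: "norm \<eta> > 0" using eta_nz by simp
  have Re1: "Re (1 - s) \<ge> 1" using prod_ge by (simp add: Re_s)
  define Z where "Z = of_real (sqrt (2 * pi)) * exp (stirling_exponent (1 - s))"
  define u where "u = Gamma (1 - s) / Z - 1"
  have Z0: "Z \<noteq> 0" by (simp add: Z_def)
  have G: "Gamma (1 - s) = Z * (1 + u)" using Z0 by (simp add: u_def)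
  have nu: "norm u \<le> 16 * exp 16 / norm \<eta>"
  proof -
    have "norm u \<le> 16 * exp 16 / norm (1 - s)"
      unfolding u_def Z_def by (rule Gamma_stirling_right_half_plane[OF Re1])
    also have "\<dots> \<le> 16 * exp 16 / norm \<eta>"
    proof (intro divide_left_mono mult_pos_pos)
      have "norm \<eta> \<le> Im s" by (rule Im_s_ge)
      also have "\<dots> \<le> norm (1 - s)" using abs_Im_le_cmod[of "1 - s"] by simp
      finally show "norm \<eta> \<le> norm (1 - s)" .
      then show "norm (1 - s) > 0" using ne by linarith
    qed (use ne in auto)
    finally show ?thesis .
  qed
  have ne2: "norm (exp (\<i> * of_real pi * s)) \<le> 1 / norm \<eta>"
  proof -
    have "norm (exp (\<i> * of_real pi * s)) = 1 / exp (pi * Im s)" by (simp add: norm_exp_eq_Re exp_minus inverse_eq_divide)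
    also have "\<dots> \<le> 1 / norm \<eta>"
    proof (intro divide_left_mono mult_pos_pos)
      have "1 * Im s \<le> pi * Im s" using order_trans[OF norm_ge_zero Im_s_ge] pi_gt3 by (intro mult_right_mono) auto
      then show "norm \<eta> \<le> exp (pi * Im s)"
        using exp_ge_add_one_self[of "pi * Im s"] Im_s_ge by linarith
    qed (use ne in auto)
    finally show ?thesis .
  qed
  have Ims: "Im s \<noteq> 0" using Im_s_ge ne by linarith
  have sn: "sin (of_real pi * (s / 2)) = \<i> / 2 * exp (- (\<i> * of_real pi * s / 2)) * (1 - exp (\<i> * of_real pi * s))"
  proof -
    have a: "\<i> * (of_real pi * (s / 2)) = \<i> * of_real pi * s / 2" by simp
    have "exp (- (\<i> * of_real pi * s / 2)) * exp (\<i> * of_real pi * s) = exp (\<i> * of_real pi * s / 2)"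
      by (simp add: mult_ac flip: exp_add)
    then show ?thesis unfolding sin_exp_eq a by (simp add: algebra_simps divide_simps)
  qed
  have Zeq: "exp (s * of_real (ln (2 * pi))) / of_real pi * Z * (\<i> / 2 * exp (- (\<i> * of_real pi * s / 2)))
      = cis (pi / 4) * exp ((1 - 2 * s) * Ln \<eta> + 2 * of_real pi * \<i> * \<eta>\<^sup>2)"
  proof -
    have sq: "of_real (sqrt (2 * pi)) = exp (of_real (ln (2 * pi)) / 2 :: complex)"
    proof -
      have "sqrt (2 * pi) = exp (ln (2 * pi) / 2)" by (simp add: powr_half_sqrt[symmetric] powr_def)
      then have "complex_of_real (sqrt (2 * pi)) = exp (of_real (ln (2 * pi) / 2))" by (simp only: exp_of_real)
      then show ?thesis by simp
    qed
    have se: "stirling_exponent (1 - s) = (1/2 - s) * (of_real (ln (2 * pi)) + 2 * Ln \<eta> - \<i> * of_real (pi / 2)) + 2 * of_real pi * \<i> * \<eta>\<^sup>2"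
    proof -
      have "stirling_exponent (1 - s) = (1/2 - s) * Ln (1 - s) + - (1 - s)" by (simp add: stirling_exponent_def)
      also have "- (1 - s) = 2 * of_real pi * \<i> * \<eta>\<^sup>2" unfolding one_minus_s by simp
      finally show ?thesis unfolding Ln_one_minus_s .
    qed
    have c: "cis (pi / 4) = \<i> * exp (- (\<i> * of_real pi / 4))"
    proof -
      have "cis (pi / 4) = cis (pi / 2 + - pi / 4)" by simp
      also have "\<dots> = \<i> * cis (- pi / 4)" by (simp only: cis_mult[symmetric] cis_pi_half)
      also have "cis (- pi / 4) = exp (- (\<i> * of_real pi / 4))" by (simp add: cis_conv_exp)
      finally show ?thesis .
    qed
    have tp: "exp (of_real (ln (2 * pi))) = (2 * of_real pi :: complex)"
      using exp_of_real[of "ln (2 * pi)", where 'a = complex] by simp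
    define l where "l = complex_of_real (ln (2 * pi))"
    have ex: "s * l + l / 2 + ((1/2 - s) * (l + 2 * Ln \<eta> - \<i> * of_real (pi / 2)) + 2 * of_real pi * \<i> * \<eta>\<^sup>2) + (- (\<i> * of_real pi * s / 2))
      = l + (- (\<i> * of_real pi / 4)) + ((1 - 2 * s) * Ln \<eta> + 2 * of_real pi * \<i> * \<eta>\<^sup>2)"
      by (simp add: field_simps)
    have "exp (s * l) / of_real pi * Z * (\<i> / 2 * exp (- (\<i> * of_real pi * s / 2)))
       = \<i> / (2 * of_real pi) * exp (s * l + l / 2 + ((1/2 - s) * (l + 2 * Ln \<eta> - \<i> * of_real (pi / 2)) + 2 * of_real pi * \<i> * \<eta>\<^sup>2) + (- (\<i> * of_real pi * s / 2)))"
      unfolding Z_def sq se l_def[symmetric] by (simp only: exp_add) (simp add: mult_ac)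
    also have "\<dots> = \<i> / (2 * of_real pi) * (exp l * exp (- (\<i> * of_real pi / 4)) * exp ((1 - 2 * s) * Ln \<eta> + 2 * of_real pi * \<i> * \<eta>\<^sup>2))"
      unfolding ex by (simp only: exp_add)
    also have "\<dots> = cis (pi / 4) * exp ((1 - 2 * s) * Ln \<eta> + 2 * of_real pi * \<i> * \<eta>\<^sup>2)"
      unfolding c l_def tp by simp
    finally show ?thesis by (simp only: l_def)
  qed
  have "zeta_chi s = (exp (s * of_real (ln (2 * pi))) / of_real pi * Z * (\<i> / 2 * exp (- (\<i> * of_real pi * s / 2)))) * (1 + u) * (1 - exp (\<i> * of_real pi * s))"
    unfolding zeta_chi_eq_Gamma_sin[OF Ims] G sn by (simp only: mult_ac times_divide_eq_left times_divide_eq_right)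
  then show ?thesis unfolding Zeq using that nu ne2 by blast
qed

lemma riemann_aux_expansion:
  assumes big: "norm \<eta> \<ge> 64 * exp 16"
  obtains U where
    "riemann_aux s = - zeta_chi s * \<eta> powr (s - 1) * exp (- of_real pi * \<i> * \<eta>\<^sup>2)
       * (of_real (sqrt 2) * exp (3 * of_real pi * \<i> / 8) * sin (of_real pi * \<eta>) / (2 * cos (2 * of_real pi * \<eta>)))
       * (1 + U)"
    "norm U \<le> expansion_const * (1 + 1 / Im \<eta>) ^ 5 / norm \<eta>"
proof -
  define H where "H = (1 + 1 / Im \<eta>) ^ 5"
  have H: "H \<ge> 1" unfolding H_def using Im_pos by (intro one_le_power) simp
  have ne: "norm \<eta> > 0" using eta_nz by simp
  obtain V where V: "riemann_aux s = phase \<eta> * main_term * (1 + V)" "norm V \<le> 4 * error_const * H / norm \<eta>"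
    using riemann_aux_main_term unfolding H_def by blast
  obtain u where u: "zeta_chi s = cis (pi / 4) * exp ((1 - 2 * s) * Ln \<eta> + 2 * of_real pi * \<i> * \<eta>\<^sup>2) * (1 + u) * (1 - exp (\<i> * of_real pi * s))"
    "norm u \<le> 16 * exp 16 / norm \<eta>" "norm (exp (\<i> * of_real pi * s)) \<le> 1 / norm \<eta>"
    by (rule zeta_chi_asymptotic)
  define e where "e = exp (\<i> * of_real pi * s)"
  define W where "W = (1 + u) * (1 - e)"
  define F where "F = - zeta_chi s * \<eta> powr (s - 1) * exp (- of_real pi * \<i> * \<eta>\<^sup>2)
       * (of_real (sqrt 2) * exp (3 * of_real pi * \<i> / 8) * sin (of_real pi * \<eta>) / (2 * cos (2 * of_real pi * \<eta>)))"
  have FW: "F = phase \<eta> * main_term * W"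
  proof -
    have e1: "\<eta> powr (s - 1) = exp ((s - 1) * Ln \<eta>)" using eta_nz by (simp add: powr_def)
    \<comment> \<open>Adding the exponents from \<open>zeta_chi\<close>, the power of \<eta> and the
      exponential reproduces the exponent of \<open>phase \<eta>\<close>; the remaining constants
      combine through \<open>pi / 4 + 3 * pi / 8 = 5 * pi / 8\<close>.\<close>
    have e2: "(1 - 2 * s) * Ln \<eta> + 2 * of_real pi * \<i> * \<eta>\<^sup>2 + (s - 1) * Ln \<eta> + - of_real pi * \<i> * \<eta>\<^sup>2
        = - s * Ln \<eta> + of_real pi * \<i> * \<eta>\<^sup>2" by (simp add: algebra_simps)
    have e3: "exp ((1 - 2 * s) * Ln \<eta> + 2 * of_real pi * \<i> * \<eta>\<^sup>2) * exp ((s - 1) * Ln \<eta>) * exp (- of_real pi * \<i> * \<eta>\<^sup>2) = phase \<eta>"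
      unfolding phase_eq_exp[OF eta_nz] e2[symmetric] by (simp only: exp_add)
    have c38: "exp (3 * of_real pi * \<i> / 8) = cis (3 * pi / 8)" by (simp add: cis_conv_exp mult_ac)
    have c58: "cis (pi / 4) * cis (3 * pi / 8) = cis (5 * pi / 8)" by (simp add: cis_mult)
    have s2: "complex_of_real (sqrt 2) / 2 = 1 / of_real (sqrt 2)"
    proof -
      have "sqrt 2 / 2 = 1 / sqrt (2::real)" by (simp add: field_simps)
      then have "complex_of_real (sqrt 2 / 2) = of_real (1 / sqrt 2)" by (simp only:)
      then show ?thesis by simp
    qed
    define S where "S = sin (of_real pi * \<eta>)"
    define C where "C = cos (2 * of_real pi * \<eta>)"
    define X where "X = exp ((1 - 2 * s) * Ln \<eta> + 2 * of_real pi * \<i> * \<eta>\<^sup>2)"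
    define Y where "Y = exp (- of_real pi * \<i> * \<eta>\<^sup>2)"
    define P where "P = exp ((s - 1) * Ln \<eta>)"
    have "F = - (X * P * Y) * (cis (pi / 4) * cis (3 * pi / 8)) * (of_real (sqrt 2) / 2) * (S / C) * W"
      unfolding F_def u(1) e1 c38 W_def e_def S_def[symmetric] C_def[symmetric] X_def[symmetric] Y_def[symmetric] P_def[symmetric]
      by (simp add: mult_ac)
    also have "X * P * Y = phase \<eta>" unfolding X_def P_def Y_def by (rule e3)
    finally show ?thesis unfolding c58 s2 main_term_def S_def C_def by simp
  qed
  have small: "norm u \<le> 1/4" "norm e \<le> 1/4"
  proof -
    have "16 * exp 16 / norm \<eta> \<le> 1/4" using big ne by (simp add: divide_le_eq)
    then show "norm u \<le> 1/4" using u(2) by linarith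
    have "norm \<eta> \<ge> 4" using norm_eta_ge Re_ge by linarith
    then have "1 / norm \<eta> \<le> 1/4" using ne by (simp add: divide_le_eq)
    then show "norm e \<le> 1/4" using u(3) unfolding e_def by linarith
  qed
  have W: "norm W \<ge> 1/2"
  proof -
    have "norm (1 + u) \<ge> 3/4" using norm_diff_ineq[of 1 u] small by simp
    moreover have "norm (1 - e) \<ge> 3/4" using norm_triangle_ineq2[of 1 e] small by simp
    ultimately have "3/4 * (3/4) \<le> norm (1 + u) * norm (1 - e)" by (intro mult_mono) auto
    then show ?thesis by (simp add: W_def norm_mult)
  qed
  then have W0: "W \<noteq> 0" by auto
  \<comment> \<open>Forced by \<open>1 + V = W * (1 + U)\<close>.\<close>
  define U where "U = (1 + V - W) / W"
  have "riemann_aux s = F * (1 + U)"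
    unfolding V(1) FW U_def using W0 by (simp add: field_simps)
  moreover have "norm U \<le> expansion_const * H / norm \<eta>"
  proof -
    have "norm (1 + V - W) = norm (V - u + e * (1 + u))"
      by (simp add: W_def algebra_simps)
    also have "\<dots> \<le> norm V + norm u + norm e * norm (1 + u)"
      using norm_triangle_ineq[of "V - u" "e * (1 + u)"] norm_triangle_ineq4[of V u] by (simp add: norm_mult)
    also have "norm e * norm (1 + u) \<le> norm e * 2"
      using small norm_triangle_ineq[of 1 u] by (intro mult_left_mono) auto
    finally have "norm (1 + V - W) \<le> norm V + norm u + 2 * norm e" by simp
    also have "\<dots> \<le> 4 * error_const * H / norm \<eta> + 16 * exp 16 / norm \<eta> + 2 * (1 / norm \<eta>)"
      using V(2) u(2,3) by (intro add_mono mult_left_mono) (auto simp: e_def)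
    also have "\<dots> = (4 * error_const * H + (16 * exp 16 + 2) * 1) / norm \<eta>"
      by (simp add: add_divide_distrib)
    also have "\<dots> \<le> (4 * error_const * H + (16 * exp 16 + 4) * H) / norm \<eta>"
      using H ne by (intro divide_right_mono add_left_mono mult_mono) auto
    finally have num: "norm (1 + V - W) \<le> (4 * error_const * H + (16 * exp 16 + 4) * H) / norm \<eta>" .
    have "norm U = norm (1 + V - W) / norm W" by (simp add: U_def norm_divide)
    also have "\<dots> \<le> ((4 * error_const * H + (16 * exp 16 + 4) * H) / norm \<eta>) / (1/2)"
      by (rule frac_le[OF order_trans[OF norm_ge_zero num] num _ W]) simp
    also have "\<dots> = expansion_const * H / norm \<eta>"
      by (simp add: expansion_const_def algebra_simps)
    finally show ?thesis .
  qed
  ultimately show ?thesis using that[of U] by (simp only: F_def H_def)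
qed

end

section \<open>The range of parameters\<close>

lemma saddle_eta_eqI:
  assumes "w\<^sup>2 = (s - 1) / (2 * of_real pi * \<i>)" "Re w + Im w > 0"
  shows "saddle_eta s = w"
  unfolding saddle_eta_def
proof (rule the_equality)
  fix v assume v: "v\<^sup>2 = (s - 1) / (2 * of_real pi * \<i>) \<and> Re v + Im v > 0"
  then have "v\<^sup>2 = w\<^sup>2" using assms(1) by simp
  then have "v = w \<or> v = - w" by (simp add: power2_eq_iff)
  then show "v = w" using v assms(2) by auto
qed (use assms in auto)

text \<open>The first summand gives \<open>sqrt t / 3 \<ge> 64 * exp 16\<close>, which makes the
  Stirling error small; the second gives \<open>t powr (1/5) \<ge> 600\<close>, which yields the
  smallness condition on \<open>Im \<eta>\<close>.\<close>

definition threshold :: real where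
  "threshold = (192 * exp 16)\<^sup>2 + 600 ^ 5"

lemma threshold_ge: "threshold \<ge> 600 ^ 5" "threshold \<ge> 1"
proof -
  show *: "threshold \<ge> 600 ^ 5" unfolding threshold_def by simp
  have "(600::real) ^ 5 \<ge> 1" by (rule one_le_power) simp
  then show "threshold \<ge> 1" using * by (rule order_trans)
qed

text \<open>The real part of \<open>\<eta>\<^sup>2\<close> is \<open>t / (2 * pi)\<close> and fixes
  the order \<open>sqrt t\<close> of \<open>Re \<eta>\<close>. Its imaginary part is
  \<open>(1 - \<sigma>) / (2 * pi)\<close>, so the upper and lower bounds on 1 - \<sigma> become
  upper and lower bounds on \<open>Im \<eta>\<close>.\<close>

lemma saddle_regime:
  fixes \<epsilon> \<delta> \<sigma> t :: real
  assumes \<epsilon>: "2/5 < \<epsilon>" and \<delta>: "\<delta> < 1 - \<epsilon>"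
    and t: "t \<ge> threshold" and up: "t powr \<delta> \<ge> 1 - \<sigma>" and lo: "1 - \<sigma> \<ge> t powr \<epsilon>"
    and \<epsilon>2: "\<epsilon> < 1/2"
  obtains \<eta> where "saddle \<eta>" "saddle.s \<eta> = Complex \<sigma> t" "saddle_eta (Complex \<sigma> t) = \<eta>"
    "norm \<eta> \<ge> 64 * exp 16" "(1 + 1 / Im \<eta>) ^ 5 / norm \<eta> \<le> 3 * 17 ^ 5 * t powr (2 - 5 * \<epsilon>)"
proof -
  define \<eta> where "\<eta> = csqrt (Complex (t / (2 * pi)) ((1 - \<sigma>) / (2 * pi)))"
  define p where "p = Re \<eta>"
  define b where "b = Im \<eta>"
  \<comment> \<open>since \<open>\<delta> < 3/5\<close>, all the required bounds become polynomial inequalities in \<open>y\<close>\<close>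
  define y where "y = t powr (1/10)"
  have t1: "t \<ge> 1" using threshold_ge(2) t by (rule order_trans)
  have sq: "\<eta>\<^sup>2 = Complex (t / (2 * pi)) ((1 - \<sigma>) / (2 * pi))" by (simp add: \<eta>_def)
  have re: "p\<^sup>2 - b\<^sup>2 = t / (2 * pi)" and im: "2 * p * b = (1 - \<sigma>) / (2 * pi)"
    using arg_cong[OF sq, of Re] arg_cong[OF sq, of Im] by (simp_all add: p_def b_def power2_eq_square mult_ac)
  have te: "t powr \<epsilon> \<ge> 1" using t1 \<epsilon> by (intro ge_one_powr_ge_zero) auto
  then have \<sigma>1: "1 - \<sigma> \<ge> 1" using lo by linarith
  have prod: "4 * pi * p * b = 1 - \<sigma>" using im by (simp add: field_simps)
  have p0: "p > 0"
  proof -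
    have "p * b \<noteq> 0" using prod \<sigma>1 by auto
    moreover have "0 < Re \<eta> \<or> Re \<eta> = 0 \<and> 0 \<le> Im \<eta>" unfolding \<eta>_def by (rule csqrt_principal)
    ultimately show ?thesis by (auto simp: p_def)
  qed
  have b0: "b > 0"
  proof -
    have "(4 * pi * p) * b > 0" using prod \<sigma>1 by simp
    then show ?thesis by (rule zero_less_mult_pos) (use p0 in simp)
  qed
  have y1: "y \<ge> 1" unfolding y_def using t1 by (intro ge_one_powr_ge_zero) auto
  have yn: "y ^ n = t powr (real n / 10)" for n
    using t1 by (simp add: y_def powr_powr flip: powr_realpow)
  have y5: "y ^ 5 = sqrt t" using yn[of 5] t1 by (simp add: powr_half_sqrt)
  have y10: "y ^ 10 = t" using yn[of 10] t1 by simp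
  have y2: "y\<^sup>2 \<ge> 600"
  proof -
    have "(600::real) ^ 5 \<le> t" using threshold_ge(1) t by (rule order_trans)
    also have "t = (y\<^sup>2) ^ 5" using y10 by (simp flip: power_mult)
    finally show ?thesis by (rule power_le_imp_le_base[of _ 4, simplified]) simp
  qed
  have st: "192 * exp 16 \<le> sqrt t"
    by (rule real_le_rsqrt) (use t in \<open>simp add: threshold_def\<close>)
  have p_lo: "y ^ 5 / 3 \<le> p"
  proof (rule power2_le_imp_le)
    have "(y ^ 5 / 3)\<^sup>2 = t / 9" using y10 by (simp add: power_divide flip: power_mult)
    also have "\<dots> \<le> t / (2 * pi)" using pi_less_4 t1 by (intro divide_left_mono) auto
    also have "\<dots> \<le> p\<^sup>2" using re zero_le_power2[of b] by linarith
    finally show "(y ^ 5 / 3)\<^sup>2 \<le> p\<^sup>2" .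
  qed (use p0 in simp)
  have b_up: "b \<le> y / 4"
  proof -
    have "4 * b * y ^ 5 = 4 * 3 * b * (y ^ 5 / 3)" by simp
    also have "\<dots> \<le> 4 * pi * b * p"
      using p_lo b0 y1 pi_gt3 by (intro mult_mono) auto
    also have "\<dots> = 1 - \<sigma>" using prod by (simp add: mult_ac)
    also have "\<dots> \<le> t powr \<delta>" by (rule up)
    also have "\<dots> \<le> t powr (real 6 / 10)" using t1 \<epsilon> \<delta> by (intro powr_mono) auto
    also have "\<dots> = y * y ^ 5" unfolding yn[symmetric] by (simp add: eval_nat_numeral)
    finally have "(4 * b) * y ^ 5 \<le> y * y ^ 5" .
    then have "4 * b \<le> y" by (rule mult_right_le_imp_le) (use y1 in simp)
    then show ?thesis by simp
  qed
  have p_up: "p \<le> y ^ 5"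
  proof (rule power2_le_imp_le)
    have "p\<^sup>2 = t / (2 * pi) + b\<^sup>2" using re by simp
    also have "t / (2 * pi) \<le> t / 6" using pi_gt3 t1 by (intro divide_left_mono) auto
    also have "b\<^sup>2 \<le> (y / 4)\<^sup>2" using b_up b0 by (intro power_mono) auto
    also have "(y / 4)\<^sup>2 \<le> t / 16"
    proof -
      have "y\<^sup>2 \<le> y ^ 10" using y1 by (intro power_increasing) auto
      then show ?thesis using y10 by (simp add: power_divide)
    qed
    also have "t / 6 + t / 16 \<le> t" using t1 by simp
    also have "t = (y ^ 5)\<^sup>2" using y10 by (simp flip: power_mult)
    finally show "p\<^sup>2 \<le> (y ^ 5)\<^sup>2" by simp
  qed (use y1 in simp)
  have big: "p \<ge> 64 * exp 16" using p_lo st unfolding y5 by simp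
  have e16: "exp 16 \<ge> (17::real)" using exp_ge_add_one_self[of "16::real"] by simp
  have sad: "saddle \<eta>"
  proof
    show "Im \<eta> > 0" using b0 by (simp add: b_def)
    show "Re \<eta> \<ge> 100" using big e16 unfolding p_def by linarith
    show "4 * pi * Re \<eta> * Im \<eta> \<ge> 1" using prod \<sigma>1 by (simp add: p_def b_def)
    \<comment> \<open>The left side is of order \<open>y ^ 3\<close> while \<open>Re \<eta>\<close>
      is of order \<open>y ^ 5\<close>; the spare factor \<open>y\<^sup>2 \<ge> 600\<close> covers
      the constants.\<close>
    have "b \<le> y" using b_up y1 by simp
    then have "b + b ^ 3 \<le> y + y ^ 3" using b0 by (intro add_mono power_mono) auto
    also have "\<dots> \<le> 2 * y ^ 3" using power_increasing[of 1 3 y] y1 by simp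
    finally have "100 * (b + b ^ 3) \<le> 600 * y ^ 3 / 3" by simp
    also have "\<dots> \<le> y\<^sup>2 * y ^ 3 / 3" using y2 y1 by (intro divide_right_mono mult_right_mono) auto
    also have "y\<^sup>2 * y ^ 3 = y ^ 5" by (simp flip: power_add)
    finally show "100 * (Im \<eta> + Im \<eta> ^ 3) \<le> Re \<eta>" using p_lo by (simp add: p_def b_def)
  qed
  have s: "saddle.s \<eta> = Complex \<sigma> t"
    unfolding saddle.s_def[OF sad] sq by (simp add: complex_eq_iff)
  have eta: "saddle_eta (Complex \<sigma> t) = \<eta>"
  proof (rule saddle_eta_eqI)
    have "2 * of_real pi * \<i> * \<eta>\<^sup>2 = Complex \<sigma> t - 1"
      using s unfolding saddle.s_def[OF sad] by (simp add: eq_diff_eq add.commute)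
    then show "\<eta>\<^sup>2 = (Complex \<sigma> t - 1) / (2 * of_real pi * \<i>)"
      by (simp add: eq_divide_eq mult.commute)
    show "Re \<eta> + Im \<eta> > 0" using p0 b0 by (simp add: p_def b_def)
  qed
  have n1: "norm \<eta> \<ge> p" unfolding p_def by (rule complex_Re_le_cmod)
  define T where "T = t powr (1/2 - \<epsilon>)"
  have T1: "T \<ge> 1" unfolding T_def using t1 \<epsilon>2 by (intro ge_one_powr_ge_zero) auto
  \<comment> \<open>\<open>b\<close> is \<open>1 - \<sigma>\<close> divided by
    \<open>4 * pi * p\<close>, with numerator at least \<open>t powr \<epsilon>\<close> and
    \<open>p \<le> sqrt t\<close>; 16 bounds \<open>4 * pi\<close>.\<close>
  have "1 / b \<le> 16 * T"
  proof -
    have "t powr \<epsilon> \<le> 4 * pi * p * b" using lo prod by simp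
    also have "\<dots> \<le> 4 * 4 * y ^ 5 * b"
      using pi_less_4 p_up b0 p0 y1 by (intro mult_mono) auto
    finally have "t powr \<epsilon> \<le> 16 * sqrt t * b" by (simp add: y5)
    moreover have "sqrt t = T * t powr \<epsilon>" using t1 by (simp add: T_def powr_half_sqrt flip: powr_add)
    ultimately have "1 * t powr \<epsilon> \<le> (16 * T * b) * t powr \<epsilon>" by (simp add: mult_ac)
    then have "1 \<le> 16 * T * b" by (rule mult_right_le_imp_le) (use t1 in simp)
    then show ?thesis using b0 by (simp add: divide_le_eq)
  qed
  then have "1 + 1 / b \<le> 17 * T" using T1 by simp
  then have "(1 + 1 / b) ^ 5 \<le> (17 * T) ^ 5" using b0 by (intro power_mono) auto
  moreover have "sqrt t / 3 \<le> norm \<eta>" using p_lo n1 y5 by simp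
  ultimately have "(1 + 1 / b) ^ 5 / norm \<eta> \<le> (17 * T) ^ 5 / (sqrt t / 3)"
    using t1 T1 by (intro frac_le) auto
  also have "\<dots> = 3 * 17 ^ 5 * (T ^ 5 / sqrt t)" by (simp add: power_mult_distrib)
  also have "T ^ 5 / sqrt t = t powr (2 - 5 * \<epsilon>)"
  proof -
    have "T ^ 5 = t powr (5 * (1/2 - \<epsilon>))"
      using t1 powr_power[of t "1/2 - \<epsilon>" 5] by (simp add: T_def mult.commute)
    moreover have "sqrt t = t powr (1/2)" using t1 by (simp add: powr_half_sqrt)
    ultimately have "T ^ 5 / sqrt t = t powr (5 * (1/2 - \<epsilon>) - 1/2)" by (simp only: powr_diff)
    also have "5 * (1/2 - \<epsilon>) - 1/2 = 2 - 5 * \<epsilon>" by simp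
    finally show ?thesis .
  qed
  finally have "(1 + 1 / Im \<eta>) ^ 5 / norm \<eta> \<le> 3 * 17 ^ 5 * t powr (2 - 5 * \<epsilon>)" by (simp add: b_def)
  moreover have "norm \<eta> \<ge> 64 * exp 16" using big n1 by linarith
  ultimately show ?thesis using that sad s eta by blast
qed

lemma expansion_const_nonneg: "expansion_const \<ge> 0"
  unfolding expansion_const_def using error_const_nonneg by (intro add_nonneg_nonneg) auto

theorem theorem8:
  fixes \<epsilon> :: real
  assumes "2/5 < \<epsilon>" and "\<epsilon> < 1/2"
  shows "(\<exists>\<delta> \<alpha> :: real. \<delta> > 0 \<and> \<alpha> > 0 \<and>
             2/5 < \<epsilon> \<and> \<epsilon> < 1/2 \<and> 1/2 < \<delta> \<and> \<delta> < 1 - \<epsilon> \<and> 1 - \<epsilon> < 1 \<and>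
             0 < 1/2 - \<epsilon> \<and> 1/2 - \<epsilon> < \<alpha> \<and> \<alpha> < \<epsilon> / 4 \<and> \<epsilon> / 4 < 1/6)
       \<and> (\<forall>\<delta> \<alpha> :: real.
             2/5 < \<epsilon> \<and> \<epsilon> < 1/2 \<and> 1/2 < \<delta> \<and> \<delta> < 1 - \<epsilon> \<and> 1 - \<epsilon> < 1 \<and>
             0 < 1/2 - \<epsilon> \<and> 1/2 - \<epsilon> < \<alpha> \<and> \<alpha> < \<epsilon> / 4 \<and> \<epsilon> / 4 < 1/6 \<longrightarrow>
             (\<exists>t\<^sub>0 A :: real. t\<^sub>0 \<ge> 1 \<and>
               (\<forall>(\<sigma> :: real) (t :: real) (s :: complex).
                  s = Complex \<sigma> t \<and> t \<ge> t\<^sub>0 \<and> t powr \<delta> \<ge> 1 - \<sigma> \<and> 1 - \<sigma> \<ge> t powr \<epsilon> \<longrightarrow>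
                  (\<exists>U :: complex.
                     riemann_aux s =
                       - zeta_chi s * saddle_eta s powr (s - 1)
                         * exp (- of_real pi * \<i> * (saddle_eta s)\<^sup>2)
                         * (of_real (sqrt 2) * exp (3 * of_real pi * \<i> / 8)
                              * sin (of_real pi * saddle_eta s)
                            / (2 * cos (2 * of_real pi * saddle_eta s)))
                         * (1 + U)
                     \<and> norm U \<le> A * t powr (4 * \<alpha> - \<epsilon>)))))"
proof (intro conjI allI impI)
  \<comment> \<open>The witnesses are midpoints: \<delta> of the interval from 1/2 to 1 -
    \<epsilon>, \<alpha> of that from 1/2 - \<epsilon> to \<epsilon>/4, which is nonempty because
    \<epsilon> > 2/5.\<close>
  show "\<exists>\<delta> \<alpha> :: real. \<delta> > 0 \<and> \<alpha> > 0 \<and>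
             2/5 < \<epsilon> \<and> \<epsilon> < 1/2 \<and> 1/2 < \<delta> \<and> \<delta> < 1 - \<epsilon> \<and> 1 - \<epsilon> < 1 \<and>
             0 < 1/2 - \<epsilon> \<and> 1/2 - \<epsilon> < \<alpha> \<and> \<alpha> < \<epsilon> / 4 \<and> \<epsilon> / 4 < 1/6"
    by (rule exI[of _ "(1/2 + (1 - \<epsilon>)) / 2"], rule exI[of _ "((1/2 - \<epsilon>) + \<epsilon> / 4) / 2"])
       (use assms in auto)
next
  fix \<delta> \<alpha> :: real
  assume h: "2/5 < \<epsilon> \<and> \<epsilon> < 1/2 \<and> 1/2 < \<delta> \<and> \<delta> < 1 - \<epsilon> \<and> 1 - \<epsilon> < 1 \<and>
             0 < 1/2 - \<epsilon> \<and> 1/2 - \<epsilon> < \<alpha> \<and> \<alpha> < \<epsilon> / 4 \<and> \<epsilon> / 4 < 1/6"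
  note t01 = threshold_ge(2)
  \<comment> \<open>Both this constant and \<open>threshold\<close> are absolute numbers,
    independent of \<epsilon>, \<delta> and \<alpha> as well.\<close>
  define A where "A = expansion_const * (3 * 17 ^ 5)"
  have "\<exists>U. riemann_aux s =
              - zeta_chi s * saddle_eta s powr (s - 1)
                * exp (- of_real pi * \<i> * (saddle_eta s)\<^sup>2)
                * (of_real (sqrt 2) * exp (3 * of_real pi * \<i> / 8)
                     * sin (of_real pi * saddle_eta s)
                   / (2 * cos (2 * of_real pi * saddle_eta s)))
                * (1 + U)
            \<and> norm U \<le> A * t powr (4 * \<alpha> - \<epsilon>)"
    if st: "s = Complex \<sigma> t \<and> t \<ge> threshold \<and> t powr \<delta> \<ge> 1 - \<sigma> \<and> 1 - \<sigma> \<ge> t powr \<epsilon>" for \<sigma> t s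
  proof -
    have t: "t \<ge> threshold" "t powr \<delta> \<ge> 1 - \<sigma>" "1 - \<sigma> \<ge> t powr \<epsilon>" and s: "s = Complex \<sigma> t"
      using st by auto
    obtain \<eta> where \<eta>: "saddle \<eta>" "saddle.s \<eta> = Complex \<sigma> t" "saddle_eta (Complex \<sigma> t) = \<eta>"
      "norm \<eta> \<ge> 64 * exp 16" "(1 + 1 / Im \<eta>) ^ 5 / norm \<eta> \<le> 3 * 17 ^ 5 * t powr (2 - 5 * \<epsilon>)"
      using saddle_regime[OF assms(1) _ t assms(2)] h by blast
    have ss: "saddle.s \<eta> = s" "saddle_eta s = \<eta>" using \<eta> s by auto
    obtain U where U: "riemann_aux s = - zeta_chi s * \<eta> powr (s - 1) * exp (- of_real pi * \<i> * \<eta>\<^sup>2)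
       * (of_real (sqrt 2) * exp (3 * of_real pi * \<i> / 8) * sin (of_real pi * \<eta>) / (2 * cos (2 * of_real pi * \<eta>)))
       * (1 + U)" "norm U \<le> expansion_const * (1 + 1 / Im \<eta>) ^ 5 / norm \<eta>"
      using saddle.riemann_aux_expansion[OF \<eta>(1,4)] unfolding ss(1) by blast
    have "norm U \<le> expansion_const * ((1 + 1 / Im \<eta>) ^ 5 / norm \<eta>)" using U(2) by simp
    also have "\<dots> \<le> expansion_const * (3 * 17 ^ 5 * t powr (2 - 5 * \<epsilon>))"
      by (intro mult_left_mono \<eta>(5) expansion_const_nonneg)
    \<comment> \<open>Since \<open>t \<ge> 1\<close>, this is the inequality 2 - 5\<epsilon> \<le>
      4\<alpha> - \<epsilon>, that is \<alpha> \<ge> 1/2 - \<epsilon>.\<close>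
    also have "\<dots> \<le> expansion_const * (3 * 17 ^ 5 * t powr (4 * \<alpha> - \<epsilon>))"
      using t(1) t01 h by (intro mult_left_mono powr_mono expansion_const_nonneg) auto
    finally have "norm U \<le> A * t powr (4 * \<alpha> - \<epsilon>)" by (simp add: A_def mult_ac)
    then show ?thesis using U(1) unfolding ss(2) by blast
  qed
  then show "\<exists>t\<^sub>0 A :: real. t\<^sub>0 \<ge> 1 \<and>
               (\<forall>(\<sigma> :: real) (t :: real) (s :: complex).
                  s = Complex \<sigma> t \<and> t \<ge> t\<^sub>0 \<and> t powr \<delta> \<ge> 1 - \<sigma> \<and> 1 - \<sigma> \<ge> t powr \<epsilon> \<longrightarrow>
                  (\<exists>U :: complex.
                     riemann_aux s =
                       - zeta_chi s * saddle_eta s powr (s - 1)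
                         * exp (- of_real pi * \<i> * (saddle_eta s)\<^sup>2)
                         * (of_real (sqrt 2) * exp (3 * of_real pi * \<i> / 8)
                              * sin (of_real pi * saddle_eta s)
                            / (2 * cos (2 * of_real pi * saddle_eta s)))
                         * (1 + U)
                     \<and> norm U \<le> A * t powr (4 * \<alpha> - \<epsilon>)))"
    using t01 by blast
qed

end
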